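(* Let $(y_\gamma^n,\xi_\gamma^n,u_\gamma^n)$ be a solution of problem $(\mathcal O^n_\gamma)$. Then there exists a Lagrange multiplier vector $(p_\gamma^n,\lambda_\gamma^n)\in\mathcal V\times L^2(\Omega)$ such that the following first order optimality system holds: $$Ay_\gamma^n-Bu_\gamma^n-\xi_\gamma^n-\overline{y}^{\,n-1}+\overline{\xi}^{\,n-1}=0\quad\text{in }\mathcal V',$$ $$Ap_\gamma^n+y_\gamma^n-y_d^n+\gamma\xi_\gamma^n-\lambda_\gamma^n=0\quad\text{in }\mathcal V',$$ $$y_\gamma^n+\varepsilon_\gamma\xi_\gamma^n\ge0,\qquad\lambda_\gamma^n\ge0,\qquad(y_\gamma^n+\varepsilon_\gamma\xi_\gamma^n,\ \lambda_\gamma^n)=0,$$ $$\xi_\gamma^n\ge0,\qquad\big(\xi_\gamma^n-\xi_d^n+2\gamma\varepsilon_\gamma\xi_\gamma^n+\gamma y_\gamma^n-p_\gamma^n-\varepsilon_\gamma\lambda_\gamma^n,\ \eta-\xi_\gamma^n\big)\ge0,$$ $$u_\gamma^n\ge0,\qquad\big(\nu u_\gamma^n-\tau B^*p_\gamma^n,\ v-u_\gamma^n\big)_{\Gamma_C}\ge0,$$ where $\eta$ and $v$ are two arbitrary non-negative functions in $L^2(\Omega)$ and $L^2(\Gamma_C)$ respectively. The sign conditions are understood a.e. in $\Omega$ (for $y_\gamma^n+\varepsilon_\gamma\xi_\gamma^n$, $\lambda_\gamma^n$ and $\xi_\gamma^n$) and a.e. in $\Gamma_C$ (for $u_\gamm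a^n$).
   Context: $\Omega\subset\mathbb R^d$ ($d=1,2$) is a bounded open set with smooth boundary $\Gamma$, on which three parts $\Gamma_N,\Gamma_D,\Gamma_C$ are distinguished. The inner products of $L^2(\Omega)$ and $L^2(\Gamma_C)$ are $(\cdot,\cdot)$ and $(\cdot,\cdot)_{\Gamma_C}$, with norms $\|\cdot\|$ and $\|\cdot\|_{\Gamma_C}$; $\|\cdot\|_{H^1(\Omega)}$ is the $H^1(\Omega)$ norm. The space $\mathcal V:=\{\phi\in H^1(\Omega):\phi=0\text{ on }\Gamma_D\}$ carries the $H^1(\Omega)$ norm; $\mathcal V'$ is its dual and $\langle\cdot,\cdot\rangle$ the duality pairing. Elements $f\in L^2(\Omega)$ are regarded as elements of $\mathcal V'$ via $\phi\mapsto(f,\phi)$. $\gamma_0$ is the trace operator on $H^1(\Omega)$. Fix a time step index $n$ and a time step size $\tau>0$, with $t^n$ the corresponding discrete time. The bounded linear operators $B:L^2(\Gamma_C)\to\mathcal V'$ and $A:\mathcal V\to\mathcal V'$ are defined by $$\langle Bv,\phi\rangle:=\tau(v,\gamma_0\phi)_{\Gamma_C},\qquad \langle A\psi,\phi\rangle:=(\psi,\phi)+\tau(\kappa^n\nabla\psi,\nabla\phi),$$ where $\kappa^n\in L^\infty(\Omega)$ is such that $A$ is uniformly coercive on $\mathcal V$ with a constant $\underline\kappa>0$. $B^*$ is the adjoint operator of $B$, i.e. $(v,B^*p)_{\Gamma_C}=\langle Bv,p\rangle$ for $v\in L^2(\Gamma_C)$, $p\in\mathcal V$. For a given convection velocity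 $\vec v(x,t)$, let $X^n(x):=x-\tau\,\vec v(x,t^n)$; it is assumed that $X^n$ maps $\Omega$ to itself. The previous temperature $y^{n-1}\in\mathcal V$ and previous solid fraction $\xi^{n-1}\in L^2(\Omega)$ are given, and $\overline{y}^{\,n-1}:=y^{n-1}\circ X^n$, $\overline{\xi}^{\,n-1}:=\xi^{n-1}\circ X^n$, understood as elements of $L^2(\Omega)$. The desired states $y_d^n\in H^1(\Omega)$ and $\xi_d^n\in L^2(\Omega)$ are given, and $\nu>0$ is a regularization parameter. The parameters $\gamma>0$ and $\varepsilon_\gamma>0$ are such that $\varepsilon_\gamma\to0$ and $\varepsilon_\gamma\gamma\to0$ as $\gamma\to\infty$. Problem $(\mathcal O^n_\gamma)$: minimize $$J_\gamma(y^n,\xi^n,u^n):=\tfrac12\|y^n-y_d^n\|_{H^1(\Omega)}^2+\tfrac12\|\xi^n-\xi_d^n\|^2+\tfrac{\nu}{2}\|u^n\|_{\Gamma_C}^2+\gamma(\xi^n,\,y^n+\varepsilon_\gamma\xi^n)$$ over $(y^n,\xi^n,u^n)\in\mathcal V\times L^2(\Omega)\times L^2(\Gamma_C)$ subject to $Ay^n=Bu^n+\xi^n+\overline{y}^{\,n-1}-\overline{\xi}^{\,n-1}$ in $\mathcal V'$, $y^n+\varepsilon_\gamma\xi^n\ge0$ a.e. in $\Omega$, $\xi^n\ge0$ a.e. in $\Omega$, and $u^n\ge0$ a.e. in $\Gamma_C$.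
   Formalization: In the adjoint equation y−y_d acts on test functions through the H^1(Ω) inner product (derivative of the H^1 cost term), not the L^2 one, and the control inequality has νu−B*p instead of νu−τB*p, since B* already contains τ; as printed both formulas fail. *)

theory Defs
  imports "HOL-Analysis.Analysis"
begin

subsection \<open>Smooth functions and domains with smooth boundary\<close>

primrec Ck_on :: "nat \<Rightarrow> ('a::euclidean_space \<Rightarrow> real) \<Rightarrow> 'a set \<Rightarrow> bool" where
  "Ck_on 0 f S \<longleftrightarrow> continuous_on S f"
| "Ck_on (Suc k) f S \<longleftrightarrow>
     (\<exists>g. (\<forall>x\<in>S. GDERIV f x :> g x) \<and> (\<forall>i\<in>Basis. Ck_on k (\<lambda>x. g x \<bullet> i) S))"

definition smooth_on :: "'a::euclidean_space set \<Rightarrow> ('a \<Rightarrow> real) \<Rightarrow> bool" where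
  "smooth_on S f \<longleftrightarrow> (\<forall>k. Ck_on k f S)"

text \<open>Near each boundary point, the domain is the negativity set of a smooth function with
  nonvanishing gradient; in particular the domain lies locally on one side of its boundary.\<close>

definition smooth_boundary :: "'a::euclidean_space set \<Rightarrow> bool" where
  "smooth_boundary \<Omega> \<longleftrightarrow>
     (\<forall>x\<in>frontier \<Omega>. \<exists>U \<rho> D. open U \<and> x \<in> U \<and> smooth_on U \<rho> \<and>
        GDERIV \<rho> x :> D \<and> D \<noteq> 0 \<and> \<Omega> \<inter> U = {y\<in>U. \<rho> y < 0})"

definition test_functions :: "'a::euclidean_space set \<Rightarrow> ('a \<Rightarrow> real) set" where
  "test_functions \<Omega> = {\<phi>. smooth_on UNIV \<phi> \<and>
     compact (closure {x. \<phi> x \<noteq> 0}) \<and> closure {x. \<phi> x \<noteq> 0} \<subseteq> \<Omega>}"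


subsection \<open>Square integrable functions\<close>

text \<open>Elements of an $L^2$ space are represented by functions; equality of elements is equality
  almost everywhere.\<close>

definition L2 :: "'a measure \<Rightarrow> ('a \<Rightarrow> 'b::euclidean_space) set" where
  "L2 M = {f \<in> borel_measurable M. integrable M (\<lambda>x. (norm (f x))\<^sup>2)}"

definition l2_inner :: "'a measure \<Rightarrow> ('a \<Rightarrow> 'b::euclidean_space) \<Rightarrow> ('a \<Rightarrow> 'b) \<Rightarrow> real" where
  "l2_inner M f g = (LINT x|M. f x \<bullet> g x)"

definition l2_norm :: "'a measure \<Rightarrow> ('a \<Rightarrow> 'b::euclidean_space) \<Rightarrow> real" where
  "l2_norm M f = sqrt (l2_inner M f f)"

definition L_infinity :: "'a measure \<Rightarrow> ('a \<Rightarrow> real) set" where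
  "L_infinity M = {f \<in> borel_measurable M. \<exists>K. AE x in M. \<bar>f x\<bar> \<le> K}"


subsection \<open>Surface measure\<close>

text \<open>The $s$-dimensional Hausdorff measure, normalised so that it is the counting measure for
  $s = 0$ and arc length on curves for $s = 1$. Only bounded covering sets are admitted, because
  \<^const>\<open>diameter\<close> is unspecified on unbounded sets; the case distinction is needed
  because \<open>0 ^ 0 = 1\<close>. The Hausdorff outer measure is countably additive on
  the Borel sets, so \<^const>\<open>measure_of\<close> yields its restriction to the Borel sets.\<close>

definition hausdorff_pre :: "nat \<Rightarrow> real \<Rightarrow> 'a::metric_space set \<Rightarrow> ennreal" where
  "hausdorff_pre s \<delta> A =
     (INF C \<in> {C :: nat \<Rightarrow> 'a set. A \<subseteq> (\<Union>i. C i) \<and> (\<forall>i. bounded (C i) \<and> diameter (C i) \<le> \<delta>)}.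
        \<Sum>i. if C i = {} then 0 else ennreal (unit_ball_vol (real s) * (diameter (C i) / 2) ^ s))"

definition hausdorff_outer :: "nat \<Rightarrow> 'a::metric_space set \<Rightarrow> ennreal" where
  "hausdorff_outer s A = (SUP \<delta>\<in>{0<..}. hausdorff_pre s \<delta> A)"

definition hausdorff_measure :: "nat \<Rightarrow> 'a::metric_space measure" where
  "hausdorff_measure s = measure_of UNIV (sets borel) (hausdorff_outer s)"

definition surface :: "'a::euclidean_space set \<Rightarrow> 'a measure" where
  "surface S = restrict_space (hausdorff_measure (DIM('a) - 1)) S"


subsection \<open>The Sobolev space and the trace operator\<close>

definition weak_gradient ::
  "'a::euclidean_space set \<Rightarrow> ('a \<Rightarrow> real) \<Rightarrow> ('a \<Rightarrow> 'a) \<Rightarrow> bool" where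
  "weak_gradient \<Omega> u g \<longleftrightarrow> g \<in> L2 (lebesgue_on \<Omega>) \<and>
     (\<forall>\<phi>\<in>test_functions \<Omega>. \<forall>D. (\<forall>x. GDERIV \<phi> x :> D x) \<longrightarrow>
        (\<forall>i\<in>Basis. (LINT x|lebesgue_on \<Omega>. u x * (D x \<bullet> i)) =
                    - (LINT x|lebesgue_on \<Omega>. (g x \<bullet> i) * \<phi> x)))"

definition H1 :: "'a::euclidean_space set \<Rightarrow> ('a \<Rightarrow> real) set" where
  "H1 \<Omega> = {u \<in> L2 (lebesgue_on \<Omega>). \<exists>g. weak_gradient \<Omega> u g}"

text \<open>A weak gradient is unique up to equality almost everywhere, so the choice of the
  representative does not matter.\<close>

definition grad :: "'a::euclidean_space set \<Rightarrow> ('a \<Rightarrow> real) \<Rightarrow> 'a \<Rightarrow> 'a" where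
  "grad \<Omega> u = (SOME g. weak_gradient \<Omega> u g)"

definition h1_inner :: "'a::euclidean_space set \<Rightarrow> ('a \<Rightarrow> real) \<Rightarrow> ('a \<Rightarrow> real) \<Rightarrow> real" where
  "h1_inner \<Omega> u v =
     l2_inner (lebesgue_on \<Omega>) u v + l2_inner (lebesgue_on \<Omega>) (grad \<Omega> u) (grad \<Omega> v)"

definition h1_norm :: "'a::euclidean_space set \<Rightarrow> ('a \<Rightarrow> real) \<Rightarrow> real" where
  "h1_norm \<Omega> u = sqrt (h1_inner \<Omega> u u)"

text \<open>The trace operator on $H^1(\Omega)$ is the extension by continuity, to all of $H^1(\Omega)$,
  of the restriction map \<open>\<phi> \<mapsto> \<phi>|\<Gamma>\<close> on functions that are smooth up to the boundary: a bounded
  linear operator into $L^2(\Gamma)$ that agrees with the restriction on smooth functions and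
  whose value at each \<open>u\<close> is the limit of restrictions of smooth functions
  converging to \<open>u\<close>. These properties determine it up to equality almost everywhere on the
  boundary.\<close>

definition trace_operator ::
  "'a::euclidean_space set \<Rightarrow> (('a \<Rightarrow> real) \<Rightarrow> ('a \<Rightarrow> real)) \<Rightarrow> bool" where
  "trace_operator \<Omega> T \<longleftrightarrow>
     (\<forall>u\<in>H1 \<Omega>. T u \<in> L2 (surface (frontier \<Omega>))) \<and>
     (\<forall>u\<in>H1 \<Omega>. \<forall>v\<in>H1 \<Omega>. \<forall>a b. AE x in surface (frontier \<Omega>).
        T (\<lambda>x. a * u x + b * v x) x = a * T u x + b * T v x) \<and>
     (\<exists>C. \<forall>u\<in>H1 \<Omega>. l2_norm (surface (frontier \<Omega>)) (T u) \<le> C * h1_norm \<Omega> u) \<and>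
     (\<forall>\<phi>. smooth_on UNIV \<phi> \<longrightarrow> (AE x in surface (frontier \<Omega>). T \<phi> x = \<phi> x)) \<and>
     (\<forall>u\<in>H1 \<Omega>. \<exists>\<Phi> :: nat \<Rightarrow> 'a \<Rightarrow> real. (\<forall>k. smooth_on UNIV (\<Phi> k)) \<and>
        (\<lambda>k. h1_norm \<Omega> (\<lambda>x. \<Phi> k x - u x)) \<longlonglongrightarrow> 0 \<and>
        (\<lambda>k. l2_norm (surface (frontier \<Omega>)) (\<lambda>x. \<Phi> k x - T u x)) \<longlonglongrightarrow> 0)"

definition H1_D ::
  "'a::euclidean_space set \<Rightarrow> 'a set \<Rightarrow> (('a \<Rightarrow> real) \<Rightarrow> ('a \<Rightarrow> real)) \<Rightarrow> ('a \<Rightarrow> real) set" where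
  "H1_D \<Omega> \<Gamma>D \<gamma>0 = {\<phi> \<in> H1 \<Omega>. AE x in surface \<Gamma>D. \<gamma>0 \<phi> x = 0}"


subsection \<open>The operators of the state equation\<close>

text \<open>Elements of the dual of \<^term>\<open>H1_D \<Omega> \<Gamma>D \<gamma>0\<close> are represented by their action on functions
  \<open>\<phi>\<close> of that space; accordingly, an equation in the dual is stated for all such \<open>\<phi>\<close>.\<close>

definition A_op ::
  "'a::euclidean_space set \<Rightarrow> real \<Rightarrow> ('a \<Rightarrow> real) \<Rightarrow> ('a \<Rightarrow> real) \<Rightarrow> ('a \<Rightarrow> real) \<Rightarrow> real" where
  "A_op \<Omega> \<tau> \<kappa> \<psi> \<phi> = l2_inner (lebesgue_on \<Omega>) \<psi> \<phi> +
     \<tau> * l2_inner (lebesgue_on \<Omega>) (\<lambda>x. \<kappa> x *\<^sub>R grad \<Omega> \<psi> x) (grad \<Omega> \<phi>)"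

definition B_op ::
  "'a::euclidean_space set \<Rightarrow> (('a \<Rightarrow> real) \<Rightarrow> ('a \<Rightarrow> real)) \<Rightarrow> real
     \<Rightarrow> ('a \<Rightarrow> real) \<Rightarrow> ('a \<Rightarrow> real) \<Rightarrow> real" where
  "B_op \<Gamma>C \<gamma>0 \<tau> v \<phi> = \<tau> * l2_inner (surface \<Gamma>C) v (\<gamma>0 \<phi>)"

text \<open>The adjoint of \<^const>\<open>B_op\<close>: the element of $L^2(\Gamma_C)$, unique up to equality almost
  everywhere, that represents \<open>v \<mapsto> \<langle>B v, p\<rangle>\<close>. It contains the factor \<open>\<tau>\<close>: it is \<open>\<tau>\<close>
  times the trace of \<open>p\<close> on $\Gamma_C$.\<close>

definition B_adj ::
  "'a::euclidean_space set \<Rightarrow> (('a \<Rightarrow> real) \<Rightarrow> ('a \<Rightarrow> real)) \<Rightarrow> real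
     \<Rightarrow> ('a \<Rightarrow> real) \<Rightarrow> 'a \<Rightarrow> real" where
  "B_adj \<Gamma>C \<gamma>0 \<tau> p = (SOME q. q \<in> L2 (surface \<Gamma>C) \<and>
     (\<forall>v\<in>L2 (surface \<Gamma>C). l2_inner (surface \<Gamma>C) v q = B_op \<Gamma>C \<gamma>0 \<tau> v p))"

definition state_equation ::
  "'a::euclidean_space set \<Rightarrow> 'a set \<Rightarrow> 'a set \<Rightarrow> (('a \<Rightarrow> real) \<Rightarrow> ('a \<Rightarrow> real)) \<Rightarrow> real
     \<Rightarrow> ('a \<Rightarrow> real) \<Rightarrow> ('a \<Rightarrow> real) \<Rightarrow> ('a \<Rightarrow> real)
     \<Rightarrow> ('a \<Rightarrow> real) \<Rightarrow> ('a \<Rightarrow> real) \<Rightarrow> ('a \<Rightarrow> real) \<Rightarrow> bool" where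
  "state_equation \<Omega> \<Gamma>D \<Gamma>C \<gamma>0 \<tau> \<kappa> ybar \<xi>bar y \<xi> u \<longleftrightarrow>
     (\<forall>\<phi>\<in>H1_D \<Omega> \<Gamma>D \<gamma>0. A_op \<Omega> \<tau> \<kappa> y \<phi> =
        B_op \<Gamma>C \<gamma>0 \<tau> u \<phi> + l2_inner (lebesgue_on \<Omega>) \<xi> \<phi> +
        l2_inner (lebesgue_on \<Omega>) ybar \<phi> - l2_inner (lebesgue_on \<Omega>) \<xi>bar \<phi>)"


subsection \<open>The regularised optimal control problem\<close>

text \<open>The first term is the squared $H^1(\Omega)$ norm, so its derivative at \<open>y\<close>, as an element
  of the dual space, is \<open>\<phi> \<mapsto> (y - yd, \<phi>)\<close> with the $H^1(\Omega)$ inner product, not the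
  $L^2(\Omega)$ one.\<close>

definition cost ::
  "'a::euclidean_space set \<Rightarrow> 'a set \<Rightarrow> ('a \<Rightarrow> real) \<Rightarrow> ('a \<Rightarrow> real) \<Rightarrow> real \<Rightarrow> real \<Rightarrow> real
     \<Rightarrow> ('a \<Rightarrow> real) \<Rightarrow> ('a \<Rightarrow> real) \<Rightarrow> ('a \<Rightarrow> real) \<Rightarrow> real" where
  "cost \<Omega> \<Gamma>C yd \<xi>d \<nu> \<gamma> \<epsilon> y \<xi> u =
     1 / 2 * (h1_norm \<Omega> (\<lambda>x. y x - yd x))\<^sup>2 +
     1 / 2 * (l2_norm (lebesgue_on \<Omega>) (\<lambda>x. \<xi> x - \<xi>d x))\<^sup>2 +
     \<nu> / 2 * (l2_norm (surface \<Gamma>C) u)\<^sup>2 +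
     \<gamma> * l2_inner (lebesgue_on \<Omega>) \<xi> (\<lambda>x. y x + \<epsilon> * \<xi> x)"

definition feasible ::
  "'a::euclidean_space set \<Rightarrow> 'a set \<Rightarrow> 'a set \<Rightarrow> (('a \<Rightarrow> real) \<Rightarrow> ('a \<Rightarrow> real)) \<Rightarrow> real
     \<Rightarrow> ('a \<Rightarrow> real) \<Rightarrow> ('a \<Rightarrow> real) \<Rightarrow> ('a \<Rightarrow> real) \<Rightarrow> real
     \<Rightarrow> ('a \<Rightarrow> real) \<Rightarrow> ('a \<Rightarrow> real) \<Rightarrow> ('a \<Rightarrow> real) \<Rightarrow> bool" where
  "feasible \<Omega> \<Gamma>D \<Gamma>C \<gamma>0 \<tau> \<kappa> ybar \<xi>bar \<epsilon> y \<xi> u \<longleftrightarrow>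
     y \<in> H1_D \<Omega> \<Gamma>D \<gamma>0 \<and> \<xi> \<in> L2 (lebesgue_on \<Omega>) \<and> u \<in> L2 (surface \<Gamma>C) \<and>
     state_equation \<Omega> \<Gamma>D \<Gamma>C \<gamma>0 \<tau> \<kappa> ybar \<xi>bar y \<xi> u \<and>
     (AE x in lebesgue_on \<Omega>. 0 \<le> y x + \<epsilon> * \<xi> x) \<and>
     (AE x in lebesgue_on \<Omega>. 0 \<le> \<xi> x) \<and>
     (AE x in surface \<Gamma>C. 0 \<le> u x)"

definition solution ::
  "'a::euclidean_space set \<Rightarrow> 'a set \<Rightarrow> 'a set \<Rightarrow> (('a \<Rightarrow> real) \<Rightarrow> ('a \<Rightarrow> real)) \<Rightarrow> real
     \<Rightarrow> ('a \<Rightarrow> real) \<Rightarrow> ('a \<Rightarrow> real) \<Rightarrow> ('a \<Rightarrow> real)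
     \<Rightarrow> ('a \<Rightarrow> real) \<Rightarrow> ('a \<Rightarrow> real) \<Rightarrow> real \<Rightarrow> real \<Rightarrow> real
     \<Rightarrow> ('a \<Rightarrow> real) \<Rightarrow> ('a \<Rightarrow> real) \<Rightarrow> ('a \<Rightarrow> real) \<Rightarrow> bool" where
  "solution \<Omega> \<Gamma>D \<Gamma>C \<gamma>0 \<tau> \<kappa> ybar \<xi>bar yd \<xi>d \<nu> \<gamma> \<epsilon> y \<xi> u \<longleftrightarrow>
     feasible \<Omega> \<Gamma>D \<Gamma>C \<gamma>0 \<tau> \<kappa> ybar \<xi>bar \<epsilon> y \<xi> u \<and>
     (\<forall>y' \<xi>' u'. feasible \<Omega> \<Gamma>D \<Gamma>C \<gamma>0 \<tau> \<kappa> ybar \<xi>bar \<epsilon> y' \<xi>' u' \<longrightarrow>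
        cost \<Omega> \<Gamma>C yd \<xi>d \<nu> \<gamma> \<epsilon> y \<xi> u \<le> cost \<Omega> \<Gamma>C yd \<xi>d \<nu> \<gamma> \<epsilon> y' \<xi>' u')"

end

theory Submission
  imports Defs "HOL-Library.Function_Algebras"
begin

text \<open>The feasible set is convex, so the derivative of the cost at the solution is nonnegative in all
  feasible directions. Dropping the constraint \<open>y + \<epsilon>\<xi> \<ge> 0\<close> and recording its violation \<open>g\<close> together
  with the change of the linearised cost gives a convex cone in \<open>L\<^sup>2(\<Omega>) \<times> \<real>\<close>. Any violation \<open>g\<close> is
  repaired by an increment \<open>h \<ge> 0\<close> of \<open>\<xi>\<close> with \<open>A z = h\<close> and \<open>z + \<epsilon> h \<ge> - g\<close>, of size \<open>O(\<parallel>g\<parallel>)\<close>; such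
  an \<open>h\<close> solves a variational inequality. Hence the cost decreases by at most \<open>M \<parallel>g\<parallel>\<close>, and separating
  \<open>(0, -1)\<close> from the cone yields \<open>\<lambda>\<close>. The adjoint state \<open>p\<close> is a Riesz representative for the form of
  \<open>A\<close>. Elements of Hilbert spaces are functions and the inner products are only semidefinite. That
  \<^const>\<open>grad\<close> is linear almost everywhere rests on the uniqueness of weak gradients, that is, on
  the fundamental lemma of the calculus of variations.\<close>

text \<open>The cone of non-negative functions in L^2(\<Omega>) has in general empty interior, so
  the state constraint offers no interior point from which a multiplier could be had, and the cone
  that is separated is not known to be closed. The linear bound on the gain in cost replaces both:
  it keeps (0, -1) away from the closure of the cone, so that the separation is strict. The repair
  exists because of \<epsilon> > 0. An increment h of \<xi> changes the constraint function by z +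
  \<epsilon> h, whose second part reaches all of L^2; accordingly the bounds on h and z grow like
  1/\<epsilon> and 1/sqrt \<epsilon>. The direct choice of h, the negative part of g divided by
  \<epsilon>, would need z \<ge> 0, a maximum principle with truncations in H^1; the variational
  inequality delivers the sign of h and the estimates together. The cost is not convex, because of
  \<gamma> (\<xi>, y + \<epsilon> \<xi>), so everything after the first variation concerns the
  linear functional \<open>dJ\<close>. Minimisation, representation and separation take place over V
  and L^2(\<Omega>); the control space enters through its inner product.\<close>

instantiation "fun" :: (type, real_vector) real_vector
begin

text \<open>Together with the pointwise operations of \<open>Function_Algebras\<close> this makes
  \<open>subspace\<close>, \<open>convex\<close>, \<open>conic\<close> and product spaces available
  for sets of functions.\<close>

definition scaleR_fun :: "real \<Rightarrow> ('a \<Rightarrow> 'b) \<Rightarrow> 'a \<Rightarrow> 'b" where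
  "scaleR_fun c f = (\<lambda>x. c *\<^sub>R f x)"

instance
  by standard (simp_all add: scaleR_fun_def fun_eq_iff algebra_simps)

end

lemma scaleR_fun_apply [simp]: "(c *\<^sub>R f) x = c *\<^sub>R f x"
  by (simp add: scaleR_fun_def)

subsection \<open>Quadratic minimisation in semi-Hilbert spaces\<close>

text \<open>The laws are required on \<open>H\<close> only: the Bochner integral of a non-integrable
  function is 0, so \<open>l2_inner\<close> is additive only where the products are integrable. A
  vector with \<open>ip x x = 0\<close> may differ from 0, since functions equal almost everywhere
  remain distinct vectors.\<close>

locale semi_inner =
  fixes H :: "'v::real_vector set" and ip :: "'v \<Rightarrow> 'v \<Rightarrow> real"
  assumes subsp: "subspace H"
    and add_left: "\<lbrakk>x \<in> H; y \<in> H; z \<in> H\<rbrakk> \<Longrightarrow> ip (x + y) z = ip x z + ip y z"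
    and scaleR_left: "\<lbrakk>x \<in> H; z \<in> H\<rbrakk> \<Longrightarrow> ip (c *\<^sub>R x) z = c * ip x z"
    and sym: "\<lbrakk>x \<in> H; y \<in> H\<rbrakk> \<Longrightarrow> ip x y = ip y x"
    and nonneg: "x \<in> H \<Longrightarrow> 0 \<le> ip x x"
begin

lemma mem [simp]:
  "0 \<in> H" "\<lbrakk>x \<in> H; y \<in> H\<rbrakk> \<Longrightarrow> x + y \<in> H" "\<lbrakk>x \<in> H; y \<in> H\<rbrakk> \<Longrightarrow> x - y \<in> H"
  "x \<in> H \<Longrightarrow> c *\<^sub>R x \<in> H"
  using subsp by (auto simp: subspace_0 subspace_add subspace_diff subspace_scale)

lemma add_right: "\<lbrakk>x \<in> H; y \<in> H; z \<in> H\<rbrakk> \<Longrightarrow> ip z (x + y) = ip z x + ip z y"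
  using add_left[of x y z] sym by simp

lemma scaleR_right: "\<lbrakk>x \<in> H; z \<in> H\<rbrakk> \<Longrightarrow> ip z (c *\<^sub>R x) = c * ip z x"
  using scaleR_left[of x z c] sym by simp

lemma diff_left: "\<lbrakk>x \<in> H; y \<in> H; z \<in> H\<rbrakk> \<Longrightarrow> ip (x - y) z = ip x z - ip y z"
  using add_left[of x "(-1) *\<^sub>R y" z] scaleR_left[of y z "-1"] mem(4)[of y "-1"] by simp

lemma diff_right: "\<lbrakk>x \<in> H; y \<in> H; z \<in> H\<rbrakk> \<Longrightarrow> ip z (x - y) = ip z x - ip z y"
  using diff_left[of x y z] sym by simp

lemmas ip_simps = add_left add_right diff_left diff_right scaleR_left scaleR_right

lemma ip_zero: "x \<in> H \<Longrightarrow> ip x 0 = 0" "x \<in> H \<Longrightarrow> ip 0 x = 0"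
  using diff_right[of x x x] diff_left[of x x x] by simp_all

lemma add_scaleR_square:
  assumes "x \<in> H" "y \<in> H"
  shows "ip (x + t *\<^sub>R y) (x + t *\<^sub>R y) = ip x x + 2 * t * ip x y + t\<^sup>2 * ip y y"
  using assms sym[OF assms] by (simp add: ip_simps power2_eq_square algebra_simps)

lemma Cauchy_Schwarz:
  assumes x: "x \<in> H" and y: "y \<in> H"
  shows "\<bar>ip x y\<bar> \<le> sqrt (ip x x) * sqrt (ip y y)"
proof -
  have *: "0 \<le> ip x x + 2 * t * ip x y + t\<^sup>2 * ip y y" for t
  proof -
    have "0 \<le> ip (x + t *\<^sub>R y) (x + t *\<^sub>R y)" by (rule nonneg) (use x y in simp)
    then show ?thesis by (simp add: add_scaleR_square[OF x y])
  qed
  have "(ip x y)\<^sup>2 \<le> ip x x * ip y y"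
  proof (cases "ip y y = 0")
    case True
    have "ip x y = 0"
    proof (rule ccontr)
      assume n: "ip x y \<noteq> 0"
      \<comment> \<open>This t makes the remaining affine expression
        \<open>ip x x + 2 * t * ip x y\<close> equal to -1.\<close>
      show False using *[of "- (ip x x + 1) / (2 * ip x y)"] n True by (simp add: field_simps)
    qed
    then show ?thesis using True by simp
  next
    case False
    then have p: "ip y y > 0" using nonneg[OF y] by simp
    \<comment> \<open>The value of t used here is the minimiser of the quadratic.\<close>
    have "0 \<le> ip x x - (ip x y)\<^sup>2 / ip y y"
      using *[of "- ip x y / ip y y"] p by (simp add: power2_eq_square field_simps)
    then show ?thesis using p by (simp add: field_simps)
  qed
  then have "sqrt ((ip x y)\<^sup>2) \<le> sqrt (ip x x * ip y y)" by (rule real_sqrt_le_mono)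
  then show ?thesis by (simp add: real_sqrt_mult)
qed

lemma ip_tendsto_left:
  assumes X: "\<And>n. X n \<in> H" and x: "x \<in> H" and z: "z \<in> H"
    and lim: "(\<lambda>n. ip (X n - x) (X n - x)) \<longlonglongrightarrow> 0"
  shows "(\<lambda>n. ip (X n) z) \<longlonglongrightarrow> ip x z"
proof (rule Lim_null[THEN iffD2], rule Lim_null_comparison)
  show "(\<lambda>n. sqrt (ip (X n - x) (X n - x)) * sqrt (ip z z)) \<longlonglongrightarrow> 0"
    using tendsto_mult_right[OF tendsto_real_sqrt[OF lim]] by (auto intro: tendsto_eq_intros)
  have "\<bar>ip (X n) z - ip x z\<bar> \<le> sqrt (ip (X n - x) (X n - x)) * sqrt (ip z z)" for n
    using Cauchy_Schwarz[of "X n - x" z] X x z by (simp add: ip_simps)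
  then show "\<forall>\<^sub>F n in sequentially. norm (ip (X n) z - ip x z)
      \<le> sqrt (ip (X n - x) (X n - x)) * sqrt (ip z z)" by simp
qed

lemma ip_tendsto_diag:
  assumes X: "\<And>n. X n \<in> H" and x: "x \<in> H" 
    and lim: "(\<lambda>n. ip (X n - x) (X n - x)) \<longlonglongrightarrow> 0"
  shows "(\<lambda>n. ip (X n) (X n)) \<longlonglongrightarrow> ip x x"
proof -
  have "ip (X n) (X n) = ip (X n - x) (X n - x) + 2 * ip (X n) x - ip x x" for n
    using X[of n] x sym[OF X x, of n] by (simp add: ip_simps)
  moreover have "(\<lambda>n. ip (X n - x) (X n - x) + 2 * ip (X n) x - ip x x) \<longlonglongrightarrow> 0 + 2 * ip x x - ip x x"
    by (intro tendsto_intros lim ip_tendsto_left[OF X x x])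
  ultimately show ?thesis by simp
qed

end

definition linear_functional_on :: "'v::real_vector set \<Rightarrow> ('v \<Rightarrow> real) \<Rightarrow> bool" where
  "linear_functional_on H l \<longleftrightarrow> (\<forall>x\<in>H. \<forall>y\<in>H. l (x + y) = l x + l y) \<and> (\<forall>c. \<forall>x\<in>H. l (c *\<^sub>R x) = c * l x)"

lemma linear_functional_on_add:
  "\<lbrakk>linear_functional_on W l; linear_functional_on W k\<rbrakk> \<Longrightarrow> linear_functional_on W (\<lambda>x. l x + k x)"
  by (simp add: linear_functional_on_def algebra_simps)

lemma linear_functional_on_cmult:
  "linear_functional_on W l \<Longrightarrow> linear_functional_on W (\<lambda>x. c * l x)"
  by (simp add: linear_functional_on_def algebra_simps)

locale semi_hilbert = semi_inner +
  assumes complete: "\<lbrakk>\<And>n. X n \<in> H;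
      \<And>e. e > 0 \<Longrightarrow> \<exists>N. \<forall>m\<ge>N. \<forall>n\<ge>N. ip (X m - X n) (X m - X n) < e\<rbrakk>
    \<Longrightarrow> \<exists>x\<in>H. (\<lambda>n. ip (X n - x) (X n - x)) \<longlonglongrightarrow> 0"
begin

text \<open>Direct method for \<open>ip z z - 2 * l z\<close>, whose derivative is twice
  \<open>ip z - l\<close>. \<open>C\<close> is not assumed closed, so the limit \<open>x\<close> of
  a minimising sequence may lie outside \<open>C\<close>; the sequence is kept in the conclusion and
  lets an application carry closed properties of \<open>C\<close> over to \<open>x\<close>.\<close>

lemma variational_inequality:
  assumes C: "C \<subseteq> H" "convex C" "C \<noteq> {}"
    and lin: "linear_functional_on H l"
    and bdd: "\<And>x. x \<in> H \<Longrightarrow> \<bar>l x\<bar> \<le> c * sqrt (ip x x)"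
  shows "\<exists>x\<in>H. (\<forall>z\<in>C. l (z - x) \<le> ip x (z - x)) \<and>
    (\<exists>Z::nat \<Rightarrow> 'a. (\<forall>n. Z n \<in> C) \<and> (\<lambda>n. ip (Z n - x) (Z n - x)) \<longlonglongrightarrow> 0)"
proof -
  have la: "l (x + y) = l x + l y" if "x \<in> H" "y \<in> H" for x y
    using lin that by (auto simp: linear_functional_on_def)
  have ls: "l (r *\<^sub>R x) = r * l x" if "x \<in> H" for r x
    using lin that by (auto simp: linear_functional_on_def)
  have ld: "l (x - y) = l x - l y" if "x \<in> H" "y \<in> H" for x y
    using la[of x "(-1) *\<^sub>R y"] ls[of y "-1"] that mem(4)[of y "-1"] by simp
  define F where "F z = ip z z - 2 * l z" for z
  \<comment> \<open>Completing the square in \<open>sqrt (ip z z)\<close>.\<close>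
  have Fbelow: "- c\<^sup>2 \<le> F z" if "z \<in> H" for z
  proof -
    have "l z \<le> c * sqrt (ip z z)" using bdd[OF that] by simp
    moreover have "0 \<le> (sqrt (ip z z) - c)\<^sup>2" by simp
    ultimately show ?thesis using nonneg[OF that]
      by (simp add: F_def power2_diff algebra_simps)
  qed
  define m where "m = (INF z\<in>C. F z)"
  have bb: "bdd_below (F ` C)" using Fbelow C by (intro bdd_belowI[of _ "-c\<^sup>2"]) auto
  have m_le: "m \<le> F z" if "z \<in> C" for z
    unfolding m_def using bb that by (rule cINF_lower)
  have "\<exists>z\<in>C. F z < m + 1 / Suc n" for n
    using cINF_less_iff[OF C(3) bb, of "m + 1 / Suc n"] by (simp add: m_def)
  then obtain Z where Z: "\<And>n. Z n \<in> C" and FZ: "\<And>n. F (Z n) < m + 1 / Suc n" by metis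
  have ZH: "Z n \<in> H" for n using Z C by auto
  \<comment> \<open>Parallelogram identity at the midpoint, which lies in \<open>C\<close>: the
    linear part cancels, and the two values of \<open>F\<close> exceed the infimum by less than 1 /
    Suc i and 1 / Suc j.\<close>
  have par: "ip (Z i - Z j) (Z i - Z j) \<le> 2 / Suc i + 2 / Suc j" for i j
  proof -
    have "(1/2) *\<^sub>R Z i + (1/2) *\<^sub>R Z j \<in> C" using convexD[OF C(2) Z Z] by simp
    then have "m \<le> F ((1/2) *\<^sub>R Z i + (1/2) *\<^sub>R Z j)" by (rule m_le)
    also have "4 * \<dots> = 2 * F (Z i) + 2 * F (Z j) - ip (Z i - Z j) (Z i - Z j)"
      using ZH sym[OF ZH ZH, of i j] by (simp add: F_def ip_simps la ls) (simp add: field_simps)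
    finally show ?thesis using FZ[of i] FZ[of j] by simp
  qed
  have "\<exists>N. \<forall>i\<ge>N. \<forall>j\<ge>N. ip (Z i - Z j) (Z i - Z j) < e" if "e > 0" for e
  proof -
    obtain N where N: "4 / e < real N" using reals_Archimedean2 by blast
    have "ip (Z i - Z j) (Z i - Z j) < e" if "i \<ge> N" "j \<ge> N" for i j
    proof -
      have b: "2 / Suc k < e / 2" if "k \<ge> N" for k
      proof -
        have "4 / e < real (Suc k)" using N that by linarith
        then show ?thesis using \<open>e > 0\<close> by (simp add: field_simps)
      qed
      show ?thesis using par[of i j] b[OF that(1)] b[OF that(2)] by simp
    qed
    then show ?thesis by blast
  qed
  then obtain x where x: "x \<in> H" and lim: "(\<lambda>n. ip (Z n - x) (Z n - x)) \<longlonglongrightarrow> 0"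
    using complete[of Z] ZH by blast
  have "l (z - x) \<le> ip x (z - x)" if z: "z \<in> C" for z
  proof -
    have zH: "z \<in> H" using z C by auto
    have l1: "(\<lambda>n. ip (Z n) y) \<longlonglongrightarrow> ip x y" if "y \<in> H" for y
      by (rule ip_tendsto_left[OF ZH x that lim])
    have l2: "(\<lambda>n. ip (Z n) (Z n)) \<longlonglongrightarrow> ip x x" by (rule ip_tendsto_diag[OF ZH x lim])
    have l3: "(\<lambda>n. l (Z n)) \<longlonglongrightarrow> l x"
    proof (rule Lim_null[THEN iffD2], rule Lim_null_comparison)
      show "(\<lambda>n. c * sqrt (ip (Z n - x) (Z n - x))) \<longlonglongrightarrow> 0"
        using tendsto_mult_left[OF tendsto_real_sqrt[OF lim]] by (auto intro: tendsto_eq_intros)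
      show "\<forall>\<^sub>F n in sequentially. norm (l (Z n) - l x) \<le> c * sqrt (ip (Z n - x) (Z n - x))"
        using bdd[of "Z _ - x"] ZH x by (simp add: ld)
    qed
    \<comment> \<open>Since \<open>x\<close> need not lie in \<open>C\<close>, the segment towards
      \<open>z\<close> starts at \<open>Z n\<close>. The error 1 / Suc n of the minimising sequence
      gets divided by t, so n tends to infinity at fixed t, and only afterwards t tends to
      0.\<close>
    have key: "0 \<le> 2 * (ip x (z - x) - l (z - x)) + t * ip (z - x) (z - x)" if t: "0 < t" "t \<le> 1" for t
    proof -
      have ev: "0 \<le> 1 / Suc n / t + 2 * (ip (Z n) z - ip (Z n) (Z n) - (l z - l (Z n)))
            + t * (ip z z - 2 * ip (Z n) z + ip (Z n) (Z n))" for n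
      proof -
        have "(1 - t) *\<^sub>R Z n + t *\<^sub>R z \<in> C" using convexD[OF C(2) Z z] t by simp
        then have "m \<le> F ((1 - t) *\<^sub>R Z n + t *\<^sub>R z)" by (rule m_le)
        also have "\<dots> = F (Z n) + t * (2 * (ip (Z n) z - ip (Z n) (Z n) - (l z - l (Z n)))
            + t * (ip z z - 2 * ip (Z n) z + ip (Z n) (Z n)))"
          using ZH zH sym[OF ZH zH, of n]
          by (simp add: F_def ip_simps la ls) (simp add: algebra_simps)
        finally have "0 \<le> 1 / Suc n + t * (2 * (ip (Z n) z - ip (Z n) (Z n) - (l z - l (Z n)))
            + t * (ip z z - 2 * ip (Z n) z + ip (Z n) (Z n)))" using FZ[of n] by linarith
        also have "\<dots> = t * (1 / Suc n / t + 2 * (ip (Z n) z - ip (Z n) (Z n) - (l z - l (Z n)))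
            + t * (ip z z - 2 * ip (Z n) z + ip (Z n) (Z n)))"
          using t by (simp add: distrib_left)
        finally show ?thesis using t by (simp add: zero_le_mult_iff)
      qed
      have "0 \<le> 0 / t + 2 * (ip x z - ip x x - (l z - l x)) + t * (ip z z - 2 * ip x z + ip x x)"
      proof (rule LIMSEQ_le_const)
        show "(\<lambda>n. 1 / Suc n / t + 2 * (ip (Z n) z - ip (Z n) (Z n) - (l z - l (Z n)))
            + t * (ip z z - 2 * ip (Z n) z + ip (Z n) (Z n))) \<longlonglongrightarrow>
          0 / t + 2 * (ip x z - ip x x - (l z - l x)) + t * (ip z z - 2 * ip x z + ip x x)"
          using t by (intro tendsto_intros l1 l2 l3 zH LIMSEQ_Suc[OF lim_1_over_n]) auto
      qed (use ev in auto)
      also have "\<dots> = 2 * (ip x (z - x) - l (z - x)) + t * ip (z - x) (z - x)"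
        using x zH sym[OF x zH] by (simp add: ip_simps ld)
      finally show ?thesis .
    qed
    have "0 \<le> 2 * (ip x (z - x) - l (z - x)) + 0 * ip (z - x) (z - x)"
    proof (rule tendsto_lowerbound)
      show "((\<lambda>t. 2 * (ip x (z - x) - l (z - x)) + t * ip (z - x) (z - x)) \<longlongrightarrow>
        2 * (ip x (z - x) - l (z - x)) + 0 * ip (z - x) (z - x)) (at_right 0)"
        by (intro tendsto_intros)
      show "\<forall>\<^sub>F t in at_right 0. 0 \<le> 2 * (ip x (z - x) - l (z - x)) + t * ip (z - x) (z - x)"
        using key by (auto simp: eventually_at_right_field intro!: exI[of _ 1])
    qed simp
    then show ?thesis by simp
  qed
  then show ?thesis using x Z lim by blast
qed

text \<open>With all of \<open>H\<close> as the convex set every vector is an admissible increment,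
  and z together with -z forces equality.\<close>

lemma riesz:
  assumes lin: "linear_functional_on H l"
    and bdd: "\<And>x. x \<in> H \<Longrightarrow> \<bar>l x\<bar> \<le> c * sqrt (ip x x)"
  obtains x where "x \<in> H" "\<And>z. z \<in> H \<Longrightarrow> ip x z = l z"
proof -
  have ne: "H \<noteq> {}" using mem(1) by blast
  obtain x where x: "x \<in> H" and vi: "\<And>z. z \<in> H \<Longrightarrow> l (z - x) \<le> ip x (z - x)"
    using variational_inequality[OF order_refl subspace_imp_convex[OF subsp] ne lin bdd] by auto
  have le: "l z \<le> ip x z" if "z \<in> H" for z
    using vi[of "z + x"] that x by simp
  have "ip x z = l z" if z: "z \<in> H" for z
  proof -
    have "l ((-1) *\<^sub>R z) = (-1) * l z" using lin z unfolding linear_functional_on_def by blast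
    then show ?thesis using le[OF z] le[OF mem(4)[OF z], of "-1"] scaleR_right[OF z x, of "-1"] by simp
  qed
  then show ?thesis using that x by blast
qed

text \<open>With \<open>l = ip x0\<close> the minimised functional is the squared distance to
  \<open>x0\<close> up to a constant, so \<open>x\<close> is a projection of \<open>x0\<close> onto
  the closure of \<open>C\<close>, and \<open>n = x - x0\<close> is the normal. The distance bound
  does the work of closedness: as \<open>ip n x = 0\<close>, it yields
  \<open>ip n x0 = - ip n n \<le> - d\<close>.\<close>

lemma cone_separation:
  assumes C: "C \<subseteq> H" "convex C" "conic C" "C \<noteq> {}"
    and x0: "x0 \<in> H" and d: "d > 0" "\<And>z. z \<in> C \<Longrightarrow> d \<le> ip (z - x0) (z - x0)"
  obtains n where "n \<in> H" "\<And>z. z \<in> C \<Longrightarrow> 0 \<le> ip n z" "ip n x0 < 0"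
proof -
  have lin: "linear_functional_on H (ip x0)"
    using x0 by (auto simp: linear_functional_on_def ip_simps)
  have bdd: "\<bar>ip x0 z\<bar> \<le> sqrt (ip x0 x0) * sqrt (ip z z)" if "z \<in> H" for z
    by (rule Cauchy_Schwarz[OF x0 that])
  obtain x Z where x: "x \<in> H" and vi: "\<And>z. z \<in> C \<Longrightarrow> ip x0 (z - x) \<le> ip x (z - x)"
    and Z: "\<And>n::nat. Z n \<in> C" and lim: "(\<lambda>n. ip (Z n - x) (Z n - x)) \<longlonglongrightarrow> 0"
    using variational_inequality[OF C(1,2,4) lin bdd] by auto
  have ZH: "Z n \<in> H" for n using Z C by auto
  define n where "n = x - x0"
  have nH: "n \<in> H" using x x0 by (simp add: n_def)
  have vi': "ip n x \<le> ip n z" if "z \<in> C" for z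
    using vi[OF that] that C(1) x x0 by (auto simp: n_def ip_simps subset_iff)
  have limn: "(\<lambda>k. ip n (Z k)) \<longlonglongrightarrow> ip n x"
    using ip_tendsto_left[OF ZH x nH lim] sym ZH x nH by simp
  have cone: "t *\<^sub>R z \<in> C" if "z \<in> C" "0 \<le> t" for t z
    using C(3) that by (auto simp: conic_def)
  \<comment> \<open>A cone allows the factors 0 and 2. They are applied to the members
    \<open>Z k\<close>, because \<open>x\<close> itself may lie outside \<open>C\<close>; the two
    resulting bounds on \<open>ip n x\<close> leave only the value 0.\<close>
  have "ip n x \<le> ip n (0 *\<^sub>R Z 0)" by (intro vi' cone Z) simp
  then have le0: "ip n x \<le> 0" using nH by (simp add: ip_zero)
  have "ip n x \<le> 2 * ip n x"
  proof (rule LIMSEQ_le_const)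
    show "(\<lambda>k. 2 * ip n (Z k)) \<longlonglongrightarrow> 2 * ip n x" by (intro tendsto_intros limn)
    have "ip n x \<le> ip n (2 *\<^sub>R Z k)" for k by (intro vi' cone Z) simp
    then show "\<exists>N. \<forall>k\<ge>N. ip n x \<le> 2 * ip n (Z k)" using ZH nH by (simp add: scaleR_right)
  qed
  with le0 have zero: "ip n x = 0" by simp
  have "d \<le> ip n n"
  proof (rule LIMSEQ_le_const)
    have "(\<lambda>k. ip (Z k - x0) (Z k - x0)) \<longlonglongrightarrow> ip (x - x0) (x - x0)"
    proof (rule ip_tendsto_diag)
      show "(\<lambda>k. ip (Z k - x0 - (x - x0)) (Z k - x0 - (x - x0))) \<longlonglongrightarrow> 0" using lim by simp
    qed (use ZH x x0 in auto)
    then show "(\<lambda>k. ip (Z k - x0) (Z k - x0)) \<longlonglongrightarrow> ip n n" by (simp add: n_def)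
    show "\<exists>N. \<forall>k\<ge>N. d \<le> ip (Z k - x0) (Z k - x0)" using d Z by blast
  qed
  moreover have "ip n n = ip n x - ip n x0" using nH x x0 by (simp add: n_def ip_simps)
  ultimately have "ip n x0 < 0" using zero d by simp
  then show ?thesis using that[OF nH] vi' zero by simp
qed

text \<open>The lower bound carries Cauchy sequences from \<open>a\<close> to \<open>ip\<close>, the
  upper bound carries limits back. This is how the energy form of the elliptic operator, and its
  multiple by \<epsilon>, become inner products.\<close>

lemma equivalent_form:
  assumes al: "\<And>x y z. \<lbrakk>x \<in> H; y \<in> H; z \<in> H\<rbrakk> \<Longrightarrow> a (x + y) z = a x z + a y z"
    and as: "\<And>x z c. \<lbrakk>x \<in> H; z \<in> H\<rbrakk> \<Longrightarrow> a (c *\<^sub>R x) z = c * a x z"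
    and asym: "\<And>x y. \<lbrakk>x \<in> H; y \<in> H\<rbrakk> \<Longrightarrow> a x y = a y x"
    and lower: "0 < k" "\<And>x. x \<in> H \<Longrightarrow> k * ip x x \<le> a x x"
    and upper: "\<And>x. x \<in> H \<Longrightarrow> a x x \<le> K * ip x x"
  shows "semi_hilbert H a"
proof
  fix x assume "x \<in> H"
  then show "0 \<le> a x x" using lower(1) lower(2)[of x] nonneg[of x] by (meson mult_nonneg_nonneg less_imp_le order_trans)
next
  fix X :: "nat \<Rightarrow> 'a"
  assume X: "\<And>n. X n \<in> H" and C: "\<And>e. e > 0 \<Longrightarrow> \<exists>N. \<forall>m\<ge>N. \<forall>n\<ge>N. a (X m - X n) (X m - X n) < e"
  have "\<exists>N. \<forall>m\<ge>N. \<forall>n\<ge>N. ip (X m - X n) (X m - X n) < e" if "e > 0" for e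
  proof -
    obtain N where N: "\<And>m n. m \<ge> N \<Longrightarrow> n \<ge> N \<Longrightarrow> a (X m - X n) (X m - X n) < k * e"
      using C[of "k * e"] \<open>e > 0\<close> lower(1) by auto
    have "ip (X m - X n) (X m - X n) < e" if "m \<ge> N" "n \<ge> N" for m n
    proof -
      have "k * ip (X m - X n) (X m - X n) < k * e"
        using N[OF that] lower(2)[of "X m - X n"] X by (meson mem(3) le_less_trans)
      then show ?thesis using lower(1) by simp
    qed
    then show ?thesis by blast
  qed
  then obtain x where x: "x \<in> H" and lim: "(\<lambda>n. ip (X n - x) (X n - x)) \<longlonglongrightarrow> 0"
    using complete X by blast
  have "(\<lambda>n. a (X n - x) (X n - x)) \<longlonglongrightarrow> 0"
  proof (rule Lim_null_comparison)
    show "(\<lambda>n. K * ip (X n - x) (X n - x)) \<longlonglongrightarrow> 0"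
      using tendsto_mult_left[OF lim, of K] by simp
    have "0 \<le> k * ip (X n - x) (X n - x)" for n using lower(1) nonneg X x by simp
    then have "norm (a (X n - x) (X n - x)) \<le> K * ip (X n - x) (X n - x)" for n
      using lower(2)[of "X n - x"] upper[of "X n - x"] X x by (smt (verit) mem(3) real_norm_def)
    then show "\<forall>\<^sub>F n in sequentially. norm (a (X n - x) (X n - x)) \<le> K * ip (X n - x) (X n - x)" by simp
  qed
  then show "\<exists>x\<in>H. (\<lambda>n. a (X n - x) (X n - x)) \<longlonglongrightarrow> 0" using x by blast
qed (use al as asym subsp in auto)

end

section \<open>Product spaces and multipliers for convex cones\<close>

lemma semi_hilbert_Times:
  assumes "semi_hilbert H a" "semi_hilbert K b"
  shows "semi_hilbert (H \<times> K) (\<lambda>p q. a (fst p) (fst q) + b (snd p) (snd q))"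
proof -
  interpret A: semi_hilbert H a by fact
  interpret B: semi_hilbert K b by fact
  show ?thesis
  proof
    show "subspace (H \<times> K)" using A.subsp B.subsp by (rule subspace_Times)
  next
    fix X :: "nat \<Rightarrow> _ \<times> _"
    let ?n = "\<lambda>p. a (fst p) (fst p) + b (snd p) (snd p)"
    assume X: "\<And>n. X n \<in> H \<times> K" and C: "\<And>e. e > 0 \<Longrightarrow> \<exists>N. \<forall>m\<ge>N. \<forall>n\<ge>N. ?n (X m - X n) < e"
    have mem: "fst (X n) \<in> H" "snd (X n) \<in> K" for n using X[of n] by (auto simp: mem_Times_iff)
    have nn: "0 \<le> a (fst (X m) - fst (X n)) (fst (X m) - fst (X n))"
       "0 \<le> b (snd (X m) - snd (X n)) (snd (X m) - snd (X n))" for m n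
      using A.nonneg B.nonneg mem by simp_all
    have "\<exists>N. \<forall>m\<ge>N. \<forall>n\<ge>N. a (fst (X m) - fst (X n)) (fst (X m) - fst (X n)) < e" if "e > 0" for e
    proof -
      obtain N where N: "\<And>m n. m \<ge> N \<Longrightarrow> n \<ge> N \<Longrightarrow> ?n (X m - X n) < e" using C[OF \<open>e > 0\<close>] by blast
      have "a (fst (X m) - fst (X n)) (fst (X m) - fst (X n)) < e" if "m \<ge> N" "n \<ge> N" for m n
        using N[OF that] nn(2)[of m n] by simp
      then show ?thesis by blast
    qed
    then obtain x where x: "x \<in> H" "(\<lambda>n. a (fst (X n) - x) (fst (X n) - x)) \<longlonglongrightarrow> 0"
      using A.complete[of "\<lambda>n. fst (X n)"] mem by blast
    have "\<exists>N. \<forall>m\<ge>N. \<forall>n\<ge>N. b (snd (X m) - snd (X n)) (snd (X m) - snd (X n)) < e" if "e > 0" for e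
    proof -
      obtain N where N: "\<And>m n. m \<ge> N \<Longrightarrow> n \<ge> N \<Longrightarrow> ?n (X m - X n) < e" using C[OF \<open>e > 0\<close>] by blast
      have "b (snd (X m) - snd (X n)) (snd (X m) - snd (X n)) < e" if "m \<ge> N" "n \<ge> N" for m n
        using N[OF that] nn(1)[of m n] by simp
      then show ?thesis by blast
    qed
    then obtain y where y: "y \<in> K" "(\<lambda>n. b (snd (X n) - y) (snd (X n) - y)) \<longlonglongrightarrow> 0"
      using B.complete[of "\<lambda>n. snd (X n)"] mem by blast
    have "(\<lambda>n. ?n (X n - (x, y))) \<longlonglongrightarrow> 0"
      using tendsto_add[OF x(2) y(2)] by simp
    then show "\<exists>x\<in>H \<times> K. (\<lambda>n. ?n (X n - x)) \<longlonglongrightarrow> 0" using x(1) y(1) by blast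
  qed (auto simp: A.ip_simps B.ip_simps A.sym B.sym A.nonneg B.nonneg algebra_simps)
qed

lemma semi_hilbert_real: "semi_hilbert (UNIV :: real set) (*)"
proof
  fix X :: "nat \<Rightarrow> real"
  assume C: "\<And>e. e > 0 \<Longrightarrow> \<exists>N. \<forall>m\<ge>N. \<forall>n\<ge>N. (X m - X n) * (X m - X n) < e"
  have "Cauchy X"
  proof (rule metric_CauchyI)
    fix e :: real assume "e > 0"
    then obtain N where N: "\<And>m n. m \<ge> N \<Longrightarrow> n \<ge> N \<Longrightarrow> (X m - X n) * (X m - X n) < e * e"
      using C[of "e * e"] by auto
    have "dist (X m) (X n) < e" if "m \<ge> N" "n \<ge> N" for m n
      using power2_less_imp_less[of "\<bar>X m - X n\<bar>" e] N[OF that] \<open>e > 0\<close>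
      by (simp add: dist_real_def power2_eq_square)
    then show "\<exists>M. \<forall>m\<ge>M. \<forall>n\<ge>M. dist (X m) (X n) < e" by blast
  qed
  then obtain x where "X \<longlonglongrightarrow> x" by (auto simp: Cauchy_convergent_iff convergent_def)
  then have "(\<lambda>n. (X n - x) * (X n - x)) \<longlonglongrightarrow> (x - x) * (x - x)" by (intro tendsto_intros)
  then show "\<exists>x\<in>UNIV. (\<lambda>n. (X n - x) * (X n - x)) \<longlonglongrightarrow> 0" by auto
qed (auto simp: algebra_simps)

text \<open>A Farkas lemma without closedness: the lower bound on the second components keeps
  \<open>(0, -1)\<close> at positive distance from the cone, and a separating normal has a positive second
  component, by which it can be divided.\<close>

lemma (in semi_hilbert) conic_multiplier:
  assumes C: "C \<subseteq> H \<times> UNIV" "convex C" "conic C" "C \<noteq> {}"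
    and M: "\<And>g r. (g, r) \<in> C \<Longrightarrow> - M * sqrt (ip g g) \<le> (r::real)"
  obtains lam where "lam \<in> H" "\<And>g r. (g, r) \<in> C \<Longrightarrow> ip lam g \<le> r"
proof -
  interpret P: semi_hilbert "H \<times> (UNIV :: real set)" "\<lambda>p q. ip (fst p) (fst q) + snd p * snd q"
    by (rule semi_hilbert_Times[OF semi_hilbert_axioms semi_hilbert_real])
  \<comment> \<open>The slope \<open>N\<close> is at least 1. Either the norm of g is at least 1 /
    (2 N), or N times it is below 1/2; then r \<ge> -1/2, and r + 1 \<ge> 1/2 \<ge> 1 / (2 N). In
    both cases the squared distance to (0, -1) is at least \<open>d\<close>.\<close>
  define N where "N = \<bar>M\<bar> + 1"
  have N: "N \<ge> 1" by (simp add: N_def)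
  define d where "d = (1 / (2 * N))\<^sup>2"
  have dist: "d \<le> ip (fst (z - (0, -1))) (fst (z - (0, -1))) + snd (z - (0, -1)) * snd (z - (0, -1))"
    if "z \<in> C" for z
  proof -
    obtain g r where z: "z = (g, r)" by (cases z)
    have g: "g \<in> H" using that C(1) z by auto
    let ?s = "sqrt (ip g g)"
    have s0: "0 \<le> ?s" using nonneg[OF g] by simp
    have "M * ?s \<le> N * ?s" unfolding N_def using s0 by (intro mult_right_mono) auto
    then have r: "- (N * ?s) \<le> r" using M[of g r] that z by simp
    have "d \<le> ?s\<^sup>2 + (r + 1)\<^sup>2"
    proof (cases "1 / (2 * N) \<le> ?s")
      case True
      then have "d \<le> ?s\<^sup>2" unfolding d_def using N by (intro power_mono) auto
      then show ?thesis by (smt (verit) zero_le_power2)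
    next
      case False
      then have "N * ?s \<le> 1 / 2" using N by (simp add: field_simps)
      then have "1 / 2 \<le> r + 1" using r by simp
      moreover have "1 / (2 * N) \<le> 1 / 2" using N by (simp add: field_simps)
      ultimately have "1 / (2 * N) \<le> r + 1" by simp
      then have "d \<le> (r + 1)\<^sup>2" unfolding d_def using N by (intro power_mono) auto
      then show ?thesis by (smt (verit) zero_le_power2)
    qed
    then show ?thesis using z nonneg[OF g] by (simp add: power2_eq_square)
  qed
  obtain n where n: "n \<in> H \<times> UNIV"
    and nC: "\<And>z. z \<in> C \<Longrightarrow> 0 \<le> ip (fst n) (fst z) + snd n * snd z"
    and n0: "ip (fst n) (fst (0, -1 :: real)) + snd n * snd (0 :: 'a, -1) < 0"
  proof (rule P.cone_separation[OF C, of "(0, -1)" d])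
    show "0 < d" using N by (simp add: d_def)
  qed (use dist in auto)
  have nH: "fst n \<in> H" using n by (simp add: mem_Times_iff)
  have pos: "snd n > 0" using n0 nH by (simp add: ip_zero)
  show ?thesis
  proof (rule that[of "(- 1 / snd n) *\<^sub>R fst n"])
    fix g r assume gr: "(g, r) \<in> C"
    then have g: "g \<in> H" using C(1) by auto
    show "ip ((- 1 / snd n) *\<^sub>R fst n) g \<le> r"
      using nC[OF gr] pos unfolding scaleR_left[OF nH g] by (simp add: field_simps)
  qed (rule mem(4)[OF nH])
qed

subsection \<open>The space of square integrable functions\<close>

lemma L2_measurable [measurable_dest]: "f \<in> L2 M \<Longrightarrow> f \<in> borel_measurable M"
  by (simp add: L2_def)

lemma L2_integrable_inner:
  assumes f: "f \<in> L2 M" and g: "g \<in> L2 M"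
  shows "integrable M (\<lambda>x. f x \<bullet> g x)"
proof (rule Bochner_Integration.integrable_bound)
  show "integrable M (\<lambda>x. (norm (f x))\<^sup>2 + (norm (g x))\<^sup>2)"
    using f g by (auto simp: L2_def)
  show "(\<lambda>x. f x \<bullet> g x) \<in> borel_measurable M"
    using f g by (intro borel_measurable_inner L2_measurable)
  have "\<bar>f x \<bullet> g x\<bar> \<le> (norm (f x))\<^sup>2 + (norm (g x))\<^sup>2" for x
    using Cauchy_Schwarz_ineq2[of "f x" "g x"] sum_squares_bound[of "norm (f x)" "norm (g x)"]
      mult_nonneg_nonneg[OF norm_ge_zero norm_ge_zero, of "f x" "g x"] by linarith
  then show "AE x in M. norm (f x \<bullet> g x) \<le> norm ((norm (f x))\<^sup>2 + (norm (g x))\<^sup>2)"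
    by (intro AE_I2) (simp add: order_trans)
qed

lemma L2_bounded:
  assumes "finite_measure M" and f: "f \<in> borel_measurable M"
    and b: "\<And>x. x \<in> space M \<Longrightarrow> norm (f x) \<le> B"
  shows "f \<in> L2 M"
proof -
  interpret finite_measure M by fact
  have "integrable M (\<lambda>x. (norm (f x))\<^sup>2)"
    by (rule integrable_const_bound[of _ "B\<^sup>2"]) (use f b in \<open>auto intro!: power_mono\<close>)
  then show ?thesis using f by (simp add: L2_def)
qed

lemma subspace_L2: "subspace (L2 M :: ('a \<Rightarrow> 'b::euclidean_space) set)"
proof (rule subspaceI)
  show "0 \<in> L2 M" by (simp add: L2_def zero_fun_def)
next
  fix f g :: "'a \<Rightarrow> 'b" assume f: "f \<in> L2 M" and g: "g \<in> L2 M"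
  have "integrable M (\<lambda>x. (norm (f x))\<^sup>2 + (norm (g x))\<^sup>2 + 2 * (f x \<bullet> g x))"
    using f g L2_integrable_inner[OF f g] by (auto simp: L2_def)
  also have "(\<lambda>x. (norm (f x))\<^sup>2 + (norm (g x))\<^sup>2 + 2 * (f x \<bullet> g x)) = (\<lambda>x. (norm ((f + g) x))\<^sup>2)"
    by (simp add: fun_eq_iff power2_norm_eq_inner inner_add inner_commute)
  finally show "f + g \<in> L2 M" using f g by (simp add: L2_def plus_fun_def borel_measurable_add)
next
  fix f :: "'a \<Rightarrow> 'b" and c :: real assume f: "f \<in> L2 M"
  then have "integrable M (\<lambda>x. c\<^sup>2 * (norm (f x))\<^sup>2)" by (auto simp: L2_def)
  then show "c *\<^sub>R f \<in> L2 M" using f by (simp add: L2_def power_mult_distrib scaleR_fun_def borel_measurable_scaleR)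
qed

lemma semi_inner_L2: "semi_inner (L2 M) (l2_inner M)"
proof
  fix f g h :: "'a \<Rightarrow> 'b" assume "f \<in> L2 M" "g \<in> L2 M" "h \<in> L2 M"
  then show "l2_inner M (f + g) h = l2_inner M f h + l2_inner M g h"
    by (simp add: l2_inner_def inner_add_left L2_integrable_inner)
qed (auto simp: subspace_L2 l2_inner_def inner_commute)

text \<open>Riesz-Fischer. Finiteness of the measure makes an L^2 Cauchy sequence Cauchy in L^1,
  which supplies a subsequence converging almost everywhere; Fatou's lemma then gives L^2
  convergence of the whole sequence to that pointwise limit.\<close>

lemma semi_hilbert_L2:
  assumes "finite_measure M"
  shows "semi_hilbert (L2 M) (l2_inner M :: ('a \<Rightarrow> 'b::euclidean_space) \<Rightarrow> _)"
proof -
  interpret finite_measure M by fact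
  interpret S: semi_inner "L2 M" "l2_inner M :: ('a \<Rightarrow> 'b) \<Rightarrow> _" by (rule semi_inner_L2)
  interpret R: semi_inner "L2 M" "l2_inner M :: ('a \<Rightarrow> real) \<Rightarrow> _" by (rule semi_inner_L2)
  have L2_sq: "l2_inner M f f = (LINT x|M. (norm (f x))\<^sup>2)" for f :: "'a \<Rightarrow> 'b"
    by (simp add: l2_inner_def power2_norm_eq_inner)
  show ?thesis
  proof
    fix X :: "nat \<Rightarrow> 'a \<Rightarrow> 'b"
    assume X: "\<And>n. X n \<in> L2 M"
      and C: "\<And>e. e > 0 \<Longrightarrow> \<exists>N. \<forall>m\<ge>N. \<forall>n\<ge>N. l2_inner M (X m - X n) (X m - X n) < e"
    have [measurable]: "X n \<in> borel_measurable M" for n using X by measurable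
    have one: "(\<lambda>x. 1::real) \<in> L2 M" by (rule L2_bounded[OF assms, of _ 1]) auto
    have L1: "integrable M f" "(LINT x|M. norm (f x)) \<le> sqrt (l2_inner M f f) * sqrt (measure M (space M))"
      if f: "f \<in> L2 M" for f :: "'a \<Rightarrow> 'b"
    proof -
      have n: "(\<lambda>x. norm (f x)) \<in> L2 M" using f by (auto simp: L2_def)
      show "integrable M f" using L2_integrable_inner[OF n one] f
        by (simp add: integrable_norm_iff L2_measurable)
      show "(LINT x|M. norm (f x)) \<le> sqrt (l2_inner M f f) * sqrt (measure M (space M))"
        using R.Cauchy_Schwarz[OF n one] 
        by (simp add: l2_inner_def power2_norm_eq_inner flip: power2_eq_square)
    qed
    \<comment> \<open>Adding 1 keeps the divisor positive even if the space has measure 0.\<close>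
    define K where "K = sqrt (measure M (space M)) + 1"
    have K: "K > 0" by (simp add: K_def add_nonneg_pos)
    obtain r where r: "strict_mono r" and cau: "AE x in M. Cauchy (\<lambda>i. X (r i) x)"
    proof (rule cauchy_L1_AE_cauchy_subseq[of M X])
      show "integrable M (X n)" for n by (rule L1[OF X])
      fix e :: real assume e: "0 < e"
      obtain N where N: "\<And>m n. m \<ge> N \<Longrightarrow> n \<ge> N \<Longrightarrow> l2_inner M (X m - X n) (X m - X n) < (e / K)\<^sup>2"
        using C[of "(e / K)\<^sup>2"] e K by auto
      have "(LINT x|M. norm (X i x - X j x)) < e" if "i \<ge> N" "j \<ge> N" for i j
      proof -
        have s: "sqrt (l2_inner M (X i - X j) (X i - X j)) < e / K"
          using N[OF that] e K by (intro real_less_lsqrt) (auto simp: S.nonneg X)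
        have "(LINT x|M. norm (X i x - X j x)) \<le> sqrt (l2_inner M (X i - X j) (X i - X j)) * sqrt (measure M (space M))"
          using L1(2)[of "X i - X j"] X by simp
        also have "\<dots> \<le> sqrt (l2_inner M (X i - X j) (X i - X j)) * K"
          using S.nonneg[of "X i - X j"] X by (intro mult_left_mono) (auto simp: K_def)
        also have "\<dots> < e / K * K" using s K by (intro mult_strict_right_mono) auto
        finally show ?thesis using K by simp
      qed
      then show "\<exists>N. \<forall>i\<ge>N. \<forall>j\<ge>N. (LINT x|M. norm (X i x - X j x)) < e" by blast
    qed blast
    define f where "f x = lim (\<lambda>i. X (r i) x)" for x
    have [measurable]: "f \<in> borel_measurable M" unfolding f_def by measurable
    have conv: "AE x in M. (\<lambda>i. X (r i) x) \<longlonglongrightarrow> f x"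
      using cau by eventually_elim (simp add: f_def Cauchy_convergent_iff convergent_LIMSEQ_iff)
    \<comment> \<open>Stated with non-negative integrals, because \<open>f\<close> is not yet known
      to be square integrable. Fatou's lemma runs along the subsequence at fixed n, and
      \<open>r i \<ge> i\<close> puts its members past \<open>N\<close>.\<close>
    have close: "\<exists>N. \<forall>n\<ge>N. (\<integral>\<^sup>+x. ennreal ((norm (X n x - f x))\<^sup>2) \<partial>M) \<le> ennreal e" if e: "0 < e" for e
    proof -
      obtain N where N: "\<And>m n. m \<ge> N \<Longrightarrow> n \<ge> N \<Longrightarrow> l2_inner M (X m - X n) (X m - X n) < e"
        using C[OF e] by blast
      have "(\<integral>\<^sup>+x. ennreal ((norm (X n x - f x))\<^sup>2) \<partial>M) \<le> ennreal e" if n: "n \<ge> N" for n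
      proof -
        have "AE x in M. liminf (\<lambda>i. ennreal ((norm (X n x - X (r i) x))\<^sup>2)) = ennreal ((norm (X n x - f x))\<^sup>2)"
          using conv
        proof eventually_elim
          fix x assume "(\<lambda>i. X (r i) x) \<longlonglongrightarrow> f x"
          then have "(\<lambda>i. ennreal ((norm (X n x - X (r i) x))\<^sup>2)) \<longlonglongrightarrow> ennreal ((norm (X n x - f x))\<^sup>2)"
            by (intro tendsto_intros)
          then show "liminf (\<lambda>i. ennreal ((norm (X n x - X (r i) x))\<^sup>2)) = ennreal ((norm (X n x - f x))\<^sup>2)"
            by (intro lim_imp_Liminf) auto
        qed
        then have "(\<integral>\<^sup>+x. ennreal ((norm (X n x - f x))\<^sup>2) \<partial>M) = (\<integral>\<^sup>+x. liminf (\<lambda>i. ennreal ((norm (X n x - X (r i) x))\<^sup>2)) \<partial>M)"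
          by (intro nn_integral_cong_AE) auto
        also have "\<dots> \<le> liminf (\<lambda>i. \<integral>\<^sup>+x. ennreal ((norm (X n x - X (r i) x))\<^sup>2) \<partial>M)"
          by (intro nn_integral_liminf) measurable
        also have "\<dots> \<le> ennreal e"
        proof (rule Liminf_le)
          have "(\<integral>\<^sup>+x. ennreal ((norm (X n x - X (r i) x))\<^sup>2) \<partial>M) \<le> ennreal e" if "i \<ge> N" for i
          proof -
            have "(\<integral>\<^sup>+x. ennreal ((norm (X n x - X (r i) x))\<^sup>2) \<partial>M) = ennreal (LINT x|M. (norm (X n x - X (r i) x))\<^sup>2)"
              using S.mem(3)[OF X X, of n "r i"] by (intro nn_integral_eq_integral) (auto simp: L2_def)
            also have "\<dots> \<le> ennreal e"
              using N[OF n, of "r i"] seq_suble[OF r, of i] that by (intro ennreal_leI) (simp add: L2_sq)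
            finally show ?thesis .
          qed
          then show "\<forall>\<^sub>F i in sequentially. (\<integral>\<^sup>+x. ennreal ((norm (X n x - X (r i) x))\<^sup>2) \<partial>M) \<le> ennreal e"
            by (auto simp: eventually_sequentially)
        qed simp
        finally show ?thesis .
      qed
      then show ?thesis by blast
    qed
    have diffs: "X n - f \<in> L2 M \<and> l2_inner M (X n - f) (X n - f) \<le> e"
      if le: "(\<integral>\<^sup>+x. ennreal ((norm (X n x - f x))\<^sup>2) \<partial>M) \<le> ennreal e" and e: "0 < e" for n e
    proof -
      have "(\<integral>\<^sup>+x. ennreal ((norm (X n x - f x))\<^sup>2) \<partial>M) < \<infinity>"
        using le by (rule le_less_trans) simp
      then have int: "integrable M (\<lambda>x. (norm (X n x - f x))\<^sup>2)"
        by (intro integrableI_bounded) auto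
      then have "X n - f \<in> L2 M" by (simp add: L2_def fun_diff_def)
      moreover have "(LINT x|M. (norm (X n x - f x))\<^sup>2) \<le> e"
        using le e nn_integral_eq_integral[OF int] by simp
      ultimately show ?thesis by (simp add: L2_sq)
    qed
    have f: "f \<in> L2 M"
    proof -
      obtain N where "(\<integral>\<^sup>+x. ennreal ((norm (X N x - f x))\<^sup>2) \<partial>M) \<le> ennreal 1"
        using close[of 1] by auto
      then have "X N - f \<in> L2 M" using diffs by fastforce
      then have "X N - (X N - f) \<in> L2 M" by (rule S.mem(3)[OF X])
      moreover have "X N - (X N - f) = f" by (simp add: fun_eq_iff)
      ultimately show ?thesis by metis
    qed
    have "(\<lambda>n. l2_inner M (X n - f) (X n - f)) \<longlonglongrightarrow> 0"
    proof (rule LIMSEQ_I)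
      fix e :: real assume e: "0 < e"
      obtain N where N: "\<And>n. n \<ge> N \<Longrightarrow> (\<integral>\<^sup>+x. ennreal ((norm (X n x - f x))\<^sup>2) \<partial>M) \<le> ennreal (e/2)"
        using close[of "e/2"] e by auto
      have "norm (l2_inner M (X n - f) (X n - f) - 0) < e" if "n \<ge> N" for n
        using diffs[OF N[OF that]] e S.nonneg[of "X n - f"] X f by (simp)
      then show "\<exists>N. \<forall>n\<ge>N. norm (l2_inner M (X n - f) (X n - f) - 0) < e" by blast
    qed
    then show "\<exists>f\<in>L2 M. (\<lambda>n. l2_inner M (X n - f) (X n - f)) \<longlonglongrightarrow> 0" using f by blast
  qed
qed

section \<open>Null functions and the cone of non-negative functions\<close>

lemma L2_null_iff:
  assumes f: "f \<in> L2 M"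
  shows "l2_inner M f f = 0 \<longleftrightarrow> (AE x in M. f x = 0)"
  using integral_nonneg_eq_0_iff_AE[OF L2_integrable_inner[OF f f]] by (simp add: l2_inner_def)

lemma l2_inner_cong_AE:
  assumes "f \<in> L2 M" "f' \<in> L2 M" "g \<in> L2 M" "g' \<in> L2 M"
    and "AE x in M. f x = f' x" "AE x in M. g x = g' x"
  shows "l2_inner M f g = l2_inner M f' g'"
  unfolding l2_inner_def
proof (rule integral_cong_AE)
  show "AE x in M. f x \<bullet> g x = f' x \<bullet> g' x" using assms(5,6) by eventually_elim simp
qed (use assms in \<open>auto intro!: borel_measurable_inner L2_measurable\<close>)

text \<open>The cone of non-negative functions is self-dual: tested with the negative part g of f,
  the hypothesis reads - (g, g) \<ge> 0.\<close>

lemma L2_nonneg_dual: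
  assumes "finite_measure M" and f: "f \<in> L2 M"
    and ge: "\<And>g. g \<in> L2 M \<Longrightarrow> AE x in M. 0 \<le> g x \<Longrightarrow> 0 \<le> l2_inner M f g"
  shows "AE x in M. 0 \<le> (f x :: real)"
proof -
  interpret finite_measure M by fact
  define g where "g x = max 0 (- f x)" for x
  have [measurable]: "f \<in> borel_measurable M" using f by measurable
  have "integrable M (\<lambda>x. (norm (g x))\<^sup>2)"
    by (rule Bochner_Integration.integrable_bound[of _ "\<lambda>x. (norm (f x))\<^sup>2"])
      (use f in \<open>auto simp: L2_def g_def max_def\<close>)
  moreover have "g \<in> borel_measurable M" unfolding g_def by measurable
  ultimately have g: "g \<in> L2 M" by (simp add: L2_def)
  have "0 \<le> l2_inner M f g" by (rule ge[OF g]) (simp add: g_def)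
  also have "l2_inner M f g = - l2_inner M g g"
  proof -
    have "f x \<bullet> g x = - (g x \<bullet> g x)" for x by (simp add: g_def max_def)
    then show ?thesis by (simp add: l2_inner_def)
  qed
  finally have "l2_inner M g g = 0"
    using semi_inner.nonneg[OF semi_inner_L2 g] by simp
  then have "AE x in M. g x = 0" using L2_null_iff[OF g] by simp
  then show ?thesis by eventually_elim (auto simp: g_def max_def split: if_splits)
qed

lemma l2_inner_nonneg:
  fixes f g :: "'a \<Rightarrow> real"
  assumes "AE x in M. 0 \<le> f x" "AE x in M. 0 \<le> g x"
  shows "0 \<le> l2_inner M f g"
  unfolding l2_inner_def using assms by (intro integral_nonneg_AE) (auto elim: eventually_elim2)

text \<open>Self-duality reduces the claim to limits of inner products with a fixed non-negative
  g.\<close>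

lemma L2_nonneg_closed:
  assumes "finite_measure M" and f: "f \<in> L2 M" and Z: "\<And>n::nat. Z n \<in> L2 M" "\<And>n. AE x in M. 0 \<le> Z n x"
    and lim: "(\<lambda>n. l2_inner M (Z n - f) (Z n - f)) \<longlonglongrightarrow> 0"
  shows "AE x in M. 0 \<le> (f x :: real)"
proof (rule L2_nonneg_dual[OF assms(1) f])
  interpret S: semi_inner "L2 M" "l2_inner M :: ('a \<Rightarrow> real) \<Rightarrow> _" by (rule semi_inner_L2)
  fix g :: "'a \<Rightarrow> real" assume g: "g \<in> L2 M" "AE x in M. 0 \<le> g x"
  show "0 \<le> l2_inner M f g"
  proof (rule LIMSEQ_le_const)
    show "(\<lambda>n. l2_inner M (Z n) g) \<longlonglongrightarrow> l2_inner M f g"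
      by (rule S.ip_tendsto_left[OF Z(1) f g(1) lim])
  qed (use l2_inner_nonneg Z(2) g(2) in blast)
qed

subsection \<open>Smooth bump functions\<close>

text \<open>The product rule calls for this: the derivative of \<open>f * h\<close> contains
  \<open>f\<close> and \<open>h\<close> themselves, which are then needed at the lower
  order.\<close>

lemma Ck_on_SucD: "Ck_on (Suc k) f S \<Longrightarrow> Ck_on k f S"
proof (induction k arbitrary: f)
  case 0
  then obtain g where "\<And>x. x \<in> S \<Longrightarrow> GDERIV f x :> g x" by auto
  then show ?case
    by (auto simp: gderiv_def intro!: continuous_at_imp_continuous_on has_derivative_continuous)
next
  case (Suc k)
  obtain g where "\<And>x. x \<in> S \<Longrightarrow> GDERIV f x :> g x" "\<And>i. i \<in> Basis \<Longrightarrow> Ck_on (Suc k) (\<lambda>x. g x \<bullet> i) S"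
    using Suc.prems by (subst (asm) Ck_on.simps(2)) blast
  then show ?case using Suc.IH unfolding Ck_on.simps(2)[of k f] by blast
qed

lemma Ck_on_const: "Ck_on k (\<lambda>x. c) S"
proof (induction k arbitrary: c)
  case (Suc k)
  then show ?case by (auto intro!: exI[of _ "\<lambda>x. 0"] simp: GDERIV_const)
qed auto

lemma Ck_on_add: "\<lbrakk>Ck_on k f S; Ck_on k h S\<rbrakk> \<Longrightarrow> Ck_on k (\<lambda>x. f x + h x) S"
proof (induction k arbitrary: f h)
  case 0 then show ?case by (auto intro: continuous_intros)
next
  case (Suc k)
  obtain f' h' where "\<And>x. x \<in> S \<Longrightarrow> GDERIV f x :> f' x" "\<And>i. i \<in> Basis \<Longrightarrow> Ck_on k (\<lambda>x. f' x \<bullet> i) S"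
     "\<And>x. x \<in> S \<Longrightarrow> GDERIV h x :> h' x" "\<And>i. i \<in> Basis \<Longrightarrow> Ck_on k (\<lambda>x. h' x \<bullet> i) S"
    using Suc.prems unfolding Ck_on.simps by blast
  then show ?case unfolding Ck_on.simps
    by (intro exI[of _ "\<lambda>x. f' x + h' x"]) (auto intro!: GDERIV_add Suc.IH simp: inner_add_left)
qed

lemma Ck_on_mult: "\<lbrakk>Ck_on k f S; Ck_on k h S\<rbrakk> \<Longrightarrow> Ck_on k (\<lambda>x. f x * h x) S"
proof (induction k arbitrary: f h)
  case 0 then show ?case by (auto intro: continuous_intros)
next
  case (Suc k)
  obtain f' h' where "\<And>x. x \<in> S \<Longrightarrow> GDERIV f x :> f' x" "\<And>i. i \<in> Basis \<Longrightarrow> Ck_on k (\<lambda>x. f' x \<bullet> i) S"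
     "\<And>x. x \<in> S \<Longrightarrow> GDERIV h x :> h' x" "\<And>i. i \<in> Basis \<Longrightarrow> Ck_on k (\<lambda>x. h' x \<bullet> i) S"
    using Suc.prems unfolding Ck_on.simps by blast
  moreover have "Ck_on k f S" "Ck_on k h S" using Suc.prems Ck_on_SucD by blast+
  ultimately show ?case unfolding Ck_on.simps
    by (intro exI[of _ "\<lambda>x. f x *\<^sub>R h' x + h x *\<^sub>R f' x"])
      (auto intro!: GDERIV_mult Suc.IH Ck_on_add simp: inner_add_left)
qed

lemma Ck_on_prod: "(\<And>i. i \<in> I \<Longrightarrow> Ck_on k (f i) S) \<Longrightarrow> Ck_on k (\<lambda>x. \<Prod>i\<in>I. f i x) S"
  by (induction I rule: infinite_finite_induct) (auto intro: Ck_on_const Ck_on_mult)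

text \<open>The factor \<open>inverse t ^ n\<close> makes the family closed under differentiation up
  to linear combinations, so that smoothness follows by an induction over all members at
  once.\<close>

definition flat :: "nat \<Rightarrow> real \<Rightarrow> real" where
  "flat n t = (if t \<le> 0 then 0 else exp (- inverse t) * inverse t ^ n)"

lemma flat_tendsto_0: "(flat n \<longlongrightarrow> 0) (at 0)"
proof -
  have "((\<lambda>t::real. inverse t ^ n / exp (inverse t)) \<longlongrightarrow> 0) (at_right 0)"
    by (rule filterlim_compose[OF tendsto_power_div_exp_0[of n] filterlim_inverse_at_top_right])
  moreover have "\<forall>\<^sub>F t in at_right 0. inverse t ^ n / exp (inverse t) = flat n t"
    by (auto simp: eventually_at_right_field flat_def exp_minus field_simps intro!: exI[of _ 1])
  ultimately have "(flat n \<longlongrightarrow> 0) (at_right 0)" by (rule Lim_transform_eventually)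
  moreover have "\<forall>\<^sub>F t in at_left 0. 0 = flat n t"
    by (auto simp: eventually_at_left_field flat_def intro!: exI[of _ "-1"])
  then have "(flat n \<longlongrightarrow> 0) (at_left 0)" by (rule Lim_transform_eventually[OF tendsto_const])
  ultimately show ?thesis by (rule filterlim_split_at[rotated])
qed

lemma DERIV_flat: "(flat n has_real_derivative flat (n + 2) t - n * flat (n + 1) t) (at t)"
proof -
  consider "t < 0" | "t = 0" | "t > 0" by linarith
  then show ?thesis
  proof cases
    case 1
    have "((\<lambda>t. 0) has_real_derivative flat (n + 2) t - n * flat (n + 1) t) (at t)"
      using 1 by (simp add: flat_def)
    then show ?thesis
      by (rule has_field_derivative_transform_within_open[of _ _ _ "{..<0}"]) (use 1 in \<open>auto simp: flat_def\<close>)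
  next
    case 2
    \<comment> \<open>At t = 0 the difference quotient is the next member,
      \<open>flat (n + 1) h\<close>, which tends to 0.\<close>
    have "((\<lambda>h. (flat n (0 + h) - flat n 0) / h) \<longlongrightarrow> 0) (at 0)"
      using flat_tendsto_0[of "n + 1"]
      by (rule Lim_transform_eventually) (auto intro!: always_eventually simp: flat_def field_simps)
    then show ?thesis using 2 by (simp add: DERIV_def flat_def)
  next
    case 3
    have inv: "(inverse has_real_derivative - (inverse t)\<^sup>2) (at t)"
      using DERIV_inverse[of t] 3 by (simp add: numeral_2_eq_2)
    have "((\<lambda>t. inverse t ^ n) has_real_derivative - (n * inverse t ^ (n + 1))) (at t)"
    proof (cases n)
      case (Suc m)
      then show ?thesis using DERIV_power[OF inv, of n] by (simp add: power2_eq_square algebra_simps)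
    qed simp
    moreover have "((\<lambda>t. exp (- inverse t)) has_real_derivative exp (- inverse t) * (inverse t)\<^sup>2) (at t)"
      using DERIV_fun_exp[OF DERIV_minus[OF inv]] by simp
    ultimately have "((\<lambda>t. exp (- inverse t) * inverse t ^ n) has_real_derivative
        flat (n + 2) t - n * flat (n + 1) t) (at t)"
      using 3 by (rule_tac DERIV_cong[OF DERIV_mult]) (auto simp: flat_def power_add power2_eq_square algebra_simps)
    then show ?thesis
      by (rule has_field_derivative_transform_within_open[of _ _ _ "{0<..}"]) (use 3 in \<open>auto simp: flat_def\<close>)
  qed
qed

lemma flat_le_1: "0 \<le> flat 0 t" "flat 0 t \<le> 1"
  by (auto simp: flat_def)

lemma Ck_on_flat: "Ck_on k (\<lambda>x::'a::euclidean_space. flat n (c * (x \<bullet> b) + d)) S"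
proof (induction k arbitrary: n)
  case 0
  have "isCont (flat n) t" for t using DERIV_flat DERIV_isCont by blast
  then have "continuous_on UNIV (flat n)" by (simp add: continuous_at_imp_continuous_on)
  then show ?case
    by (auto intro!: continuous_on_compose2[of UNIV "flat n"] continuous_intros)
next
  case (Suc k)
  let ?a = "\<lambda>x. c * (x \<bullet> b) + d"
  let ?g = "\<lambda>x. (flat (n + 2) (?a x) + (- real n) * flat (n + 1) (?a x)) *\<^sub>R (c *\<^sub>R b)"
  have a: "GDERIV ?a x :> c *\<^sub>R b" for x
    unfolding gderiv_def by (auto intro!: derivative_eq_intros)
  have "GDERIV (\<lambda>x. flat n (?a x)) x :> ?g x" for x
    using GDERIV_DERIV_compose[OF a DERIV_flat] by simp
  moreover have "Ck_on k (\<lambda>x. ?g x \<bullet> i) S" for i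
    unfolding inner_scaleR_left by (intro Ck_on_add Ck_on_mult Ck_on_const Suc.IH)
  ultimately show ?case unfolding Ck_on.simps by (intro exI[of _ ?g] conjI ballI)
qed

text \<open>The scaling by \<open>Suc n\<close> drives each factor to 1 inside the box, so these
  test functions approximate the indicator of the open box. Each argument is an affine function of
  one coordinate, the form handled by \<open>Ck_on_flat\<close>.\<close>

definition box_bump :: "nat \<Rightarrow> 'a::euclidean_space \<Rightarrow> 'a \<Rightarrow> 'a \<Rightarrow> real" where
  "box_bump n a b x = (\<Prod>i\<in>Basis. flat 0 (Suc n * (x \<bullet> i) - Suc n * (a \<bullet> i)) *
     flat 0 (- Suc n * (x \<bullet> i) + Suc n * (b \<bullet> i)))"

lemma smooth_box_bump: "smooth_on UNIV (box_bump n a b)"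
proof -
  have "Ck_on k (box_bump n a b) UNIV" for k
    unfolding box_bump_def diff_conv_add_uminus by (intro Ck_on_prod Ck_on_mult Ck_on_flat)
  then show ?thesis by (simp add: smooth_on_def)
qed

lemma box_bump_outside: "x \<notin> box a b \<Longrightarrow> box_bump n a b x = 0"
proof -
  assume "x \<notin> box a b"
  then obtain i where i: "i \<in> Basis" "x \<bullet> i \<le> a \<bullet> i \<or> b \<bullet> i \<le> x \<bullet> i" by (auto simp: mem_box not_less)
  have "Suc n * (x \<bullet> i) \<le> Suc n * (a \<bullet> i) \<or> Suc n * (b \<bullet> i) \<le> Suc n * (x \<bullet> i)"
    using i(2) by (auto intro: mult_left_mono)
  then have "flat 0 (Suc n * (x \<bullet> i) - Suc n * (a \<bullet> i)) * flat 0 (- Suc n * (x \<bullet> i) + Suc n * (b \<bullet> i)) = 0"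
    by (auto simp: flat_def simp del: of_nat_Suc)
  then show ?thesis unfolding box_bump_def using i(1) by (intro prod_zero) auto
qed

lemma box_bump_bounds: "0 \<le> box_bump n a b x" "box_bump n a b x \<le> 1"
  unfolding box_bump_def using flat_le_1 by (auto intro!: prod_nonneg prod_le_1 mult_le_one)

lemma box_bump_test_function: "cbox a b \<subseteq> \<Omega> \<Longrightarrow> box_bump n a b \<in> test_functions \<Omega>"
proof -
  assume *: "cbox a b \<subseteq> \<Omega>"
  have "closure {x. box_bump n a b x \<noteq> 0} \<subseteq> cbox a b"
  proof (rule closure_minimal)
    show "{x. box_bump n a b x \<noteq> 0} \<subseteq> cbox a b"
      using box_bump_outside[of _ a b n] box_subset_cbox[of a b] by auto
  qed (rule closed_cbox)
  then show ?thesis using * smooth_box_bump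
    by (auto simp: test_functions_def intro: compact_Int_closed[of "cbox a b", simplified Int_absorb1]
        bounded_subset[OF bounded_cbox] simp: compact_eq_bounded_closed)
qed

lemma flat_tendsto_1:
  fixes s :: real
  assumes s: "s > 0"
  shows "(\<lambda>n. flat 0 (Suc n * s)) \<longlonglongrightarrow> 1"
proof -
  have "(\<lambda>n. exp (- (inverse (real (Suc n)) * inverse s))) \<longlonglongrightarrow> exp (- (0 * inverse s))"
    by (intro tendsto_intros LIMSEQ_inverse_real_of_nat)
  then show ?thesis using s by (simp add: flat_def not_le mult_le_0_iff del: of_nat_Suc)
qed

lemma box_bump_tendsto: "(\<lambda>n. box_bump n a b x) \<longlonglongrightarrow> indicator (box a b) x"
proof (cases "x \<in> box a b")
  case True
  have "(\<lambda>n. \<Prod>i\<in>Basis. flat 0 (Suc n * ((x - a) \<bullet> i)) * flat 0 (Suc n * ((b - x) \<bullet> i))) \<longlonglongrightarrow>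
      (\<Prod>i\<in>(Basis::'a set). 1 * 1)"
    using True by (intro tendsto_prod tendsto_mult flat_tendsto_1) (auto simp: mem_box inner_diff)
  moreover have "box_bump n a b x = (\<Prod>i\<in>Basis. flat 0 (Suc n * ((x - a) \<bullet> i)) * flat 0 (Suc n * ((b - x) \<bullet> i)))" for n
    unfolding box_bump_def by (intro prod.cong refl arg_cong2[of _ _ _ _ "(*)"] arg_cong[of _ _ "flat 0"])
      (auto simp: algebra_simps)
  ultimately show ?thesis using True by simp
qed (simp add: box_bump_outside)

subsection \<open>The fundamental lemma of the calculus of variations\<close>

text \<open>Open boxes form an intersection-stable generator of the Borel sets, so vanishing of the
  integrals spreads to all Borel sets by a Dynkin argument. It is run inside one box whose closure
  lies in \<Omega>, and countably many such boxes cover \<Omega>.\<close>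

lemma AE_zero_if_box_integrals_zero:
  fixes G :: "'a::euclidean_space \<Rightarrow> real"
  assumes \<Omega>: "open \<Omega>" and G: "integrable lborel G"
    and zero: "\<And>a b. cbox a b \<subseteq> \<Omega> \<Longrightarrow> (LINT x|lborel. indicator (box a b) x * G x) = 0"
  shows "AE x in lborel. x \<in> \<Omega> \<longrightarrow> G x = 0"
proof -
  have [measurable]: "G \<in> borel_measurable borel" using G by auto
  have loc: "AE x in lborel. x \<in> box c d \<longrightarrow> G x = 0" if cd: "cbox c d \<subseteq> \<Omega>" for c d
  proof -
    \<comment> \<open>Truncation to \<open>box c d\<close> makes the integral over the whole space
      zero, as the complement step of the induction requires.\<close>
    define F where "F x = indicator (box c d) x * G x" for x
    have intF: "integrable lborel F"
      using integrable_mult_indicator[OF _ G, of "box c d"] by (simp add: F_def[abs_def])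
    have int: "integrable lborel (\<lambda>x. indicator A x * F x)" if "A \<in> sets borel" for A
      using integrable_mult_indicator[OF _ intF, of A] that by simp
    have F0: "integral\<^sup>L lborel F = 0" using zero[OF cd] by (simp add: F_def[abs_def])
    have dyn: "set_lebesgue_integral lborel A F = 0" if A: "A \<in> sets borel" for A
    proof -
      have "Int_stable (range (\<lambda>(a, b). box a (b::'a)))"
        by (auto simp: Int_stable_def box_Int_box)
      moreover have "range (\<lambda>(a, b). box a (b::'a)) \<subseteq> Pow UNIV" by auto
      moreover have "A \<in> sigma_sets UNIV (range (\<lambda>(a, b). box a b))"
        using A by (subst (asm) borel_eq_box) simp
      ultimately show ?thesis
      proof (induction rule: sigma_sets_induct_disjoint)
        case (basic A)
        then obtain a b where A: "A = box a b" by auto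
        obtain e f where ef: "box a b \<inter> box c d = box e f" by (auto simp: box_Int_box)
        \<comment> \<open>If \<open>box e f\<close> is empty, \<open>cbox e f\<close> may be
          nonempty and need not lie in \<open>cbox c d\<close>; that case is settled because the
          integrand vanishes.\<close>
        have "(LINT x|lborel. indicator (box e f) x * G x) = 0"
        proof (cases "box e f = {}")
          case False
          then have "cbox e f = closure (box e f)" by (simp add: closure_box)
          also have "\<dots> \<subseteq> cbox c d"
            by (rule closure_minimal) (use ef box_subset_cbox in auto)
          finally show ?thesis using zero cd by blast
        qed simp
        then show ?case unfolding set_lebesgue_integral_def F_def A ef[symmetric]
          by (simp add: indicator_inter_arith mult.assoc)
      next
        case (compl A)
        then have "A \<in> sets borel" by (simp add: borel_eq_box)
        then have "(LINT x|lborel. F x - indicator A x * F x) = 0"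
          using intF int compl.IH F0 by (simp add: set_lebesgue_integral_def)
        moreover have "F x - indicator A x * F x = indicator (UNIV - A) x *\<^sub>R F x" for x
          by (simp add: indicator_def)
        ultimately show ?case by (simp add: set_lebesgue_integral_def)
      next
        case (union A)
        have A: "range A \<subseteq> sets borel" using union by (simp add: borel_eq_box)
        then have U: "(\<Union>i. A i) \<in> sets borel" by auto
        have "set_lebesgue_integral lborel (\<Union>i. A i) F = (\<Sum>i. set_lebesgue_integral lborel (A i) F)"
          using union by (intro lebesgue_integral_countable_add)
            (use A int[OF U] in \<open>auto simp: disjoint_family_on_def set_integrable_def\<close>)
        then show ?case using union by simp
      qed (simp add: set_lebesgue_integral_def)
    qed
    have "AE x in lborel. F x = 0"
      by (rule density_unique_real[OF intF]) (use dyn in \<open>auto simp: set_lebesgue_integral_def\<close>)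
    then show ?thesis by eventually_elim (auto simp: F_def)
  qed
  \<comment> \<open>The exceptional null set depends on the box. Lindelof's theorem leaves countably
    many boxes, whose null sets can be united.\<close>
  define \<B> where "\<B> = {box a b | a b. cbox a b \<subseteq> \<Omega>}"
  have "\<Union>\<B> = \<Omega>"
  proof
    show "\<Omega> \<subseteq> \<Union>\<B>"
    proof
      fix x assume "x \<in> \<Omega>"
      then obtain a b where "cbox a b \<subseteq> \<Omega>" "x \<in> box a b"
        using open_contains_cbox[OF \<Omega>] by metis
      then show "x \<in> \<Union>\<B>" by (auto simp: \<B>_def)
    qed
  qed (use box_subset_cbox in \<open>fastforce simp: \<B>_def\<close>)
  moreover obtain \<C> where C: "\<C> \<subseteq> \<B>" "countable \<C>" "\<Union>\<C> = \<Union>\<B>"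
    using Lindelof[of \<B>] by (auto simp: \<B>_def)
  moreover have "AE x in lborel. \<forall>B\<in>\<C>. x \<in> B \<longrightarrow> G x = 0"
    using C loc by (subst AE_ball_countable) (auto simp: \<B>_def)
  ultimately show ?thesis by (auto elim!: eventually_mono)
qed

text \<open>Dominated convergence along \<open>box_bump\<close> turns test functions into indicators
  of boxes, after which the statement on box integrals applies.\<close>

lemma fundamental_lemma:
  fixes f :: "'a::euclidean_space \<Rightarrow> real"
  assumes \<Omega>: "open \<Omega>" and f: "integrable (lebesgue_on \<Omega>) f"
    and zero: "\<And>\<phi>. \<phi> \<in> test_functions \<Omega> \<Longrightarrow> (LINT x|lebesgue_on \<Omega>. f x * \<phi> x) = 0"
  shows "AE x in lebesgue_on \<Omega>. f x = 0"
proof -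
  have \<Omega>l: "\<Omega> \<in> sets lebesgue" using \<Omega> by simp
  have fm: "f \<in> borel_measurable (lebesgue_on \<Omega>)" using f by auto
  have boxl: "(\<lambda>x. indicator (box a b) x :: real) \<in> borel_measurable (lebesgue_on \<Omega>)" for a b
    by (intro measurable_restrict_space1 borel_measurable_indicator) simp
  have box: "(LINT x|lebesgue_on \<Omega>. f x * indicator (box a b) x) = 0" if "cbox a b \<subseteq> \<Omega>" for a b
  proof -
    have "(\<lambda>n. LINT x|lebesgue_on \<Omega>. f x * box_bump n a b x) \<longlonglongrightarrow> (LINT x|lebesgue_on \<Omega>. f x * indicator (box a b) x)"
    proof (rule integral_dominated_convergence[where w = "\<lambda>x. norm (f x)"])
      fix n
      have "continuous_on \<Omega> (box_bump n a b)"
        using smooth_box_bump[of n a b] unfolding smooth_on_def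
        by (metis Ck_on.simps(1) continuous_on_subset subset_UNIV)
      then have "box_bump n a b \<in> borel_measurable (lebesgue_on \<Omega>)"
        using \<Omega>l by (rule continuous_imp_measurable_on_sets_lebesgue)
      then show "(\<lambda>x. f x * box_bump n a b x) \<in> borel_measurable (lebesgue_on \<Omega>)"
        using fm by measurable
      have "norm (f x * box_bump n a b x) \<le> norm (f x)" for x
        using box_bump_bounds[of n a b x] by (simp add: abs_mult mult_left_le)
      then show "AE x in lebesgue_on \<Omega>. norm (f x * box_bump n a b x) \<le> norm (f x)" by simp
    next
      show "(\<lambda>x. f x * indicator (box a b) x) \<in> borel_measurable (lebesgue_on \<Omega>)"
        using fm boxl by (rule borel_measurable_times)
      show "AE x in lebesgue_on \<Omega>. (\<lambda>n. f x * box_bump n a b x) \<longlonglongrightarrow> f x * indicator (box a b) x"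
        by (intro AE_I2 tendsto_mult tendsto_const box_bump_tendsto)
    qed (use f in simp)
    then show ?thesis by (simp add: zero[OF box_bump_test_function[OF that]] LIMSEQ_const_iff)
  qed
  \<comment> \<open>Box integrals determine functions on Borel sets, whereas \<open>f\<close> is
    only Lebesgue measurable. Its extension by 0 is therefore exchanged for a Borel function
    \<open>G\<close> that agrees with it almost everywhere.\<close>
  define F where "F x = indicator \<Omega> x * f x" for x
  have F: "integrable lebesgue F"
    using f \<Omega>l by (simp add: integrable_restrict_space F_def[abs_def])
  then obtain G where G: "G \<in> borel_measurable lborel" and FG: "AE x in lborel. F x = G x"
    using completion_ex_borel_measurable_real[of F lborel] by auto
  have FG': "AE x in lebesgue. F x = G x" using FG by (rule AE_completion)
  have Gl: "G \<in> borel_measurable lebesgue" using G by (rule measurable_completion)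
  have "integrable lebesgue G"
    by (rule integrable_cong_AE_imp[OF F Gl FG'])
  then have Gi: "integrable lborel G" using G by (simp add: integrable_completion)
  have "AE x in lborel. x \<in> \<Omega> \<longrightarrow> G x = 0"
  proof (rule AE_zero_if_box_integrals_zero[OF \<Omega> Gi])
    fix a b assume ab: "cbox a b \<subseteq> \<Omega>"
    have "(LINT x|lborel. indicator (box a b) x * G x) = (LINT x|lebesgue. indicator (box a b) x * G x)"
      using G by (intro integral_completion[symmetric] borel_measurable_times borel_measurable_indicator) auto
    also have "\<dots> = (LINT x|lebesgue. indicator \<Omega> x *\<^sub>R (f x * indicator (box a b) x))"
    proof (rule integral_cong_AE)
      have boxm: "(indicator (box a b) :: 'a \<Rightarrow> real) \<in> borel_measurable lebesgue"
        by (intro borel_measurable_indicator) simp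
      show "AE x in lebesgue. indicator (box a b) x * G x = indicator \<Omega> x *\<^sub>R (f x * indicator (box a b) x)"
        using FG' by eventually_elim (auto simp: F_def indicator_def split: if_splits)
      have "(\<lambda>x. F x * indicator (box a b) x) \<in> borel_measurable lebesgue"
        using F boxm by (intro borel_measurable_times) auto
      then show "(\<lambda>x. indicator \<Omega> x *\<^sub>R (f x * indicator (box a b) x)) \<in> borel_measurable lebesgue"
        by (simp add: F_def mult.assoc)
      show "(\<lambda>x. indicator (box a b) x * G x) \<in> borel_measurable lebesgue"
        using Gl boxm by (intro borel_measurable_times) auto
    qed
    also have "\<dots> = (LINT x|lebesgue_on \<Omega>. f x * indicator (box a b) x)"
      using \<Omega>l by (simp add: integral_restrict_space)
    finally show "(LINT x|lborel. indicator (box a b) x * G x) = 0" using box[OF ab] by simp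
  qed
  then have "AE x in lebesgue. x \<in> \<Omega> \<longrightarrow> G x = 0" by (rule AE_completion)
  with FG' have "AE x in lebesgue. x \<in> \<Omega> \<longrightarrow> f x = 0"
    by eventually_elim (auto simp: F_def)
  then show ?thesis using \<Omega>l by (simp add: AE_restrict_space_iff)
qed

subsection \<open>Weak gradients and the Sobolev space\<close>

lemma finite_measure_lebesgue_on:
  fixes \<Omega> :: "'a::euclidean_space set"
  assumes "open \<Omega>" "bounded \<Omega>"
  shows "finite_measure (lebesgue_on \<Omega>)"
proof -
  have "\<Omega> \<in> lmeasurable" using assms by (simp add: bounded_set_imp_lmeasurable)
  then show ?thesis by (rule finite_measure_lebesgue_on)
qed

lemma continuous_imp_L2:
  fixes f :: "'a::euclidean_space \<Rightarrow> 'b::euclidean_space"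
  assumes \<Omega>: "open \<Omega>" "bounded \<Omega>" and f: "continuous_on UNIV f"
  shows "f \<in> L2 (lebesgue_on \<Omega>)"
proof -
  have "compact (f ` closure \<Omega>)"
    using \<Omega> f by (intro compact_continuous_image) (auto intro: continuous_on_subset)
  then obtain B where B: "\<And>y. y \<in> f ` closure \<Omega> \<Longrightarrow> norm y \<le> B"
    using compact_imp_bounded bounded_iff by metis
  have "f \<in> borel_measurable (lebesgue_on \<Omega>)"
    using f \<Omega> by (intro continuous_imp_measurable_on_sets_lebesgue) (auto intro: continuous_on_subset)
  moreover have "norm (f x) \<le> B" if "x \<in> space (lebesgue_on \<Omega>)" for x
    using B that closure_subset[of \<Omega>] by auto
  ultimately show ?thesis
    by (rule L2_bounded[OF finite_measure_lebesgue_on[OF \<Omega>]])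
qed

lemma GDERIV_unique: "\<lbrakk>GDERIV f x :> D; GDERIV f x :> D'\<rbrakk> \<Longrightarrow> D = D'"
proof -
  assume "GDERIV f x :> D" "GDERIV f x :> D'"
  then have "(\<lambda>h. h \<bullet> D) = (\<lambda>h. h \<bullet> D')" unfolding gderiv_def by (rule has_derivative_unique)
  then have "\<forall>h. h \<bullet> D = h \<bullet> D'" by (simp add: fun_eq_iff)
  then show ?thesis by (simp add: vector_eq_ldot)
qed

lemma smooth_imp_continuous: "smooth_on S f \<Longrightarrow> continuous_on S f"
  unfolding smooth_on_def by (metis Ck_on.simps(1))

lemma smooth_GDERIV_obtains:
  assumes "smooth_on UNIV f"
  obtains D where "\<And>x. GDERIV f x :> D x"
  using assms unfolding smooth_on_def by (metis Ck_on.simps(2) UNIV_I)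

text \<open>The gradients inside \<open>Ck_on\<close> are existentially quantified; uniqueness of
  the gradient identifies them with the given \<open>D\<close>.\<close>

lemma smooth_GDERIV_continuous:
  assumes f: "smooth_on UNIV f" and D: "\<And>x. GDERIV f x :> D x" and i: "i \<in> Basis"
  shows "continuous_on UNIV (\<lambda>x. D x \<bullet> i)"
proof -
  have "Ck_on (Suc 0) f UNIV" using f by (simp add: smooth_on_def del: Ck_on.simps)
  then obtain g where g: "\<And>x. GDERIV f x :> g x" "\<And>i. i \<in> Basis \<Longrightarrow> continuous_on UNIV (\<lambda>x. g x \<bullet> i)"
    by auto
  have "g = D" using GDERIV_unique[OF g(1) D] by auto
  then show ?thesis using g(2)[OF i] by simp
qed

text \<open>For a fixed test function both sides become inner products with a fixed L^2 function, so
  linearity and closedness of weak gradients reduce to properties of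
  \<open>l2_inner\<close>.\<close>

lemma weak_gradient_iff:
  "weak_gradient \<Omega> u g \<longleftrightarrow> g \<in> L2 (lebesgue_on \<Omega>) \<and>
     (\<forall>\<phi>\<in>test_functions \<Omega>. \<forall>D. (\<forall>x. GDERIV \<phi> x :> D x) \<longrightarrow>
        (\<forall>i\<in>Basis. l2_inner (lebesgue_on \<Omega>) u (\<lambda>x. D x \<bullet> i) =
                    - l2_inner (lebesgue_on \<Omega>) g (\<lambda>x. \<phi> x *\<^sub>R i)))"
  by (simp add: weak_gradient_def l2_inner_def mult.commute)

locale bounded_open =
  fixes \<Omega> :: "'a::euclidean_space set"
  assumes open_dom: "open \<Omega>" and bounded_dom: "bounded \<Omega>"
begin

abbreviation "L \<equiv> lebesgue_on \<Omega>"

sublocale R: semi_hilbert "L2 L" "l2_inner L :: ('a \<Rightarrow> real) \<Rightarrow> _"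
  by (rule semi_hilbert_L2[OF finite_measure_lebesgue_on[OF open_dom bounded_dom]])

sublocale G: semi_hilbert "L2 L" "l2_inner L :: ('a \<Rightarrow> 'a) \<Rightarrow> _"
  by (rule semi_hilbert_L2[OF finite_measure_lebesgue_on[OF open_dom bounded_dom]])

lemma test_in_L2:
  assumes "\<phi> \<in> test_functions \<Omega>"
  shows "(\<lambda>x. \<phi> x *\<^sub>R (i::'a)) \<in> L2 L"
proof -
  have "continuous_on UNIV \<phi>" using assms by (simp add: test_functions_def smooth_imp_continuous)
  then show ?thesis by (intro continuous_imp_L2 open_dom bounded_dom continuous_intros)
qed

lemma test_deriv_in_L2:
  assumes "\<phi> \<in> test_functions \<Omega>" "\<forall>x. GDERIV \<phi> x :> D x" "i \<in> Basis"
  shows "(\<lambda>x. D x \<bullet> i) \<in> L2 L"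
  using assms smooth_GDERIV_continuous[of \<phi> D i]
  by (intro continuous_imp_L2 open_dom bounded_dom) (auto simp: test_functions_def)

lemma weak_gradient_unique:
  assumes "weak_gradient \<Omega> u g" "weak_gradient \<Omega> u h"
  shows "AE x in L. g x = h x"
proof -
  have gh: "g \<in> L2 L" "h \<in> L2 L" using assms by (auto simp: weak_gradient_def)
  then have d: "g - h \<in> L2 L" by simp
  have "AE x in L. (g - h) x \<bullet> i = 0" if i: "i \<in> Basis" for i
  proof (rule fundamental_lemma[OF open_dom])
    have "(\<lambda>x. i) \<in> L2 L" by (intro continuous_imp_L2 open_dom bounded_dom continuous_intros)
    then show "integrable L (\<lambda>x. (g - h) x \<bullet> i)" by (rule L2_integrable_inner[OF d])
    fix \<phi> assume \<phi>: "\<phi> \<in> test_functions \<Omega>"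
    then obtain D where D: "\<And>x. GDERIV \<phi> x :> D x"
      using smooth_GDERIV_obtains by (auto simp: test_functions_def)
    have "l2_inner L (g - h) (\<lambda>x. \<phi> x *\<^sub>R i) = 0"
      using assms \<phi> D i gh test_in_L2[OF \<phi>, of i] unfolding weak_gradient_iff
      by (simp add: G.diff_left) (metis (no_types, lifting) neg_equal_iff_equal)
    then show "(LINT x|L. (g - h) x \<bullet> i * \<phi> x) = 0"
      by (simp add: l2_inner_def mult.commute)
  qed
  then have "AE x in L. \<forall>i\<in>Basis. (g - h) x \<bullet> i = 0" by (intro AE_finite_allI) auto
  then show ?thesis by eventually_elim (auto simp: euclidean_eq_iff[where 'a = 'a] inner_diff)
qed

lemma weak_gradient_add:
  assumes "u \<in> L2 L" "v \<in> L2 L" "weak_gradient \<Omega> u g" "weak_gradient \<Omega> v h"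
  shows "weak_gradient \<Omega> (u + v) (g + h)"
  using assms test_in_L2 test_deriv_in_L2 unfolding weak_gradient_iff
  by (auto simp: G.add_left R.add_left)

lemma weak_gradient_scaleR:
  assumes "u \<in> L2 L" "weak_gradient \<Omega> u g"
  shows "weak_gradient \<Omega> (c *\<^sub>R u) (c *\<^sub>R g)"
  using assms test_in_L2 test_deriv_in_L2 unfolding weak_gradient_iff
  by (auto simp: G.scaleR_left R.scaleR_left)

text \<open>The step that makes H^1 complete: both sides of the identity are continuous under L^2
  convergence.\<close>

lemma weak_gradient_closed:
  assumes X: "\<And>n::nat. X n \<in> L2 L" "\<And>n. weak_gradient \<Omega> (X n) (W n)"
    and u: "u \<in> L2 L" "(\<lambda>n. l2_inner L (X n - u) (X n - u)) \<longlonglongrightarrow> 0"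
    and g: "g \<in> L2 L" "(\<lambda>n. l2_inner L (W n - g) (W n - g)) \<longlonglongrightarrow> 0"
  shows "weak_gradient \<Omega> u g"
proof -
  have W: "W n \<in> L2 L" for n using X(2) by (simp add: weak_gradient_iff)
  have "l2_inner L u (\<lambda>x. D x \<bullet> i) = - l2_inner L g (\<lambda>x. \<phi> x *\<^sub>R i)"
    if \<phi>: "\<phi> \<in> test_functions \<Omega>" "\<forall>x. GDERIV \<phi> x :> D x" "i \<in> Basis" for \<phi> D i
  proof (rule LIMSEQ_unique)
    show "(\<lambda>n. l2_inner L (X n) (\<lambda>x. D x \<bullet> i)) \<longlonglongrightarrow> l2_inner L u (\<lambda>x. D x \<bullet> i)"
      by (rule R.ip_tendsto_left[OF X(1) u(1) test_deriv_in_L2[OF \<phi>] u(2)])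
    have "l2_inner L (X n) (\<lambda>x. D x \<bullet> i) = - l2_inner L (W n) (\<lambda>x. \<phi> x *\<^sub>R i)" for n
      using X(2) \<phi> by (auto simp: weak_gradient_iff)
    then show "(\<lambda>n. l2_inner L (X n) (\<lambda>x. D x \<bullet> i)) \<longlonglongrightarrow> - l2_inner L g (\<lambda>x. \<phi> x *\<^sub>R i)"
      using tendsto_minus[OF G.ip_tendsto_left[OF W g(1) test_in_L2[OF \<phi>(1)] g(2)]] by simp
  qed
  then show ?thesis using g(1) by (simp add: weak_gradient_iff)
qed

section \<open>Completeness of the Sobolev space\<close>

lemma H1_L2: "u \<in> H1 \<Omega> \<Longrightarrow> u \<in> L2 L"
  by (simp add: H1_def)

lemma grad_weak_gradient: "u \<in> H1 \<Omega> \<Longrightarrow> weak_gradient \<Omega> u (grad \<Omega> u)"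
proof -
  assume "u \<in> H1 \<Omega>"
  then have "\<exists>g. weak_gradient \<Omega> u g" by (simp add: H1_def)
  then show ?thesis unfolding grad_def by (rule someI_ex)
qed

lemma grad_L2: "u \<in> H1 \<Omega> \<Longrightarrow> grad \<Omega> u \<in> L2 L"
  using grad_weak_gradient by (simp add: weak_gradient_iff)

lemma subspace_H1: "subspace (H1 \<Omega>)"
proof (rule subspaceI)
  show "0 \<in> H1 \<Omega>"
    by (auto simp: H1_def weak_gradient_iff R.ip_zero G.ip_zero test_in_L2 test_deriv_in_L2 intro!: exI[of _ 0])
next
  show "u + v \<in> H1 \<Omega>" if "u \<in> H1 \<Omega>" "v \<in> H1 \<Omega>" for u v
    using that weak_gradient_add R.mem(2) unfolding H1_def by blast
  show "c *\<^sub>R u \<in> H1 \<Omega>" if "u \<in> H1 \<Omega>" for c u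
    using that weak_gradient_scaleR R.mem(4) unfolding H1_def by blast
qed

lemma H1_add: "\<lbrakk>u \<in> H1 \<Omega>; v \<in> H1 \<Omega>\<rbrakk> \<Longrightarrow> u + v \<in> H1 \<Omega>"
  and H1_scaleR: "u \<in> H1 \<Omega> \<Longrightarrow> c *\<^sub>R u \<in> H1 \<Omega>"
  and H1_diff: "\<lbrakk>u \<in> H1 \<Omega>; v \<in> H1 \<Omega>\<rbrakk> \<Longrightarrow> u - v \<in> H1 \<Omega>"
  using subspace_H1 by (simp_all add: subspace_add subspace_scale subspace_diff)

lemma grad_add:
  assumes "u \<in> H1 \<Omega>" "v \<in> H1 \<Omega>"
  shows "AE x in L. grad \<Omega> (u + v) x = (grad \<Omega> u + grad \<Omega> v) x"
  by (rule weak_gradient_unique[OF grad_weak_gradient weak_gradient_add])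
    (use assms in \<open>simp_all add: H1_add H1_L2 grad_weak_gradient\<close>)

lemma grad_scaleR:
  assumes "u \<in> H1 \<Omega>"
  shows "AE x in L. grad \<Omega> (c *\<^sub>R u) x = (c *\<^sub>R grad \<Omega> u) x"
  by (rule weak_gradient_unique[OF grad_weak_gradient weak_gradient_scaleR])
    (use assms in \<open>simp_all add: H1_scaleR H1_L2 grad_weak_gradient\<close>)

lemma grad_diff:
  assumes "u \<in> H1 \<Omega>" "v \<in> H1 \<Omega>"
  shows "AE x in L. grad \<Omega> (u - v) x = (grad \<Omega> u - grad \<Omega> v) x"
  using grad_add[OF assms(1) H1_scaleR[OF assms(2), of "-1"]] grad_scaleR[OF assms(2), of "-1"]
  by eventually_elim simp

lemma l2_grad_add:
  assumes "u \<in> H1 \<Omega>" "v \<in> H1 \<Omega>" "h \<in> L2 L"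
  shows "l2_inner L (grad \<Omega> (u + v)) h = l2_inner L (grad \<Omega> u) h + l2_inner L (grad \<Omega> v) h"
proof -
  have "l2_inner L (grad \<Omega> (u + v)) h = l2_inner L (grad \<Omega> u + grad \<Omega> v) h"
    using assms grad_add by (intro l2_inner_cong_AE) (auto simp: grad_L2 H1_add)
  then show ?thesis using assms by (simp add: G.add_left grad_L2)
qed

lemma l2_grad_scaleR:
  assumes "u \<in> H1 \<Omega>" "h \<in> L2 L"
  shows "l2_inner L (grad \<Omega> (c *\<^sub>R u)) h = c * l2_inner L (grad \<Omega> u) h"
proof -
  have "l2_inner L (grad \<Omega> (c *\<^sub>R u)) h = l2_inner L (c *\<^sub>R grad \<Omega> u) h"
    using assms grad_scaleR by (intro l2_inner_cong_AE) (auto simp: grad_L2 H1_scaleR)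
  then show ?thesis using assms by (simp add: G.scaleR_left grad_L2)
qed

lemma l2_grad_diff_diag:
  assumes "u \<in> H1 \<Omega>" "v \<in> H1 \<Omega>"
  shows "l2_inner L (grad \<Omega> (u - v)) (grad \<Omega> (u - v)) = l2_inner L (grad \<Omega> u - grad \<Omega> v) (grad \<Omega> u - grad \<Omega> v)"
  using assms grad_diff by (intro l2_inner_cong_AE) (auto simp: grad_L2 H1_diff)

text \<open>Functions and gradients converge separately in L^2. By closedness the limit of the
  gradients is a weak gradient of the limit function, and by uniqueness it may be exchanged for
  \<open>grad \<Omega> u\<close> in every integral, although \<open>grad\<close> is an arbitrary
  choice.\<close>

sublocale H: semi_hilbert "H1 \<Omega>" "h1_inner \<Omega>"
proof
  fix X :: "nat \<Rightarrow> 'a \<Rightarrow> real"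
  assume X: "\<And>n. X n \<in> H1 \<Omega>"
    and C: "\<And>e. e > 0 \<Longrightarrow> \<exists>N. \<forall>m\<ge>N. \<forall>n\<ge>N. h1_inner \<Omega> (X m - X n) (X m - X n) < e"
  let ?G = "\<lambda>n. grad \<Omega> (X n)"
  have split: "h1_inner \<Omega> (X m - X n) (X m - X n) =
      l2_inner L (X m - X n) (X m - X n) + l2_inner L (?G m - ?G n) (?G m - ?G n)" for m n
    using l2_grad_diff_diag[OF X X] by (simp add: h1_inner_def)
  have nn: "0 \<le> l2_inner L (X m - X n) (X m - X n)" "0 \<le> l2_inner L (?G m - ?G n) (?G m - ?G n)" for m n
    using X by (simp_all add: R.nonneg G.nonneg H1_L2 grad_L2)
  have "\<exists>N. \<forall>m\<ge>N. \<forall>n\<ge>N. l2_inner L (X m - X n) (X m - X n) < e" if e: "e > 0" for e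
    using C[OF e] nn(2) unfolding split by (meson le_add_same_cancel1 le_less_trans)
  then obtain u where u: "u \<in> L2 L" "(\<lambda>n. l2_inner L (X n - u) (X n - u)) \<longlonglongrightarrow> 0"
    using R.complete[of X] X H1_L2 by blast
  have "\<exists>N. \<forall>m\<ge>N. \<forall>n\<ge>N. l2_inner L (?G m - ?G n) (?G m - ?G n) < e" if e: "e > 0" for e
    using C[OF e] nn(1) unfolding split by (meson le_add_same_cancel2 le_less_trans)
  then obtain g where g: "g \<in> L2 L" "(\<lambda>n. l2_inner L (?G n - g) (?G n - g)) \<longlonglongrightarrow> 0"
    using G.complete[of ?G] X grad_L2 by blast
  have wg: "weak_gradient \<Omega> u g"
    by (rule weak_gradient_closed[OF H1_L2[OF X] grad_weak_gradient[OF X] u g])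
  then have uH: "u \<in> H1 \<Omega>" using u by (auto simp: H1_def)
  have gu: "AE x in L. grad \<Omega> u x = g x"
    by (rule weak_gradient_unique[OF grad_weak_gradient[OF uH] wg])
  have "h1_inner \<Omega> (X n - u) (X n - u) = l2_inner L (X n - u) (X n - u) + l2_inner L (?G n - g) (?G n - g)" for n
  proof -
    have "l2_inner L (?G n - grad \<Omega> u) (?G n - grad \<Omega> u) = l2_inner L (?G n - g) (?G n - g)"
      using X uH g gu by (intro l2_inner_cong_AE) (auto simp: grad_L2 elim: eventually_mono)
    then show ?thesis using l2_grad_diff_diag[OF X uH] by (simp add: h1_inner_def)
  qed
  then show "\<exists>u\<in>H1 \<Omega>. (\<lambda>n. h1_inner \<Omega> (X n - u) (X n - u)) \<longlonglongrightarrow> 0"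
    using tendsto_add[OF u(2) g(2)] uH by (intro bexI[of _ u]) simp_all
next
  show "h1_inner \<Omega> u v = h1_inner \<Omega> v u" for u v
    by (simp add: h1_inner_def l2_inner_def inner_commute mult.commute)
qed (auto simp: subspace_H1 h1_inner_def R.add_left R.scaleR_left R.nonneg G.nonneg l2_grad_add
      l2_grad_scaleR H1_L2 grad_L2 algebra_simps)

lemma l2_le_h1: "u \<in> H1 \<Omega> \<Longrightarrow> l2_inner L u u \<le> h1_inner \<Omega> u u"
  by (simp add: h1_inner_def G.nonneg grad_L2)

end

subsection \<open>Traces and the spaces with boundary conditions\<close>

lemma sets_hausdorff_measure [simp]: "sets (hausdorff_measure s :: 'a::metric_space measure) = sets borel"
  using sets.sigma_sets_eq[of "borel :: 'a measure"] by (simp add: hausdorff_measure_def)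

lemma space_hausdorff_measure [simp]: "space (hausdorff_measure s) = UNIV"
  by (simp add: hausdorff_measure_def)

text \<open>The trace operator is described on the whole boundary, while the boundary condition and
  the control live on parts of it. Viewing the surface measure of a part as a restriction carries
  the properties of the trace over.\<close>

lemma surface_restrict:
  fixes S T :: "'a::euclidean_space set"
  assumes "S \<subseteq> T" "S \<in> sets borel" "T \<in> sets borel"
  shows "surface S = restrict_space (surface T) S" "S \<inter> space (surface T) \<in> sets (surface T)"
proof -
  show "surface S = restrict_space (surface T) S"
    using assms by (simp add: surface_def restrict_restrict_space Int_absorb1)
  have "S = T \<inter> S" using assms by auto
  then have "S \<in> (\<inter>) T ` sets borel" using assms by blast
  then show "S \<inter> space (surface T) \<in> sets (surface T)"
    using assms by (simp add: surface_def space_restrict_space sets_restrict_space Int_absorb2)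
qed

lemma L2_restrict_space:
  assumes S: "S \<inter> space M \<in> sets M" and f: "f \<in> L2 M"
  shows "f \<in> L2 (restrict_space M S)"
    "l2_inner (restrict_space M S) f f \<le> l2_inner M f f"
proof -
  have i: "integrable M (\<lambda>x. (norm (f x))\<^sup>2)" using f by (simp add: L2_def)
  have j: "integrable M (\<lambda>x. indicator S x *\<^sub>R (norm (f x))\<^sup>2)"
  proof (rule Bochner_Integration.integrable_bound[OF i])
    have "(\<lambda>x. (norm (f x))\<^sup>2) \<in> borel_measurable M" using i by auto
    then have "(\<lambda>x. (norm (f x))\<^sup>2) \<in> borel_measurable (restrict_space M S)"
      by (rule measurable_restrict_space1)
    then show "(\<lambda>x. indicator S x *\<^sub>R (norm (f x))\<^sup>2) \<in> borel_measurable M"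
      using borel_measurable_restrict_space_iff[OF S, of "\<lambda>x. (norm (f x))\<^sup>2"] by simp
  qed (auto simp: indicator_def)
  show "f \<in> L2 (restrict_space M S)"
    using f j by (simp add: L2_def integrable_restrict_space[OF S] measurable_restrict_space1)
  have "(LINT x|M. indicator S x *\<^sub>R (norm (f x))\<^sup>2) \<le> (LINT x|M. (norm (f x))\<^sup>2)"
    by (rule integral_mono[OF j i]) (auto simp: indicator_def)
  then show "l2_inner (restrict_space M S) f f \<le> l2_inner M f f"
    by (simp add: l2_inner_def integral_restrict_space[OF S] power2_norm_eq_inner)
qed

locale trace_space = bounded_open \<Omega> for \<Omega> :: "'a::euclidean_space set" +
  fixes \<gamma>0 :: "('a \<Rightarrow> real) \<Rightarrow> 'a \<Rightarrow> real"
  assumes trace: "trace_operator \<Omega> \<gamma>0"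
begin

definition bpart :: "'a set \<Rightarrow> bool" where
  "bpart S \<longleftrightarrow> S \<subseteq> frontier \<Omega> \<and> S \<in> sets borel"

lemma surface_bpart:
  assumes "bpart S"
  shows "surface S = restrict_space (surface (frontier \<Omega>)) S"
    "S \<inter> space (surface (frontier \<Omega>)) \<in> sets (surface (frontier \<Omega>))"
  using assms surface_restrict[of S "frontier \<Omega>"] by (auto simp: bpart_def borel_closed)

lemma trace_L2:
  assumes "bpart S" "u \<in> H1 \<Omega>"
  shows "\<gamma>0 u \<in> L2 (surface S)"
proof -
  have "\<gamma>0 u \<in> L2 (surface (frontier \<Omega>))" using trace assms(2) by (auto simp: trace_operator_def)
  then show ?thesis using L2_restrict_space(1)[OF surface_bpart(2)[OF assms(1)]]
    by (simp add: surface_bpart(1)[OF assms(1)])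
qed

lemma trace_linear:
  assumes S: "bpart S" and uv: "u \<in> H1 \<Omega>" "v \<in> H1 \<Omega>"
  shows "AE x in surface S. \<gamma>0 (a *\<^sub>R u + b *\<^sub>R v) x = (a *\<^sub>R \<gamma>0 u + b *\<^sub>R \<gamma>0 v) x"
proof -
  have "AE x in surface (frontier \<Omega>). \<gamma>0 (\<lambda>x. a * u x + b * v x) x = a * \<gamma>0 u x + b * \<gamma>0 v x"
    using trace uv unfolding trace_operator_def by blast
  moreover have "(\<lambda>x. a * u x + b * v x) = a *\<^sub>R u + b *\<^sub>R v" by (simp add: fun_eq_iff)
  ultimately have "AE x in surface (frontier \<Omega>). \<gamma>0 (a *\<^sub>R u + b *\<^sub>R v) x = a * \<gamma>0 u x + b * \<gamma>0 v x"
    by simp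
  then show ?thesis unfolding surface_bpart(1)[OF S] AE_restrict_space_iff[OF surface_bpart(2)[OF S]]
    by eventually_elim simp
qed

lemma trace_bounded:
  assumes S: "bpart S"
  obtains C where "\<And>u. u \<in> H1 \<Omega> \<Longrightarrow> l2_inner (surface S) (\<gamma>0 u) (\<gamma>0 u) \<le> C * h1_inner \<Omega> u u"
proof -
  obtain C where C: "\<And>u. u \<in> H1 \<Omega> \<Longrightarrow> l2_norm (surface (frontier \<Omega>)) (\<gamma>0 u) \<le> C * h1_norm \<Omega> u"
    using trace unfolding trace_operator_def by blast
  have "l2_inner (surface S) (\<gamma>0 u) (\<gamma>0 u) \<le> C\<^sup>2 * h1_inner \<Omega> u u" if u: "u \<in> H1 \<Omega>" for u
  proof -
    let ?F = "surface (frontier \<Omega>)"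
    have L: "\<gamma>0 u \<in> L2 ?F" using trace u by (auto simp: trace_operator_def)
    have nn: "0 \<le> l2_inner ?F (\<gamma>0 u) (\<gamma>0 u)" by (rule semi_inner.nonneg[OF semi_inner_L2 L])
    have "l2_inner (surface S) (\<gamma>0 u) (\<gamma>0 u) \<le> l2_inner ?F (\<gamma>0 u) (\<gamma>0 u)"
      using L2_restrict_space(2)[OF surface_bpart(2)[OF S] L] by (simp add: surface_bpart(1)[OF S])
    also have "\<dots> = (l2_norm ?F (\<gamma>0 u))\<^sup>2" using nn by (simp add: l2_norm_def)
    also have "\<dots> \<le> (C * h1_norm \<Omega> u)\<^sup>2"
      using C[OF u] nn by (intro power_mono) (auto simp: l2_norm_def)
    also have "\<dots> = C\<^sup>2 * h1_inner \<Omega> u u" using H.nonneg[OF u] by (simp add: h1_norm_def power_mult_distrib)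
    finally show ?thesis .
  qed
  then show ?thesis using that by blast
qed

lemma l2_trace_linear:
  assumes S: "bpart S" and uv: "u \<in> H1 \<Omega>" "v \<in> H1 \<Omega>" and w: "w \<in> L2 (surface S)"
  shows "l2_inner (surface S) w (\<gamma>0 (a *\<^sub>R u + b *\<^sub>R v)) =
    a * l2_inner (surface S) w (\<gamma>0 u) + b * l2_inner (surface S) w (\<gamma>0 v)"
proof -
  interpret S: semi_inner "L2 (surface S)" "l2_inner (surface S) :: ('a \<Rightarrow> real) \<Rightarrow> _" by (rule semi_inner_L2)
  have t: "\<gamma>0 u \<in> L2 (surface S)" "\<gamma>0 v \<in> L2 (surface S)" using trace_L2 S uv by auto
  have "l2_inner (surface S) w (\<gamma>0 (a *\<^sub>R u + b *\<^sub>R v)) = l2_inner (surface S) w (a *\<^sub>R \<gamma>0 u + b *\<^sub>R \<gamma>0 v)"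
    by (rule l2_inner_cong_AE) (use w t trace_linear[OF S uv] trace_L2[OF S] uv in simp_all)
  then show ?thesis using t w by (simp add: S.ip_simps)
qed

lemma H1_D_H1: "u \<in> H1_D \<Omega> \<Gamma>D \<gamma>0 \<Longrightarrow> u \<in> H1 \<Omega>"
  by (simp add: H1_D_def)

lemma subspace_H1_D:
  assumes S: "bpart \<Gamma>D"
  shows "subspace (H1_D \<Omega> \<Gamma>D \<gamma>0)"
proof -
  have lc: "a *\<^sub>R u + b *\<^sub>R v \<in> H1_D \<Omega> \<Gamma>D \<gamma>0"
    if "u \<in> H1 \<Omega>" "v \<in> H1 \<Omega>" "AE x in surface \<Gamma>D. (a *\<^sub>R \<gamma>0 u + b *\<^sub>R \<gamma>0 v) x = 0" for a b u v
    using that(1,2) trace_linear[OF S that(1,2), of a b] that(3) by (auto simp: H1_D_def)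
  show ?thesis
  proof (rule subspaceI)
    show "0 \<in> H1_D \<Omega> \<Gamma>D \<gamma>0" using lc[of 0 0 0 0] by simp
    show "u + v \<in> H1_D \<Omega> \<Gamma>D \<gamma>0" if "u \<in> H1_D \<Omega> \<Gamma>D \<gamma>0" "v \<in> H1_D \<Omega> \<Gamma>D \<gamma>0" for u v
    proof -
      have "AE x in surface \<Gamma>D. \<gamma>0 u x = 0" "AE x in surface \<Gamma>D. \<gamma>0 v x = 0"
        using that by (auto simp: H1_D_def)
      then have "AE x in surface \<Gamma>D. (1 *\<^sub>R \<gamma>0 u + 1 *\<^sub>R \<gamma>0 v) x = 0" by eventually_elim simp
      then show ?thesis using lc[of u v 1 1] that H1_D_H1 by simp
    qed
    show "c *\<^sub>R u \<in> H1_D \<Omega> \<Gamma>D \<gamma>0" if "u \<in> H1_D \<Omega> \<Gamma>D \<gamma>0" for c u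
    proof -
      have "AE x in surface \<Gamma>D. \<gamma>0 u x = 0" using that by (auto simp: H1_D_def)
      then have "AE x in surface \<Gamma>D. (c *\<^sub>R \<gamma>0 u + 0 *\<^sub>R \<gamma>0 u) x = 0" by eventually_elim simp
      then show ?thesis using lc[of u u c 0] that H1_D_H1 by simp
    qed
  qed
qed

text \<open>The boundary condition is closed in H^1. As the trace of \<open>X n\<close> vanishes on
  \<Gamma>D, the trace of \<open>u\<close> there is minus the trace of \<open>X n - u\<close>, whose
  norm is bounded by the distance from \<open>X n\<close> to \<open>u\<close>.\<close>

lemma semi_hilbert_H1_D:
  assumes S: "bpart \<Gamma>D"
  shows "semi_hilbert (H1_D \<Omega> \<Gamma>D \<gamma>0) (h1_inner \<Omega>)"
proof
  fix X :: "nat \<Rightarrow> 'a \<Rightarrow> real"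
  assume X: "\<And>n. X n \<in> H1_D \<Omega> \<Gamma>D \<gamma>0"
    and C: "\<And>e. e > 0 \<Longrightarrow> \<exists>N. \<forall>m\<ge>N. \<forall>n\<ge>N. h1_inner \<Omega> (X m - X n) (X m - X n) < e"
  have XH: "X n \<in> H1 \<Omega>" for n using X H1_D_H1 by blast
  obtain u where u: "u \<in> H1 \<Omega>" and lim: "(\<lambda>n. h1_inner \<Omega> (X n - u) (X n - u)) \<longlonglongrightarrow> 0"
    using H.complete[OF XH C] by blast
  obtain K where K: "\<And>u. u \<in> H1 \<Omega> \<Longrightarrow> l2_inner (surface \<Gamma>D) (\<gamma>0 u) (\<gamma>0 u) \<le> K * h1_inner \<Omega> u u"
    using trace_bounded[OF S] by blast
  have le: "l2_inner (surface \<Gamma>D) (\<gamma>0 u) (\<gamma>0 u) \<le> K * h1_inner \<Omega> (X n - u) (X n - u)" for n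
  proof -
    have "AE x in surface \<Gamma>D. \<gamma>0 (X n) x = 0" using X by (auto simp: H1_D_def)
    then have ae: "AE x in surface \<Gamma>D. \<gamma>0 u x = ((-1) *\<^sub>R \<gamma>0 (X n - u)) x"
      using trace_linear[OF S XH[of n] u, where a = 1 and b = "-1"] by eventually_elim simp
    have t: "\<gamma>0 u \<in> L2 (surface \<Gamma>D)" "(-1) *\<^sub>R \<gamma>0 (X n - u) \<in> L2 (surface \<Gamma>D)"
      by (rule trace_L2[OF S u], rule subspace_scale[OF subspace_L2 trace_L2[OF S H.mem(3)[OF XH u]]])
    have "l2_inner (surface \<Gamma>D) (\<gamma>0 u) (\<gamma>0 u) = l2_inner (surface \<Gamma>D) ((-1) *\<^sub>R \<gamma>0 (X n - u)) ((-1) *\<^sub>R \<gamma>0 (X n - u))"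
      by (rule l2_inner_cong_AE[OF t t ae ae])
    also have "\<dots> = l2_inner (surface \<Gamma>D) (\<gamma>0 (X n - u)) (\<gamma>0 (X n - u))"
      by (simp add: l2_inner_def)
    also have "\<dots> \<le> K * h1_inner \<Omega> (X n - u) (X n - u)" by (rule K[OF H.mem(3)[OF XH u]])
    finally show ?thesis .
  qed
  have tu: "\<gamma>0 u \<in> L2 (surface \<Gamma>D)" by (rule trace_L2[OF S u])
  have "l2_inner (surface \<Gamma>D) (\<gamma>0 u) (\<gamma>0 u) \<le> K * 0"
    by (rule LIMSEQ_le_const[OF tendsto_mult_left[OF lim]]) (use le in blast)
  then have "l2_inner (surface \<Gamma>D) (\<gamma>0 u) (\<gamma>0 u) = 0"
    using semi_inner.nonneg[OF semi_inner_L2 tu] by simp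
  then have "u \<in> H1_D \<Omega> \<Gamma>D \<gamma>0" using u L2_null_iff[OF tu] by (simp add: H1_D_def)
  then show "\<exists>u\<in>H1_D \<Omega> \<Gamma>D \<gamma>0. (\<lambda>n. h1_inner \<Omega> (X n - u) (X n - u)) \<longlonglongrightarrow> 0" using lim by blast
qed (use subspace_H1_D[OF S] H1_D_H1 in \<open>auto simp: H.ip_simps H.sym H.nonneg\<close>)

end

subsection \<open>The state equation\<close>

locale state_problem = trace_space \<Omega> \<gamma>0 for \<Omega> :: "'a::euclidean_space set" and \<gamma>0 +
  fixes \<Gamma>D \<Gamma>C :: "'a set" and \<tau> \<kappa>low :: real and \<kappa> :: "'a \<Rightarrow> real"
  assumes \<Gamma>D: "bpart \<Gamma>D" and \<Gamma>C: "bpart \<Gamma>C"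
    and \<tau>: "\<tau> > 0" and \<kappa>: "\<kappa> \<in> L_infinity (lebesgue_on \<Omega>)" and \<kappa>low: "\<kappa>low > 0"
    and coercive: "\<And>\<psi>. \<psi> \<in> H1_D \<Omega> \<Gamma>D \<gamma>0 \<Longrightarrow> \<kappa>low * (h1_norm \<Omega> \<psi>)\<^sup>2 \<le> A_op \<Omega> \<tau> \<kappa> \<psi> \<psi>"
begin

abbreviation "V \<equiv> H1_D \<Omega> \<Gamma>D \<gamma>0"
abbreviation "LC \<equiv> surface \<Gamma>C"
abbreviation "a \<equiv> A_op \<Omega> \<tau> \<kappa>"
abbreviation "b \<equiv> B_op \<Gamma>C \<gamma>0 \<tau>"

sublocale V: semi_hilbert V "h1_inner \<Omega>"
  by (rule semi_hilbert_H1_D[OF \<Gamma>D])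

sublocale C: semi_inner "L2 LC" "l2_inner LC :: ('a \<Rightarrow> real) \<Rightarrow> _"
  by (rule semi_inner_L2)

lemma V_H1: "u \<in> V \<Longrightarrow> u \<in> H1 \<Omega>"
  by (rule H1_D_H1)

lemma V_L2: "u \<in> V \<Longrightarrow> u \<in> L2 L"
  by (simp add: V_H1 H1_L2)

lemma \<kappa>_bound: obtains K where "AE x in L. \<bar>\<kappa> x\<bar> \<le> K" "0 \<le> K"
proof -
  obtain K where "AE x in L. \<bar>\<kappa> x\<bar> \<le> K" using \<kappa> by (auto simp: L_infinity_def)
  then have "AE x in L. \<bar>\<kappa> x\<bar> \<le> \<bar>K\<bar>" by eventually_elim simp
  then show ?thesis using that by simp
qed

lemma \<kappa>_mult_L2:
  assumes g: "g \<in> L2 L"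
  shows "(\<lambda>x. \<kappa> x *\<^sub>R g x :: 'a) \<in> L2 L"
proof -
  obtain K where K: "AE x in L. \<bar>\<kappa> x\<bar> \<le> K" "0 \<le> K" using \<kappa>_bound by blast
  have m: "(\<lambda>x. \<kappa> x *\<^sub>R g x) \<in> borel_measurable L"
    using \<kappa> g by (intro borel_measurable_scaleR) (auto simp: L_infinity_def L2_def)
  have "integrable L (\<lambda>x. K\<^sup>2 * (norm (g x))\<^sup>2)" using g by (auto simp: L2_def)
  then have "integrable L (\<lambda>x. (norm (\<kappa> x *\<^sub>R g x))\<^sup>2)"
  proof (rule Bochner_Integration.integrable_bound)
    show "(\<lambda>x. (norm (\<kappa> x *\<^sub>R g x))\<^sup>2) \<in> borel_measurable L" using m by measurable
    show "AE x in L. norm ((norm (\<kappa> x *\<^sub>R g x))\<^sup>2) \<le> norm (K\<^sup>2 * (norm (g x))\<^sup>2)"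
      using K(1)
    proof eventually_elim
      fix x assume "\<bar>\<kappa> x\<bar> \<le> K"
      then have "(norm (\<kappa> x *\<^sub>R g x))\<^sup>2 \<le> (K * norm (g x))\<^sup>2"
        by (intro power_mono) (auto intro: mult_right_mono)
      then show "norm ((norm (\<kappa> x *\<^sub>R g x))\<^sup>2) \<le> norm (K\<^sup>2 * (norm (g x))\<^sup>2)"
        by (simp add: power_mult_distrib)
    qed
  qed
  then show ?thesis using m by (simp add: L2_def)
qed

text \<open>\<kappa> is scalar valued. Symmetry lets \<open>a\<close> serve as an inner product on
  \<open>V\<close> and makes the adjoint equation involve the same operator as the state
  equation.\<close>

lemma A_sym: "a u v = a v u"
  by (simp add: A_op_def l2_inner_def inner_commute mult.commute)

lemma A_add_right:
  assumes "u \<in> H1 \<Omega>" "v \<in> H1 \<Omega>" "w \<in> H1 \<Omega>"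
  shows "a w (u + v) = a w u + a w v"
proof -
  have k: "(\<lambda>x. \<kappa> x *\<^sub>R grad \<Omega> w x) \<in> L2 L" using assms by (intro \<kappa>_mult_L2 grad_L2)
  show ?thesis using assms k l2_grad_add[OF assms(1,2) k]
    by (simp add: A_op_def R.add_right H1_L2 G.sym[OF k] grad_L2 H1_add distrib_left)
qed

lemma A_scaleR_right:
  assumes "u \<in> H1 \<Omega>" "w \<in> H1 \<Omega>"
  shows "a w (c *\<^sub>R u) = c * a w u"
proof -
  have k: "(\<lambda>x. \<kappa> x *\<^sub>R grad \<Omega> w x) \<in> L2 L" using assms by (intro \<kappa>_mult_L2 grad_L2)
  show ?thesis using assms k l2_grad_scaleR[OF assms(1) k, of c]
    by (simp add: A_op_def R.scaleR_right H1_L2 G.sym[OF k] grad_L2 H1_scaleR algebra_simps)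
qed

lemma A_bounded:
  obtains K where "\<And>u. u \<in> H1 \<Omega> \<Longrightarrow> a u u \<le> K * h1_inner \<Omega> u u"
proof -
  obtain K where K: "AE x in L. \<bar>\<kappa> x\<bar> \<le> K" "0 \<le> K" using \<kappa>_bound by blast
  have "a u u \<le> (1 + \<tau> * K) * h1_inner \<Omega> u u" if u: "u \<in> H1 \<Omega>" for u
  proof -
    let ?g = "grad \<Omega> u"
    have g: "?g \<in> L2 L" by (rule grad_L2[OF u])
    have "l2_inner L (\<lambda>x. \<kappa> x *\<^sub>R ?g x) ?g \<le> l2_inner L (K *\<^sub>R ?g) ?g"
      unfolding l2_inner_def
    proof (rule integral_mono_AE)
      show "AE x in L. (\<kappa> x *\<^sub>R ?g x) \<bullet> ?g x \<le> (K *\<^sub>R ?g) x \<bullet> ?g x"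
        using K(1) by eventually_elim (auto intro!: mult_right_mono)
    qed (rule L2_integrable_inner[OF \<kappa>_mult_L2[OF g] g], rule L2_integrable_inner[OF G.mem(4)[OF g] g])
    also have "\<dots> = K * l2_inner L ?g ?g" using g by (simp add: G.scaleR_left)
    finally have "a u u \<le> l2_inner L u u + \<tau> * (K * l2_inner L ?g ?g)"
      using \<tau> by (simp add: A_op_def)
    also have "\<dots> \<le> (1 + \<tau> * K) * h1_inner \<Omega> u u"
      using \<tau> K(2) R.nonneg[OF H1_L2[OF u]] G.nonneg[OF g] by (simp add: h1_inner_def algebra_simps)
    finally show ?thesis .
  qed
  then show ?thesis using that by blast
qed

lemma A_coercive: "u \<in> V \<Longrightarrow> \<kappa>low * h1_inner \<Omega> u u \<le> a u u"
  using coercive[of u] V.nonneg[of u] by (simp add: h1_norm_def)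

text \<open>With the energy form as inner product, solving an equation with the elliptic operator is
  a Riesz representation.\<close>

sublocale A: semi_hilbert V a
proof -
  obtain K where K: "\<And>u. u \<in> H1 \<Omega> \<Longrightarrow> a u u \<le> K * h1_inner \<Omega> u u" using A_bounded by blast
  show "semi_hilbert V a"
  proof (rule V.equivalent_form[where a = a and k = \<kappa>low and K = K])
    fix u v w c assume *: "u \<in> V" "w \<in> V"
    show "a (c *\<^sub>R u) w = c * a u w"
      using A_scaleR_right[of u w c] * A_sym by (simp add: V_H1)
    assume "v \<in> V"
    then show "a (u + v) w = a u w + a v w"
      using A_add_right[of u v w] * A_sym by (simp add: V_H1)
  qed (use K A_sym V_H1 \<kappa>low A_coercive in auto)
qed

text \<open>Coercivity converts the bound in the H^1 norm into one in the energy norm, which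
  produces the factor 1 / sqrt \<kappa>low. The modulus of \<open>c\<close> is taken because
  \<open>c\<close> has no prescribed sign.\<close>

lemma state_exists:
  assumes lin: "linear_functional_on V l" and bdd: "\<And>\<phi>. \<phi> \<in> V \<Longrightarrow> \<bar>l \<phi>\<bar> \<le> c * sqrt (h1_inner \<Omega> \<phi> \<phi>)"
  obtains y where "y \<in> V" "\<And>\<phi>. \<phi> \<in> V \<Longrightarrow> a y \<phi> = l \<phi>"
proof (rule A.riesz[OF lin])
  fix \<phi> assume \<phi>: "\<phi> \<in> V"
  have "sqrt (h1_inner \<Omega> \<phi> \<phi>) \<le> sqrt (a \<phi> \<phi> / \<kappa>low)"
    using A_coercive[OF \<phi>] \<kappa>low by (intro real_sqrt_le_mono) (simp add: field_simps)
  then have "\<bar>c\<bar> * sqrt (h1_inner \<Omega> \<phi> \<phi>) \<le> \<bar>c\<bar> * (sqrt (a \<phi> \<phi>) / sqrt \<kappa>low)"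
    by (intro mult_left_mono) (auto simp: real_sqrt_divide)
  moreover have "c * sqrt (h1_inner \<Omega> \<phi> \<phi>) \<le> \<bar>c\<bar> * sqrt (h1_inner \<Omega> \<phi> \<phi>)"
    by (intro mult_right_mono) (simp_all add: V.nonneg[OF \<phi>])
  ultimately show "\<bar>l \<phi>\<bar> \<le> \<bar>c\<bar> / sqrt \<kappa>low * sqrt (a \<phi> \<phi>)" using bdd[OF \<phi>] by simp
qed (rule that)

lemma l2_functional:
  assumes f: "f \<in> L2 L"
  shows "linear_functional_on V (l2_inner L f)"
    "\<phi> \<in> V \<Longrightarrow> \<bar>l2_inner L f \<phi>\<bar> \<le> sqrt (l2_inner L f f) * sqrt (h1_inner \<Omega> \<phi> \<phi>)"
proof -
  show "linear_functional_on V (l2_inner L f)"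
    using f by (auto simp: linear_functional_on_def R.ip_simps V_L2)
  assume \<phi>: "\<phi> \<in> V"
  have "\<bar>l2_inner L f \<phi>\<bar> \<le> sqrt (l2_inner L f f) * sqrt (l2_inner L \<phi> \<phi>)"
    by (rule R.Cauchy_Schwarz[OF f V_L2[OF \<phi>]])
  also have "\<dots> \<le> sqrt (l2_inner L f f) * sqrt (h1_inner \<Omega> \<phi> \<phi>)"
    using l2_le_h1[OF V_H1[OF \<phi>]] R.nonneg[OF f] by (intro mult_left_mono) auto
  finally show "\<bar>l2_inner L f \<phi>\<bar> \<le> sqrt (l2_inner L f f) * sqrt (h1_inner \<Omega> \<phi> \<phi>)" .
qed

lemma B_functional:
  assumes v: "v \<in> L2 LC"
  shows "linear_functional_on V (b v)"
    "\<exists>c. \<forall>\<phi>\<in>V. \<bar>b v \<phi>\<bar> \<le> c * sqrt (h1_inner \<Omega> \<phi> \<phi>)"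
proof -
  have "b v (x + y) = b v x + b v y" if "x \<in> V" "y \<in> V" for x y
    using l2_trace_linear[OF \<Gamma>C, of x y v 1 1] that v by (simp add: V_H1 B_op_def distrib_left)
  moreover have "b v (c *\<^sub>R x) = c * b v x" if "x \<in> V" for c x
    using l2_trace_linear[OF \<Gamma>C, of x x v c 0] that v by (simp add: V_H1 B_op_def)
  ultimately show "linear_functional_on V (b v)" by (simp add: linear_functional_on_def)
  obtain K where K: "\<And>u. u \<in> H1 \<Omega> \<Longrightarrow> l2_inner LC (\<gamma>0 u) (\<gamma>0 u) \<le> K * h1_inner \<Omega> u u"
    using trace_bounded[OF \<Gamma>C] by blast
  have "\<bar>b v \<phi>\<bar> \<le> (\<tau> * sqrt (l2_inner LC v v) * sqrt K) * sqrt (h1_inner \<Omega> \<phi> \<phi>)" if \<phi>: "\<phi> \<in> V" for \<phi>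
  proof -
    have "\<bar>l2_inner LC v (\<gamma>0 \<phi>)\<bar> \<le> sqrt (l2_inner LC v v) * sqrt (l2_inner LC (\<gamma>0 \<phi>) (\<gamma>0 \<phi>))"
      by (rule C.Cauchy_Schwarz[OF v trace_L2[OF \<Gamma>C V_H1[OF \<phi>]]])
    also have "\<dots> \<le> sqrt (l2_inner LC v v) * sqrt (K * h1_inner \<Omega> \<phi> \<phi>)"
      using K[OF V_H1[OF \<phi>]] C.nonneg[OF v] by (intro mult_left_mono) auto
    finally have "\<tau> * \<bar>l2_inner LC v (\<gamma>0 \<phi>)\<bar> \<le> \<tau> * (sqrt (l2_inner LC v v) * sqrt (K * h1_inner \<Omega> \<phi> \<phi>))"
      using \<tau> by (intro mult_left_mono) auto
    then show ?thesis using \<tau> by (simp add: B_op_def abs_mult real_sqrt_mult mult_ac)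
  qed
  then show "\<exists>c. \<forall>\<phi>\<in>V. \<bar>b v \<phi>\<bar> \<le> c * sqrt (h1_inner \<Omega> \<phi> \<phi>)" by blast
qed

text \<open>With f = \<eta> + ybar - \<xi>bar this attaches a state to arbitrary \<eta> and v, so
  that the final inequality can be tested with the two independently.\<close>

lemma state_for_data:
  assumes v: "v \<in> L2 LC" and f: "f \<in> L2 L"
  obtains y where "y \<in> V" "\<And>\<phi>. \<phi> \<in> V \<Longrightarrow> a y \<phi> = b v \<phi> + l2_inner L f \<phi>"
proof -
  obtain c where c: "\<And>\<phi>. \<phi> \<in> V \<Longrightarrow> \<bar>b v \<phi>\<bar> \<le> c * sqrt (h1_inner \<Omega> \<phi> \<phi>)" using B_functional(2)[OF v] by blast
  show ?thesis
  proof (rule state_exists)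
    show "linear_functional_on V (\<lambda>\<phi>. b v \<phi> + l2_inner L f \<phi>)"
      by (intro linear_functional_on_add B_functional(1)[OF v] l2_functional(1)[OF f])
    show "\<bar>b v \<phi> + l2_inner L f \<phi>\<bar> \<le> (c + sqrt (l2_inner L f f)) * sqrt (h1_inner \<Omega> \<phi> \<phi>)" if "\<phi> \<in> V" for \<phi>
      using c[OF that] l2_functional(2)[OF f that] by (simp add: distrib_right)
  qed (rule that)
qed

text \<open>The constraint qualification. The pair \<open>z, r\<close> minimises
  \<open>\<epsilon> a(z, z) / 2 + \<parallel>r - g\<parallel>\<^sup>2 / 2\<close> subject to \<open>z - r \<ge> 0\<close>, and \<open>h = (g - r) / \<epsilon>\<close> is the multiplier of
  that constraint. Its sign is thus obtained without a maximum principle for \<open>a\<close>.\<close>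

lemma complementarity:
  assumes \<epsilon>: "\<epsilon> > 0" and g: "g \<in> L2 L"
  obtains z h where "z \<in> V" "h \<in> L2 L" "AE x in L. 0 \<le> h x" "\<And>\<phi>. \<phi> \<in> V \<Longrightarrow> a z \<phi> = l2_inner L h \<phi>"
    "AE x in L. g x \<le> z x + \<epsilon> * h x" "\<epsilon> * l2_inner L h h + a z z \<le> l2_inner L h g"
proof -
  \<comment> \<open>The weight \<epsilon> on the energy matches the factor 1 / \<epsilon> in
    \<open>h\<close>: it cancels in the optimality condition and leaves an equation for z with
    right-hand side \<open>h\<close>.\<close>
  have E: "semi_hilbert V (\<lambda>u v. \<epsilon> * a u v)"
    by (rule A.equivalent_form[where k = \<epsilon> and K = \<epsilon>]) (use \<epsilon> A_sym in \<open>auto simp: A.ip_simps algebra_simps\<close>)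
  interpret P: semi_hilbert "V \<times> (L2 L :: ('a \<Rightarrow> real) set)" "\<lambda>p q. \<epsilon> * a (fst p) (fst q) + l2_inner L (snd p) (snd q)"
    by (rule semi_hilbert_Times[OF E R.semi_hilbert_axioms])
  let ?n = "\<lambda>p. \<epsilon> * a (fst p) (fst p) + l2_inner L (snd p) (snd p)"
  let ?l = "\<lambda>p :: ('a \<Rightarrow> real) \<times> ('a \<Rightarrow> real). l2_inner L g (snd p)"
  define K where "K = {p \<in> V \<times> L2 L. AE x in L. 0 \<le> fst p x - snd p x}"
  have K1: "K \<subseteq> V \<times> L2 L" by (auto simp: K_def)
  have K2: "convex K"
  proof (rule convexI)
    fix p q :: "('a \<Rightarrow> real) \<times> ('a \<Rightarrow> real)" and s t :: real
    assume p: "p \<in> K" and q: "q \<in> K" and st: "0 \<le> s" "0 \<le> t"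
    have "AE x in L. 0 \<le> fst p x - snd p x" "AE x in L. 0 \<le> fst q x - snd q x" using p q by (auto simp: K_def)
    then have "AE x in L. 0 \<le> fst (s *\<^sub>R p + t *\<^sub>R q) x - snd (s *\<^sub>R p + t *\<^sub>R q) x"
    proof eventually_elim
      fix x assume "0 \<le> fst p x - snd p x" "0 \<le> fst q x - snd q x"
      then have "0 \<le> s * (fst p x - snd p x) + t * (fst q x - snd q x)" using st by simp
      then show "0 \<le> fst (s *\<^sub>R p + t *\<^sub>R q) x - snd (s *\<^sub>R p + t *\<^sub>R q) x" by (simp add: algebra_simps)
    qed
    then show "s *\<^sub>R p + t *\<^sub>R q \<in> K" using p q K1 by (auto simp: K_def)
  qed
  have K3: "K \<noteq> {}" using P.mem(1) by (auto simp: K_def intro!: exI[of _ 0])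
  have lin: "linear_functional_on (V \<times> L2 L) ?l"
    using g by (auto simp: linear_functional_on_def R.ip_simps)
  have bdd: "\<bar>?l p\<bar> \<le> sqrt (l2_inner L g g) * sqrt (?n p)" if "p \<in> V \<times> L2 L" for p
  proof -
    have p: "fst p \<in> V" "snd p \<in> L2 L" using that by (auto simp: mem_Times_iff)
    have "\<bar>?l p\<bar> \<le> sqrt (l2_inner L g g) * sqrt (l2_inner L (snd p) (snd p))"
      by (rule R.Cauchy_Schwarz[OF g p(2)])
    also have "\<dots> \<le> sqrt (l2_inner L g g) * sqrt (?n p)"
      using A.nonneg[OF p(1)] \<epsilon> R.nonneg[OF g] by (intro mult_left_mono) auto
    finally show ?thesis .
  qed
  obtain p where p: "p \<in> V \<times> L2 L"
    and vi: "\<forall>q\<in>K. ?l (q - p) \<le> \<epsilon> * a (fst p) (fst (q - p)) + l2_inner L (snd p) (snd (q - p))"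
    and "\<exists>Z. (\<forall>n::nat. Z n \<in> K) \<and> (\<lambda>n. ?n (Z n - p)) \<longlonglongrightarrow> 0"
    using P.variational_inequality[OF K1 K2 K3 lin bdd] by blast
  then obtain Z where Z: "\<And>n::nat. Z n \<in> K" and lim: "(\<lambda>n. ?n (Z n - p)) \<longlonglongrightarrow> 0"
    by blast
  define z where "z = fst p"
  define r where "r = snd p"
  have z: "z \<in> V" "z \<in> L2 L" and r: "r \<in> L2 L" using p V_L2 by (auto simp: z_def r_def)
  \<comment> \<open>Since r = g - \<epsilon> h, the constraint z - r \<ge> 0 is exactly z +
    \<epsilon> h \<ge> g.\<close>
  define h where "h = (1 / \<epsilon>) *\<^sub>R (g - r)"
  have h: "h \<in> L2 L" using g r by (simp add: h_def)
  have hx: "h x = (g x - r x) / \<epsilon>" for x by (simp add: h_def)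
  have lh: "\<epsilon> * l2_inner L h w = l2_inner L g w - l2_inner L r w" if "w \<in> L2 L" for w
    using that g r \<epsilon> by (simp add: h_def R.ip_simps)
  have vi': "\<epsilon> * l2_inner L h (\<rho> - r) \<le> \<epsilon> * a z (\<phi> - z)"
    if "\<phi> \<in> V" "\<rho> \<in> L2 L" "AE x in L. 0 \<le> \<phi> x - \<rho> x" for \<phi> \<rho>
    using vi[rule_format, of "(\<phi>, \<rho>)"] that r lh[of "\<rho> - r"] by (simp add: K_def z_def[symmetric] r_def[symmetric])
  have Zm: "fst (Z n) \<in> V" "snd (Z n) \<in> L2 L" "AE x in L. 0 \<le> fst (Z n) x - snd (Z n) x" for n
    using Z[of n] by (auto simp: K_def)
  \<comment> \<open>The minimiser is known only as a limit of members of \<open>K\<close>; the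
    constraint survives because convergence in the product norm implies L^2 convergence of the
    differences.\<close>
  have nonneg: "AE x in L. 0 \<le> (z - r) x"
  proof (rule L2_nonneg_closed[OF finite_measure_lebesgue_on[OF open_dom bounded_dom]])
    show "z - r \<in> L2 L" using z r by simp
    show Zd: "fst (Z n) - snd (Z n) \<in> L2 L" for n using Zm V_L2 by simp
    show "AE x in L. 0 \<le> (fst (Z n) - snd (Z n)) x" for n using Zm by simp
    show "(\<lambda>n. l2_inner L (fst (Z n) - snd (Z n) - (z - r)) (fst (Z n) - snd (Z n) - (z - r))) \<longlonglongrightarrow> 0"
    proof (rule Lim_null_comparison)
      \<comment> \<open>The constant comes from (u - v, u - v) \<le> 2 (u, u) + 2 (v, v), where
        coercivity gives (u, u) \<le> a(u, u) / \<kappa>low and the product norm contains \<epsilon>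
        a(u, u).\<close>
      show "(\<lambda>n. (2 / (\<epsilon> * \<kappa>low) + 2) * ?n (Z n - p)) \<longlonglongrightarrow> 0"
        using tendsto_mult_left[OF lim, of "2 / (\<epsilon> * \<kappa>low) + 2"] by simp
      have "norm (l2_inner L (fst (Z n) - snd (Z n) - (z - r)) (fst (Z n) - snd (Z n) - (z - r))) \<le>
         (2 / (\<epsilon> * \<kappa>low) + 2) * ?n (Z n - p)" for n
      proof -
        define u where "u = fst (Z n) - z"
        define v where "v = snd (Z n) - r"
        have u: "u \<in> V" "u \<in> L2 L" and v: "v \<in> L2 L" using Zm z r V_L2 by (auto simp: u_def v_def)
        have e: "fst (Z n) - snd (Z n) - (z - r) = u - v" by (simp add: u_def v_def)
        have "0 \<le> l2_inner L (u + v) (u + v)" using u v by (intro R.nonneg) simp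
        then have 1: "l2_inner L (u - v) (u - v) \<le> 2 * l2_inner L u u + 2 * l2_inner L v v"
          using u v R.sym[OF u(2) v] by (simp add: R.ip_simps)
        have "l2_inner L u u \<le> h1_inner \<Omega> u u" by (rule l2_le_h1[OF V_H1[OF u(1)]])
        also have "\<dots> \<le> a u u / \<kappa>low" using A_coercive[OF u(1)] \<kappa>low by (simp add: field_simps)
        finally have 2: "2 * l2_inner L u u \<le> 2 / (\<epsilon> * \<kappa>low) * (\<epsilon> * a u u)" using \<epsilon> by simp
        have 3: "0 \<le> 2 / (\<epsilon> * \<kappa>low) * l2_inner L v v" "0 \<le> 2 * (\<epsilon> * a u u)"
          using \<epsilon> \<kappa>low R.nonneg[OF v] A.nonneg[OF u(1)] by simp_all
        have "l2_inner L (u - v) (u - v) \<le> (2 / (\<epsilon> * \<kappa>low) + 2) * (\<epsilon> * a u u + l2_inner L v v)"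
          using 1 2 3 by (simp only: distrib_left distrib_right)
        then show ?thesis unfolding e using R.nonneg[of "u - v"] u v by (simp add: u_def v_def z_def r_def)
      qed
      then show "\<forall>\<^sub>F n in sequentially. norm (l2_inner L (fst (Z n) - snd (Z n) - (z - r)) (fst (Z n) - snd (Z n) - (z - r))) \<le>
         (2 / (\<epsilon> * \<kappa>low) + 2) * ?n (Z n - p)" by simp
    qed
  qed
  have le: "l2_inner L h \<psi> \<le> a z \<psi>" if \<psi>: "\<psi> \<in> V" for \<psi>
  proof -
    \<comment> \<open>Moving z and r by the same \<psi> leaves z - r unchanged, so \<psi> may carry
      either sign and the inequality becomes the equation for z.\<close>
    have "AE x in L. 0 \<le> (z + \<psi>) x - (r + \<psi>) x" using nonneg by eventually_elim simp
    then show ?thesis using vi'[of "z + \<psi>" "r + \<psi>"] z r \<psi> V_L2 \<epsilon> by simp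
  qed
  have eq: "a z \<psi> = l2_inner L h \<psi>" if \<psi>: "\<psi> \<in> V" for \<psi>
    using le[OF \<psi>] le[OF V.mem(4)[OF \<psi>], of "-1"] A.scaleR_right[OF \<psi> z(1), of "-1"]
      R.scaleR_right[OF V_L2[OF \<psi>] h, of "-1"] by simp
  have hpos: "AE x in L. 0 \<le> h x"
  proof (rule L2_nonneg_dual[OF finite_measure_lebesgue_on[OF open_dom bounded_dom] h])
    fix \<sigma> :: "'a \<Rightarrow> real" assume \<sigma>: "\<sigma> \<in> L2 L" "AE x in L. 0 \<le> \<sigma> x"
    \<comment> \<open>Lowering r by \<sigma> \<ge> 0 at fixed z stays admissible and yields the sign
      of \<open>h\<close>.\<close>
    have "AE x in L. 0 \<le> z x - (r - \<sigma>) x" using nonneg \<sigma>(2) by eventually_elim simp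
    then have "\<epsilon> * l2_inner L h (r - \<sigma> - r) \<le> \<epsilon> * a z (z - z)"
      using z r \<sigma> by (intro vi') auto
    moreover have "r - \<sigma> - r = 0 - \<sigma>" by simp
    ultimately have "\<epsilon> * l2_inner L h (0 - \<sigma>) \<le> 0" using z by (simp only: ) (simp add: A.ip_zero)
    then show "0 \<le> l2_inner L h \<sigma>" using h \<sigma> \<epsilon> R.diff_right[of 0 \<sigma> h]
      by (simp add: R.ip_zero mult_le_0_iff zero_le_mult_iff)
  qed
  show ?thesis
  proof (rule that[OF z(1) h hpos eq])
    show "AE x in L. g x \<le> z x + \<epsilon> * h x"
      using nonneg by eventually_elim (use \<epsilon> in \<open>simp add: hx\<close>)
    \<comment> \<open>Testing with the pair (z, z) gives (h, z) \<le> (h, r). Together with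
      \<epsilon> (h, h) = (h, g) - (h, r) and a(z, z) = (h, z) this is the energy estimate.\<close>
    have "\<epsilon> * l2_inner L h (z - r) \<le> \<epsilon> * a z (z - z)"
      using z by (intro vi') auto
    then have "\<epsilon> * l2_inner L h (z - r) \<le> 0" using z by (simp add: A.ip_zero)
    then have "l2_inner L h z \<le> l2_inner L h r" using \<epsilon> z r h by (simp add: R.ip_simps mult_le_0_iff)
    then show "\<epsilon> * l2_inner L h h + a z z \<le> l2_inner L h g"
      using lh[OF h] eq[OF z(1)] R.sym[OF g h] R.sym[OF r h] by simp
  qed
qed

end

subsection \<open>Optimality conditions\<close>

lemma nonneg_if_quadratic_nonneg:
  fixes c d :: real
  assumes "\<And>t. 0 < t \<Longrightarrow> t \<le> 1 \<Longrightarrow> 0 \<le> t * c + t\<^sup>2 * d"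
  shows "0 \<le> c"
proof (rule tendsto_lowerbound)
  have "((\<lambda>t. c + t * d) \<longlongrightarrow> c + 0 * d) (at_right 0)" by (intro tendsto_intros)
  then show "((\<lambda>t. c + t * d) \<longlongrightarrow> c) (at_right 0)" by simp
  have "0 \<le> c + t * d" if "0 < t" "t \<le> 1" for t
  proof -
    have "0 \<le> t * (c + t * d)" using assms[OF that] by (simp add: power2_eq_square algebra_simps)
    then show ?thesis using that by (simp add: zero_le_mult_iff)
  qed
  then show "\<forall>\<^sub>F t in at_right 0. 0 \<le> c + t * d"
    by (auto simp: eventually_at_right_field intro!: exI[of _ 1])
qed simp_all

lemma AE_convex_nonneg:
  fixes f g :: "'b \<Rightarrow> real"
  assumes "AE x in M. 0 \<le> f x" "AE x in M. 0 \<le> g x" "0 \<le> s" "0 \<le> t"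
  shows "AE x in M. 0 \<le> (s *\<^sub>R f + t *\<^sub>R g) x"
  using assms(1,2) by eventually_elim (use assms(3,4) in simp)

locale optimal_control = state_problem \<Omega> \<gamma>0 \<Gamma>D \<Gamma>C \<tau> \<kappa>low \<kappa>
  for \<Omega> :: "'a::euclidean_space set" and \<gamma>0 \<Gamma>D \<Gamma>C \<tau> \<kappa>low \<kappa> +
  fixes ybar \<xi>bar yd \<xi>d y \<xi> u :: "'a \<Rightarrow> real" and \<nu> \<gamma> \<epsilon> :: real
  assumes yd: "yd \<in> H1 \<Omega>" and \<xi>d: "\<xi>d \<in> L2 (lebesgue_on \<Omega>)" and \<epsilon>: "\<epsilon> > 0"
    and sol: "solution \<Omega> \<Gamma>D \<Gamma>C \<gamma>0 \<tau> \<kappa> ybar \<xi>bar yd \<xi>d \<nu> \<gamma> \<epsilon> y \<xi> u"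
begin

abbreviation "feas \<equiv> feasible \<Omega> \<Gamma>D \<Gamma>C \<gamma>0 \<tau> \<kappa> ybar \<xi>bar \<epsilon>"
abbreviation "J \<equiv> cost \<Omega> \<Gamma>C yd \<xi>d \<nu> \<gamma> \<epsilon>"
abbreviation "state y' \<eta> v \<equiv> state_equation \<Omega> \<Gamma>D \<Gamma>C \<gamma>0 \<tau> \<kappa> ybar \<xi>bar y' \<eta> v"

section \<open>First order condition along feasible directions\<close>

lemma feas_sol: "feas y \<xi> u"
  using sol by (simp add: solution_def)

lemma sol_mem: "y \<in> V" "y \<in> H1 \<Omega>" "y \<in> L2 L" "\<xi> \<in> L2 L" "u \<in> L2 LC"
  using feas_sol V_H1 V_L2 by (auto simp: feasible_def)

text \<open>\<open>q\<close> is the partial gradient of the cost in \<open>\<xi>\<close> at the solution, and \<open>dJ\<close> its total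
  derivative there.\<close>

definition q :: "'a \<Rightarrow> real" where
  "q = \<xi> - \<xi>d + (\<gamma> *\<^sub>R y + (2 * \<gamma> * \<epsilon>) *\<^sub>R \<xi>)"

definition dJ :: "('a \<Rightarrow> real) \<Rightarrow> ('a \<Rightarrow> real) \<Rightarrow> ('a \<Rightarrow> real) \<Rightarrow> real" where
  "dJ z h k = h1_inner \<Omega> (y - yd) z + \<gamma> * l2_inner L \<xi> z + l2_inner L q h + \<nu> * l2_inner LC u k"

lemma q_L2: "q \<in> L2 L"
  using sol_mem \<xi>d by (simp add: q_def)

lemma w_H1: "y - yd \<in> H1 \<Omega>"
  using sol_mem yd by simp

lemma dJ_linear:
  assumes "z \<in> V" "h \<in> L2 L" "k \<in> L2 LC" "z' \<in> V" "h' \<in> L2 L" "k' \<in> L2 LC"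
  shows "dJ (s *\<^sub>R z + t *\<^sub>R z') (s *\<^sub>R h + t *\<^sub>R h') (s *\<^sub>R k + t *\<^sub>R k') = s * dJ z h k + t * dJ z' h' k'"
    "dJ (z + z') (h + h') (k + k') = dJ z h k + dJ z' h' k'"
    "dJ (z - z') (h - h') (k - k') = dJ z h k - dJ z' h' k'"
  using assms V_H1 V_L2 w_H1 q_L2 sol_mem
  by (simp_all add: dJ_def H.ip_simps R.ip_simps C.ip_simps algebra_simps)

text \<open>The cost is quadratic, so the expansion is exact. The coefficient of the square of t has
  no definite sign in general, owing to the bilinear term; it only has to be independent of
  t.\<close>

lemma cost_expansion:
  assumes "z \<in> V" "h \<in> L2 L" "k \<in> L2 LC"
  shows "J (y + t *\<^sub>R z) (\<xi> + t *\<^sub>R h) (u + t *\<^sub>R k) = J y \<xi> u + t * dJ z h k +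
    t\<^sup>2 * (h1_inner \<Omega> z z / 2 + l2_inner L h h / 2 + \<nu> / 2 * l2_inner LC k k + \<gamma> * l2_inner L h (z + \<epsilon> *\<^sub>R h))"
proof -
  have J: "J y' \<eta> v = 1 / 2 * h1_inner \<Omega> (y' - yd) (y' - yd) + 1 / 2 * l2_inner L (\<eta> - \<xi>d) (\<eta> - \<xi>d) +
      \<nu> / 2 * l2_inner LC v v + \<gamma> * l2_inner L \<eta> (y' + \<epsilon> *\<^sub>R \<eta>)"
    if "y' \<in> V" "\<eta> \<in> L2 L" "v \<in> L2 LC" for y' \<eta> v
  proof -
    have e: "(\<lambda>x. y' x - yd x) = y' - yd" "(\<lambda>x. \<eta> x - \<xi>d x) = \<eta> - \<xi>d" "(\<lambda>x. y' x + \<epsilon> * \<eta> x) = y' + \<epsilon> *\<^sub>R \<eta>"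
      by (simp_all add: fun_eq_iff)
    show ?thesis unfolding cost_def e h1_norm_def l2_norm_def
      using that yd \<xi>d V_H1 H.nonneg[of "y' - yd"] R.nonneg[of "\<eta> - \<xi>d"] C.nonneg[of v] by simp
  qed
  have s: "y + t *\<^sub>R z - yd = (y - yd) + t *\<^sub>R z" "\<xi> + t *\<^sub>R h - \<xi>d = (\<xi> - \<xi>d) + t *\<^sub>R h"
    by simp_all
  have sym: "l2_inner L h y = l2_inner L y h" "l2_inner L h \<xi> = l2_inner L \<xi> h"
    using assms sol_mem by (simp_all add: R.sym)
  have m: "z \<in> H1 \<Omega>" "z \<in> L2 L" using assms V_H1 V_L2 by auto
  have ry: "\<xi> - \<xi>d \<in> L2 L" using sol_mem \<xi>d by simp
  have 1: "h1_inner \<Omega> (y + t *\<^sub>R z - yd) (y + t *\<^sub>R z - yd) = h1_inner \<Omega> (y - yd) (y - yd)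
      + 2 * t * h1_inner \<Omega> (y - yd) z + t\<^sup>2 * h1_inner \<Omega> z z"
    unfolding s by (rule H.add_scaleR_square[OF w_H1 m(1)])
  have 2: "l2_inner L (\<xi> + t *\<^sub>R h - \<xi>d) (\<xi> + t *\<^sub>R h - \<xi>d) = l2_inner L (\<xi> - \<xi>d) (\<xi> - \<xi>d)
      + 2 * t * l2_inner L (\<xi> - \<xi>d) h + t\<^sup>2 * l2_inner L h h"
    unfolding s by (rule R.add_scaleR_square[OF ry assms(2)])
  have 3: "l2_inner LC (u + t *\<^sub>R k) (u + t *\<^sub>R k) = l2_inner LC u u
      + 2 * t * l2_inner LC u k + t\<^sup>2 * l2_inner LC k k"
    by (rule C.add_scaleR_square[OF sol_mem(5) assms(3)])
  have 4: "l2_inner L (\<xi> + t *\<^sub>R h) (y + t *\<^sub>R z + \<epsilon> *\<^sub>R (\<xi> + t *\<^sub>R h)) = l2_inner L \<xi> (y + \<epsilon> *\<^sub>R \<xi>)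
      + t * (l2_inner L \<xi> z + l2_inner L y h + 2 * \<epsilon> * l2_inner L \<xi> h) + t\<^sup>2 * l2_inner L h (z + \<epsilon> *\<^sub>R h)"
    using assms sol_mem m by (simp add: R.ip_simps sym power2_eq_square algebra_simps)
  have 5: "l2_inner L q h = l2_inner L (\<xi> - \<xi>d) h + \<gamma> * l2_inner L y h + 2 * \<gamma> * \<epsilon> * l2_inner L \<xi> h"
    using assms sol_mem ry by (simp add: q_def R.add_left R.scaleR_left)
  have mem: "y + t *\<^sub>R z \<in> V" "\<xi> + t *\<^sub>R h \<in> L2 L" "u + t *\<^sub>R k \<in> L2 LC"
    using assms sol_mem by simp_all
  show ?thesis unfolding J[OF mem] J[OF sol_mem(1,4,5)] 1 2 3 4 dJ_def 5
    by (simp add: algebra_simps)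
qed

lemma state_equation_iff:
  "state y' \<eta> v \<longleftrightarrow> (\<forall>\<phi>\<in>V. a y' \<phi> = b v \<phi> + l2_inner L \<eta> \<phi> + l2_inner L ybar \<phi> - l2_inner L \<xi>bar \<phi>)"
  by (simp add: state_equation_def)

lemma b_add: "\<lbrakk>v \<in> L2 LC; v' \<in> L2 LC; \<phi> \<in> V\<rbrakk> \<Longrightarrow> b (v + v') \<phi> = b v \<phi> + b v' \<phi>"
  using trace_L2[OF \<Gamma>C V_H1] by (simp add: B_op_def C.add_left distrib_left)

lemma b_scaleR: "\<lbrakk>v \<in> L2 LC; \<phi> \<in> V\<rbrakk> \<Longrightarrow> b (c *\<^sub>R v) \<phi> = c * b v \<phi>"
  using trace_L2[OF \<Gamma>C V_H1] by (simp add: B_op_def C.scaleR_left)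

lemma state_convex:
  assumes "y1 \<in> V" "\<eta>1 \<in> L2 L" "v1 \<in> L2 LC" "y2 \<in> V" "\<eta>2 \<in> L2 L" "v2 \<in> L2 LC"
    and st: "state y1 \<eta>1 v1" "state y2 \<eta>2 v2" and "s + t = 1"
  shows "state (s *\<^sub>R y1 + t *\<^sub>R y2) (s *\<^sub>R \<eta>1 + t *\<^sub>R \<eta>2) (s *\<^sub>R v1 + t *\<^sub>R v2)"
  unfolding state_equation_iff
proof
  fix \<phi> assume \<phi>: "\<phi> \<in> V"
  have s: "s = 1 - t" using assms(9) by simp
  have e: "a y1 \<phi> = b v1 \<phi> + l2_inner L \<eta>1 \<phi> + l2_inner L ybar \<phi> - l2_inner L \<xi>bar \<phi>"
    "a y2 \<phi> = b v2 \<phi> + l2_inner L \<eta>2 \<phi> + l2_inner L ybar \<phi> - l2_inner L \<xi>bar \<phi>"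
    using st \<phi> unfolding state_equation_iff by blast+
  have "a (s *\<^sub>R y1 + t *\<^sub>R y2) \<phi> = s * a y1 \<phi> + t * a y2 \<phi>"
    using assms \<phi> by (simp add: A.add_left A.scaleR_left)
  moreover have "b (s *\<^sub>R v1 + t *\<^sub>R v2) \<phi> = s * b v1 \<phi> + t * b v2 \<phi>"
    using assms \<phi> by (simp add: b_add b_scaleR)
  moreover have "l2_inner L (s *\<^sub>R \<eta>1 + t *\<^sub>R \<eta>2) \<phi> = s * l2_inner L \<eta>1 \<phi> + t * l2_inner L \<eta>2 \<phi>"
    using assms \<phi> V_L2 by (simp add: R.add_left R.scaleR_left)
  ultimately show "a (s *\<^sub>R y1 + t *\<^sub>R y2) \<phi> = b (s *\<^sub>R v1 + t *\<^sub>R v2) \<phi> + l2_inner L (s *\<^sub>R \<eta>1 + t *\<^sub>R \<eta>2) \<phi>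
      + l2_inner L ybar \<phi> - l2_inner L \<xi>bar \<phi>"
    unfolding e s by (simp add: algebra_simps)
qed

text \<open>Linearity of \<open>dJ\<close> turns the sign of a directional derivative into a
  comparison of two values. In \<open>multiplier_exists\<close> the right-hand value then splits
  into that of an infeasible triple and that of its repair.\<close>

lemma first_order:
  assumes f: "feas y' \<eta> v"
  shows "dJ y \<xi> u \<le> dJ y' \<eta> v"
proof -
  have m: "y' \<in> V" "\<eta> \<in> L2 L" "v \<in> L2 LC" using f by (auto simp: feasible_def)
  have "0 \<le> dJ (y' - y) (\<eta> - \<xi>) (v - u)"
  proof (rule nonneg_if_quadratic_nonneg)
    fix t :: real assume t: "0 < t" "t \<le> 1"
    have c: "f + t *\<^sub>R (g - f) = (1 - t) *\<^sub>R f + t *\<^sub>R g" for f g :: "'a \<Rightarrow> real"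
      by (simp add: algebra_simps)
    have st: "0 \<le> 1 - t" "0 \<le> t" "(1 - t) + t = 1" using t by auto
    have "AE x in L. 0 \<le> ((1 - t) *\<^sub>R (\<lambda>x. y x + \<epsilon> * \<xi> x) + t *\<^sub>R (\<lambda>x. y' x + \<epsilon> * \<eta> x)) x"
      by (rule AE_convex_nonneg) (use f feas_sol st in \<open>auto simp: feasible_def\<close>)
    then have w: "AE x in L. 0 \<le> ((1 - t) *\<^sub>R y + t *\<^sub>R y') x + \<epsilon> * ((1 - t) *\<^sub>R \<xi> + t *\<^sub>R \<eta>) x"
      by eventually_elim (simp add: algebra_simps)
    have "feas (y + t *\<^sub>R (y' - y)) (\<xi> + t *\<^sub>R (\<eta> - \<xi>)) (u + t *\<^sub>R (v - u))"
      unfolding c feasible_def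
      using m sol_mem w f feas_sol st
      by (intro conjI state_convex AE_convex_nonneg) (simp_all add: feasible_def del: plus_fun_apply scaleR_fun_apply)
    then have "J y \<xi> u \<le> J (y + t *\<^sub>R (y' - y)) (\<xi> + t *\<^sub>R (\<eta> - \<xi>)) (u + t *\<^sub>R (v - u))"
      using sol by (simp add: solution_def)
    then show "0 \<le> t * dJ (y' - y) (\<eta> - \<xi>) (v - u) + t\<^sup>2 * (h1_inner \<Omega> (y' - y) (y' - y) / 2
       + l2_inner L (\<eta> - \<xi>) (\<eta> - \<xi>) / 2 + \<nu> / 2 * l2_inner LC (v - u) (v - u)
       + \<gamma> * l2_inner L (\<eta> - \<xi>) (y' - y + \<epsilon> *\<^sub>R (\<eta> - \<xi>)))"
      using cost_expansion[of "y' - y" "\<eta> - \<xi>" "v - u" t] m sol_mem by simp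
  qed
  then show ?thesis using dJ_linear(3) m sol_mem by simp
qed

text \<open>Linear control of the cost of a repair. The energy estimate bounds the norm of h by that
  of g divided by \<epsilon>, and the H^1 norm of z by that of g divided by sqrt (\<kappa>low *
  \<epsilon>); \<open>Mh\<close> and \<open>Mz\<close> bound the derivative in these two directions.
  The control direction is 0 because a repair leaves the control alone.\<close>

lemma dJ_bound:
  obtains M where "\<And>g z h. \<lbrakk>z \<in> V; h \<in> L2 L; g \<in> L2 L; \<epsilon> * l2_inner L h h + a z z \<le> l2_inner L h g\<rbrakk>
      \<Longrightarrow> dJ z h 0 \<le> M * sqrt (l2_inner L g g)"
proof -
  define Mz where "Mz = sqrt (h1_inner \<Omega> (y - yd) (y - yd)) + \<bar>\<gamma>\<bar> * sqrt (l2_inner L \<xi> \<xi>)"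
  define Mh where "Mh = sqrt (l2_inner L q q)"
  have Mz: "0 \<le> Mz" using H.nonneg[OF w_H1] R.nonneg[OF sol_mem(4)] by (simp add: Mz_def)
  have Mh: "0 \<le> Mh" using R.nonneg[OF q_L2] by (simp add: Mh_def)
  have "dJ z h 0 \<le> (Mz / sqrt (\<kappa>low * \<epsilon>) + Mh / \<epsilon>) * sqrt (l2_inner L g g)"
    if z: "z \<in> V" and h: "h \<in> L2 L" and g: "g \<in> L2 L" and le: "\<epsilon> * l2_inner L h h + a z z \<le> l2_inner L h g" for g z h
  proof -
    let ?h = "sqrt (l2_inner L h h)" and ?g = "sqrt (l2_inner L g g)" and ?z = "sqrt (h1_inner \<Omega> z z)"
    have hh: "l2_inner L h h = ?h * ?h" using R.nonneg[OF h] by simp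
    have gg: "l2_inner L g g = ?g * ?g" using R.nonneg[OF g] by simp
    have h0: "0 \<le> ?h" "0 \<le> ?g" using R.nonneg h g by auto
    have cs: "l2_inner L h g \<le> ?h * ?g" using R.Cauchy_Schwarz[OF h g] by simp
    have hg: "?h \<le> ?g / \<epsilon>"
    proof (cases "?h = 0")
      case False
      have "\<epsilon> * ?h * ?h \<le> ?g * ?h" using le cs A.nonneg[OF z] hh by (simp add: mult_ac)
      then have "\<epsilon> * ?h \<le> ?g" using False h0 by (simp add: mult_le_cancel_right)
      then show ?thesis using \<epsilon> by (simp add: field_simps)
    qed (use h0 \<epsilon> in simp)
    have "\<kappa>low * h1_inner \<Omega> z z \<le> ?h * ?g"
      using A_coercive[OF z] le cs R.nonneg[OF h] \<epsilon> by (smt (verit) mult_nonneg_nonneg)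
    also have "\<dots> \<le> ?g / \<epsilon> * ?g" using hg h0 by (intro mult_right_mono) auto
    also have "\<dots> = l2_inner L g g / \<epsilon>" using gg by simp
    finally have "h1_inner \<Omega> z z \<le> l2_inner L g g / (\<kappa>low * \<epsilon>)"
      using \<kappa>low \<epsilon> by (simp add: field_simps)
    then have "?z \<le> sqrt (l2_inner L g g / (\<kappa>low * \<epsilon>))" by (rule real_sqrt_le_mono)
    then have zg: "?z \<le> ?g / sqrt (\<kappa>low * \<epsilon>)" by (simp add: real_sqrt_divide)
    have "h1_inner \<Omega> (y - yd) z \<le> sqrt (h1_inner \<Omega> (y - yd) (y - yd)) * ?z"
      using H.Cauchy_Schwarz[OF w_H1 V_H1[OF z]] by simp
    moreover have "\<gamma> * l2_inner L \<xi> z \<le> \<bar>\<gamma>\<bar> * (sqrt (l2_inner L \<xi> \<xi>) * ?z)"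
    proof -
      have "\<gamma> * l2_inner L \<xi> z \<le> \<bar>\<gamma>\<bar> * \<bar>l2_inner L \<xi> z\<bar>" by (metis abs_ge_self abs_mult)
      also have "\<dots> \<le> \<bar>\<gamma>\<bar> * (sqrt (l2_inner L \<xi> \<xi>) * ?z)"
        using l2_functional(2)[OF sol_mem(4) z] by (intro mult_left_mono) auto
      finally show ?thesis .
    qed
    moreover have "l2_inner L q h \<le> Mh * ?h" using R.Cauchy_Schwarz[OF q_L2 h] by (simp add: Mh_def)
    moreover have "l2_inner LC u 0 = 0" using sol_mem by (simp add: C.ip_zero)
    ultimately have "dJ z h 0 \<le> Mz * ?z + Mh * ?h"
      unfolding dJ_def Mz_def by (simp add: algebra_simps)
    also have "\<dots> \<le> Mz * (?g / sqrt (\<kappa>low * \<epsilon>)) + Mh * (?g / \<epsilon>)"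
      by (intro add_mono mult_left_mono zg hg Mz Mh)
    finally show ?thesis by (simp add: algebra_simps)
  qed
  then show ?thesis using that by blast
qed

text \<open>\<open>s\<close> is a slack variable: the first component records how far the constraint
  function is from a given non-negative function, and y' is subject to no sign condition. Letting s
  range over all non-negative functions is what later yields the sign of the multiplier and
  complementarity.\<close>

lemma multiplier_exists:
  obtains lam where "lam \<in> L2 L"
    "\<And>y' \<eta> v s. \<lbrakk>y' \<in> V; \<eta> \<in> L2 L; v \<in> L2 LC; s \<in> L2 L; state y' \<eta> v;
       AE x in L. 0 \<le> \<eta> x; AE x in LC. 0 \<le> v x; AE x in L. 0 \<le> s x\<rbrakk>
      \<Longrightarrow> l2_inner L lam (y' + \<epsilon> *\<^sub>R \<eta> - s) \<le> dJ y' \<eta> v - dJ y \<xi> u"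
proof -
  define P where "P y' \<eta> v s \<longleftrightarrow> y' \<in> V \<and> \<eta> \<in> L2 L \<and> v \<in> L2 LC \<and> s \<in> L2 L \<and> state y' \<eta> v \<and>
     (AE x in L. 0 \<le> \<eta> x) \<and> (AE x in LC. 0 \<le> v x) \<and> (AE x in L. 0 \<le> s x)"
    for y' \<eta> v and s :: "'a \<Rightarrow> real"
  define D where "D = {(y' + \<epsilon> *\<^sub>R \<eta> - s, dJ y' \<eta> v - dJ y \<xi> u) | y' \<eta> v s. P y' \<eta> v s}"
  obtain M where M: "\<And>g z h. \<lbrakk>z \<in> V; h \<in> L2 L; g \<in> L2 L; \<epsilon> * l2_inner L h h + a z z \<le> l2_inner L h g\<rbrakk>
      \<Longrightarrow> dJ z h 0 \<le> M * sqrt (l2_inner L g g)" using dJ_bound by blast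
  have D1: "D \<subseteq> L2 L \<times> UNIV" by (auto simp: D_def P_def V_L2)
  have D2: "convex D"
  proof (rule convexI)
    fix d e and s t :: real assume d: "d \<in> D" and e: "e \<in> D" and st: "0 \<le> s" "0 \<le> t" "s + t = 1"
    obtain y1 \<eta>1 v1 s1 where d': "d = (y1 + \<epsilon> *\<^sub>R \<eta>1 - s1, dJ y1 \<eta>1 v1 - dJ y \<xi> u)" and p1: "P y1 \<eta>1 v1 s1"
      using d by (auto simp: D_def)
    obtain y2 \<eta>2 v2 s2 where e': "e = (y2 + \<epsilon> *\<^sub>R \<eta>2 - s2, dJ y2 \<eta>2 v2 - dJ y \<xi> u)" and p2: "P y2 \<eta>2 v2 s2"
      using e by (auto simp: D_def)
    have "P (s *\<^sub>R y1 + t *\<^sub>R y2) (s *\<^sub>R \<eta>1 + t *\<^sub>R \<eta>2) (s *\<^sub>R v1 + t *\<^sub>R v2) (s *\<^sub>R s1 + t *\<^sub>R s2)"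
      using p1 p2 st unfolding P_def
      by (intro conjI state_convex AE_convex_nonneg) (simp_all del: plus_fun_apply scaleR_fun_apply)
    then have "(s *\<^sub>R y1 + t *\<^sub>R y2 + \<epsilon> *\<^sub>R (s *\<^sub>R \<eta>1 + t *\<^sub>R \<eta>2) - (s *\<^sub>R s1 + t *\<^sub>R s2),
       dJ (s *\<^sub>R y1 + t *\<^sub>R y2) (s *\<^sub>R \<eta>1 + t *\<^sub>R \<eta>2) (s *\<^sub>R v1 + t *\<^sub>R v2) - dJ y \<xi> u) \<in> D"
      unfolding D_def by blast
    moreover have "s *\<^sub>R y1 + t *\<^sub>R y2 + \<epsilon> *\<^sub>R (s *\<^sub>R \<eta>1 + t *\<^sub>R \<eta>2) - (s *\<^sub>R s1 + t *\<^sub>R s2) =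
        s *\<^sub>R (y1 + \<epsilon> *\<^sub>R \<eta>1 - s1) + t *\<^sub>R (y2 + \<epsilon> *\<^sub>R \<eta>2 - s2)"
      by (simp add: algebra_simps)
    moreover have "dJ (s *\<^sub>R y1 + t *\<^sub>R y2) (s *\<^sub>R \<eta>1 + t *\<^sub>R \<eta>2) (s *\<^sub>R v1 + t *\<^sub>R v2) - dJ y \<xi> u =
        s * (dJ y1 \<eta>1 v1 - dJ y \<xi> u) + t * (dJ y2 \<eta>2 v2 - dJ y \<xi> u)"
    proof -
      have "s * dJ y \<xi> u + t * dJ y \<xi> u = dJ y \<xi> u" using st(3) by (metis distrib_right mult_1)
      then show ?thesis using dJ_linear(1)[of y1 \<eta>1 v1 y2 \<eta>2 v2 s t] p1 p2 by (simp add: P_def algebra_simps)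
    qed
    ultimately show "s *\<^sub>R d + t *\<^sub>R e \<in> D" by (simp add: d' e')
  qed
  have D3: "D \<noteq> {}"
  proof -
    have "P y \<xi> u 0" using feas_sol by (auto simp: P_def feasible_def)
    then show ?thesis unfolding D_def by blast
  qed
  have D4: "- M * sqrt (l2_inner L g g) \<le> r" if gr: "(g, r) \<in> D" for g r
  proof -
    obtain y' \<eta> v s where g: "g = y' + \<epsilon> *\<^sub>R \<eta> - s" and r: "r = dJ y' \<eta> v - dJ y \<xi> u" and p: "P y' \<eta> v s"
      using gr by (auto simp: D_def)
    have gL: "g \<in> L2 L" using p V_L2 by (simp add: g P_def)
    have mgL: "(-1) *\<^sub>R g \<in> L2 L" by (rule R.mem(4)[OF gL])
    obtain z h where z: "z \<in> V" and h: "h \<in> L2 L" "AE x in L. 0 \<le> h x"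
      and zh: "\<And>\<phi>. \<phi> \<in> V \<Longrightarrow> a z \<phi> = l2_inner L h \<phi>"
      and ge: "AE x in L. ((-1) *\<^sub>R g) x \<le> z x + \<epsilon> * h x"
      and bd: "\<epsilon> * l2_inner L h h + a z z \<le> l2_inner L h ((-1) *\<^sub>R g)"
      using complementarity[OF \<epsilon> mgL] by blast
    \<comment> \<open>After the repair of -g the constraint function is s + (g + z + \<epsilon> h),
      a sum of two non-negative functions.\<close>
    have "feas (y' + z) (\<eta> + h) (v + 0)"
      unfolding feasible_def
    proof (intro conjI)
      show "state (y' + z) (\<eta> + h) (v + 0)"
        using p z h zh by (auto simp: P_def state_equation_iff A.add_left R.add_left V_L2)
      have "AE x in L. 0 \<le> s x" "AE x in L. 0 \<le> \<eta> x" using p by (auto simp: P_def)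
      then show "AE x in L. 0 \<le> (y' + z) x + \<epsilon> * (\<eta> + h) x"
        using ge by eventually_elim (simp add: g algebra_simps)
      show "AE x in L. 0 \<le> (\<eta> + h) x"
        using \<open>AE x in L. 0 \<le> \<eta> x\<close> h(2) by eventually_elim simp
    qed (use p z h in \<open>auto simp: P_def\<close>)
    then have "dJ y \<xi> u \<le> dJ (y' + z) (\<eta> + h) (v + 0)" by (rule first_order)
    also have "\<dots> = dJ y' \<eta> v + dJ z h 0"
      using p z h by (intro dJ_linear(2)) (auto simp: P_def)
    also have "dJ z h 0 \<le> M * sqrt (l2_inner L ((-1) *\<^sub>R g) ((-1) *\<^sub>R g))"
      by (rule M[OF z h(1) mgL bd])
    also have "l2_inner L ((-1) *\<^sub>R g) ((-1) *\<^sub>R g) = l2_inner L g g" by (simp add: l2_inner_def)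
    finally show ?thesis by (simp add: r)
  qed
  \<comment> \<open>Both sides of the bound are positively homogeneous, so it extends from
    \<open>D\<close> to the cone generated by \<open>D\<close>.\<close>
  obtain lam where lam: "lam \<in> L2 L" and lamD: "\<And>g r. (g, r) \<in> conic hull D \<Longrightarrow> l2_inner L lam g \<le> r"
  proof (rule R.conic_multiplier[of "conic hull D" M])
    show "conic hull D \<subseteq> L2 L \<times> UNIV" using D1 by (auto simp: conic_hull_explicit)
    show "convex (conic hull D)" by (rule convex_conic_hull[OF D2])
    show "conic (conic hull D)" by (rule conic_conic_hull)
    show "conic hull D \<noteq> {}" using D3 hull_subset[of D conic] by auto
    fix g r assume "(g, r) \<in> conic hull D"
    then obtain t g' r' where t: "0 \<le> t" and g: "g = t *\<^sub>R g'" and r: "r = t * r'" and d: "(g', r') \<in> D"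
      by (auto simp: conic_hull_explicit)
    have gL: "g' \<in> L2 L" using d D1 by auto
    have "sqrt (l2_inner L g g) = t * sqrt (l2_inner L g' g')"
      using gL t by (simp add: g R.scaleR_left R.scaleR_right real_sqrt_mult)
    then have "- M * sqrt (l2_inner L g g) = t * (- M * sqrt (l2_inner L g' g'))" by simp
    also have "\<dots> \<le> r" unfolding r using D4[OF d] t by (rule mult_left_mono)
    finally show "- M * sqrt (l2_inner L g g) \<le> r" .
  qed blast
  show ?thesis
  proof (rule that[OF lam])
    fix y' \<eta> v and s :: "'a \<Rightarrow> real"
    assume "y' \<in> V" "\<eta> \<in> L2 L" "v \<in> L2 LC" "s \<in> L2 L" "state y' \<eta> v"
       "AE x in L. 0 \<le> \<eta> x" "AE x in LC. 0 \<le> v x" "AE x in L. 0 \<le> s x"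
    then have "P y' \<eta> v s" by (simp add: P_def)
    then have "(y' + \<epsilon> *\<^sub>R \<eta> - s, dJ y' \<eta> v - dJ y \<xi> u) \<in> D" unfolding D_def by blast
    then show "l2_inner L lam (y' + \<epsilon> *\<^sub>R \<eta> - s) \<le> dJ y' \<eta> v - dJ y \<xi> u"
      by (intro lamD hull_inc)
  qed
qed

text \<open>The witness \<tau> times the trace of p shows that the choice in \<open>B_adj\<close> is
  not vacuous; afterwards only the pairing with functions on \<Gamma>C matters.\<close>

lemma B_adj:
  assumes p: "p \<in> V"
  shows "B_adj \<Gamma>C \<gamma>0 \<tau> p \<in> L2 LC" "v \<in> L2 LC \<Longrightarrow> l2_inner LC v (B_adj \<Gamma>C \<gamma>0 \<tau> p) = b v p"
proof -
  have t: "\<gamma>0 p \<in> L2 LC" by (rule trace_L2[OF \<Gamma>C V_H1[OF p]])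
  have "\<exists>q. q \<in> L2 LC \<and> (\<forall>v\<in>L2 LC. l2_inner LC v q = b v p)"
    using t by (intro exI[of _ "\<tau> *\<^sub>R \<gamma>0 p"]) (simp add: C.scaleR_right B_op_def)
  from someI_ex[OF this] show "B_adj \<Gamma>C \<gamma>0 \<tau> p \<in> L2 LC"
    "v \<in> L2 LC \<Longrightarrow> l2_inner LC v (B_adj \<Gamma>C \<gamma>0 \<tau> p) = b v p" by (simp_all add: B_adj_def)
qed

text \<open>The inequality \<open>key\<close> is used in two ways. At the solution with varying
  slack it gives the sign of the multiplier and complementarity; with slack 0 and arbitrary \<eta>,
  v it gives the variational inequalities, once the adjoint state has eliminated the state
  increment.\<close>

lemma optimality_system:
  assumes ybar: "ybar \<in> L2 L" and \<xi>bar: "\<xi>bar \<in> L2 L"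
  shows "\<exists>p\<in>V. \<exists>lam\<in>L2 L.
    (\<forall>\<phi>\<in>V. a p \<phi> + h1_inner \<Omega> (y - yd) \<phi> + \<gamma> * l2_inner L \<xi> \<phi> - l2_inner L lam \<phi> = 0) \<and>
    (AE x in L. 0 \<le> lam x) \<and>
    l2_inner L (y + \<epsilon> *\<^sub>R \<xi>) lam = 0 \<and>
    (\<forall>\<eta>\<in>L2 L. (AE x in L. 0 \<le> \<eta> x) \<longrightarrow> 0 \<le> l2_inner L (q - p - \<epsilon> *\<^sub>R lam) (\<eta> - \<xi>)) \<and>
    (\<forall>v\<in>L2 LC. (AE x in LC. 0 \<le> v x) \<longrightarrow> 0 \<le> l2_inner LC (\<nu> *\<^sub>R u - B_adj \<Gamma>C \<gamma>0 \<tau> p) (v - u))"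
proof -
  obtain lam where lam: "lam \<in> L2 L"
    and key: "\<And>y' \<eta> v s. \<lbrakk>y' \<in> V; \<eta> \<in> L2 L; v \<in> L2 LC; s \<in> L2 L; state y' \<eta> v;
       AE x in L. 0 \<le> \<eta> x; AE x in LC. 0 \<le> v x; AE x in L. 0 \<le> s x\<rbrakk>
      \<Longrightarrow> l2_inner L lam (y' + \<epsilon> *\<^sub>R \<eta> - s) \<le> dJ y' \<eta> v - dJ y \<xi> u"
    using multiplier_exists by blast
  let ?w = "y + \<epsilon> *\<^sub>R \<xi>"
  have sol': "state y \<xi> u" "AE x in L. 0 \<le> \<xi> x" "AE x in LC. 0 \<le> u x" "AE x in L. 0 \<le> ?w x"
    using feas_sol by (auto simp: feasible_def)
  have w: "?w \<in> L2 L" using sol_mem by simp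
  have lamw: "l2_inner L lam (?w - s) \<le> 0" if "s \<in> L2 L" "AE x in L. 0 \<le> s x" for s
    using key[OF sol_mem(1,4,5) that(1) sol'(1,2,3) that(2)] by simp
  have lam0: "AE x in L. 0 \<le> lam x"
  proof (rule L2_nonneg_dual[OF finite_measure_lebesgue_on[OF open_dom bounded_dom] lam])
    fix s :: "'a \<Rightarrow> real" assume s: "s \<in> L2 L" "AE x in L. 0 \<le> s x"
    \<comment> \<open>The slack \<open>?w + s\<close> is admissible and leaves - (lam, s) \<le>
      0.\<close>
    have "AE x in L. 0 \<le> (?w + s) x" using sol'(4) s(2) by eventually_elim simp
    then have "l2_inner L lam (?w - (?w + s)) \<le> 0" using w s by (intro lamw) simp_all
    then show "0 \<le> l2_inner L lam s" using R.diff_right[OF w R.mem(2)[OF w s(1)] lam] R.add_right[OF w s(1) lam]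
      by simp
  qed
  \<comment> \<open>Slack 0 gives one direction; the other holds because both factors are
    non-negative.\<close>
  have lamw0: "l2_inner L lam ?w = 0"
  proof (rule antisym)
    show "l2_inner L lam ?w \<le> 0" using lamw[of 0] by simp
    show "0 \<le> l2_inner L lam ?w" by (rule l2_inner_nonneg[OF lam0 sol'(4)])
  qed
  \<comment> \<open>The right-hand side of the adjoint equation collects, with opposite sign, all
    terms of \<open>dJ\<close> and of the multiplier that contain the state increment.\<close>
  define l where "l \<phi> = l2_inner L lam \<phi> + ((- 1) * h1_inner \<Omega> (y - yd) \<phi> + (- \<gamma>) * l2_inner L \<xi> \<phi>)" for \<phi>
  have llin: "linear_functional_on V l"
    unfolding l_def using V_H1 w_H1
    by (intro linear_functional_on_add linear_functional_on_cmult l2_functional(1) lam sol_mem)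
      (auto simp: linear_functional_on_def H.ip_simps)
  have lbdd: "\<bar>l \<phi>\<bar> \<le> (sqrt (l2_inner L lam lam) + (sqrt (h1_inner \<Omega> (y - yd) (y - yd)) + \<bar>\<gamma>\<bar> * sqrt (l2_inner L \<xi> \<xi>)))
      * sqrt (h1_inner \<Omega> \<phi> \<phi>)" if \<phi>: "\<phi> \<in> V" for \<phi>
  proof -
    have "\<bar>\<gamma> * l2_inner L \<xi> \<phi>\<bar> \<le> \<bar>\<gamma>\<bar> * (sqrt (l2_inner L \<xi> \<xi>) * sqrt (h1_inner \<Omega> \<phi> \<phi>))"
      unfolding abs_mult using l2_functional(2)[OF sol_mem(4) \<phi>] by (intro mult_left_mono) auto
    then show ?thesis
      using l2_functional(2)[OF lam \<phi>] H.Cauchy_Schwarz[OF w_H1 V_H1[OF \<phi>]]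
      unfolding l_def by (simp add: distrib_right)
  qed
  obtain p where p: "p \<in> V" and ap: "\<And>\<phi>. \<phi> \<in> V \<Longrightarrow> a p \<phi> = l \<phi>"
    using state_exists[OF llin lbdd] by blast
  have main: "0 \<le> l2_inner L (q - p - \<epsilon> *\<^sub>R lam) (\<eta> - \<xi>) + l2_inner LC (\<nu> *\<^sub>R u - B_adj \<Gamma>C \<gamma>0 \<tau> p) (v - u)"
    if \<eta>: "\<eta> \<in> L2 L" "AE x in L. 0 \<le> \<eta> x" and v: "v \<in> L2 LC" "AE x in LC. 0 \<le> v x" for \<eta> v
  proof -
    have f: "\<eta> + ybar - \<xi>bar \<in> L2 L" using \<eta> ybar \<xi>bar by simp
    obtain y' where y': "y' \<in> V" and ay': "\<And>\<phi>. \<phi> \<in> V \<Longrightarrow> a y' \<phi> = b v \<phi> + l2_inner L (\<eta> + ybar - \<xi>bar) \<phi>"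
      using state_for_data[OF v(1) f] by blast
    have st: "state y' \<eta> v"
      unfolding state_equation_iff using ay' \<eta> ybar \<xi>bar by (simp add: R.ip_simps V_L2)
    have "l2_inner L lam (y' + \<epsilon> *\<^sub>R \<eta> - 0) \<le> dJ y' \<eta> v - dJ y \<xi> u"
      by (rule key) (use y' \<eta> v st in simp_all)
    then have le: "l2_inner L lam (y' + \<epsilon> *\<^sub>R \<eta>) \<le> dJ (y' - y) (\<eta> - \<xi>) (v - u)"
      using dJ_linear(3)[OF y' \<eta>(1) v(1) sol_mem(1,4,5)] by simp
    define z h k where "z = y' - y" and "h = \<eta> - \<xi>" and "k = v - u"
    have m: "z \<in> V" "z \<in> L2 L" "h \<in> L2 L" "k \<in> L2 LC"
      using y' \<eta> v sol_mem V_L2 by (simp_all add: z_def h_def k_def)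
    have "y' + \<epsilon> *\<^sub>R \<eta> = ?w + (z + \<epsilon> *\<^sub>R h)" by (simp add: z_def h_def algebra_simps)
    then have "l2_inner L lam (y' + \<epsilon> *\<^sub>R \<eta>) = l2_inner L lam ?w + (l2_inner L lam z + \<epsilon> * l2_inner L lam h)"
      using lam w m by (simp only: R.add_right R.scaleR_right R.mem)
    then have 1: "l2_inner L lam z + \<epsilon> * l2_inner L lam h \<le> dJ z h k"
      using le lamw0 by (simp add: z_def h_def k_def)
    have "a y p = b u p + l2_inner L \<xi> p + l2_inner L ybar p - l2_inner L \<xi>bar p"
      "a y' p = b v p + l2_inner L \<eta> p + l2_inner L ybar p - l2_inner L \<xi>bar p"
      using sol'(1) st p unfolding state_equation_iff by blast+
    moreover have "a z p = a y' p - a y p" using y' sol_mem p by (simp add: z_def A.diff_left)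
    moreover have "l2_inner L h p = l2_inner L \<eta> p - l2_inner L \<xi> p"
      using \<eta> sol_mem p V_L2 by (simp add: h_def R.diff_left)
    moreover have "b k p = b v p - b u p"
      using v sol_mem trace_L2[OF \<Gamma>C V_H1[OF p]] by (simp add: k_def B_op_def C.diff_left right_diff_distrib)
    \<comment> \<open>By symmetry of \<open>a\<close>, the adjoint form tested with z is the
      difference of the two state equations tested with p. The terms in z are thus traded for terms
      in h and k.\<close>
    ultimately have 2: "a p z = b k p + l2_inner L h p" using A_sym[of p z] by simp
    have 3: "a p z = l2_inner L lam z - h1_inner \<Omega> (y - yd) z - \<gamma> * l2_inner L \<xi> z"
      using ap[OF m(1)] by (simp add: l_def)
    have 4: "l2_inner L (q - p - \<epsilon> *\<^sub>R lam) h = l2_inner L q h - l2_inner L h p - \<epsilon> * l2_inner L lam h"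
      using q_L2 p V_L2 lam m R.sym[of p h] by (simp add: R.ip_simps)
    have 5: "l2_inner LC (\<nu> *\<^sub>R u - B_adj \<Gamma>C \<gamma>0 \<tau> p) k = \<nu> * l2_inner LC u k - b k p"
      using sol_mem m B_adj[OF p] C.sym[of "B_adj \<Gamma>C \<gamma>0 \<tau> p" k] by (simp add: C.diff_left C.scaleR_left)
    show ?thesis using 1 2 3 4 5 unfolding dJ_def h_def[symmetric] k_def[symmetric] by simp
  qed
  have adjoint: "\<forall>\<phi>\<in>V. a p \<phi> + h1_inner \<Omega> (y - yd) \<phi> + \<gamma> * l2_inner L \<xi> \<phi> - l2_inner L lam \<phi> = 0"
    using ap by (simp add: l_def)
  \<comment> \<open>The choice v = u removes the control term from the joint inequality;
    \<open>u_ineq\<close> takes \<eta> = \<xi> in the same way.\<close>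
  have q_ineq: "0 \<le> l2_inner L (q - p - \<epsilon> *\<^sub>R lam) (\<eta> - \<xi>)" if "\<eta> \<in> L2 L" "AE x in L. 0 \<le> \<eta> x" for \<eta>
  proof -
    have "l2_inner LC (\<nu> *\<^sub>R u - B_adj \<Gamma>C \<gamma>0 \<tau> p) (u - u) = 0"
      using sol_mem B_adj(1)[OF p] by (simp add: C.ip_zero)
    then show ?thesis using main[OF that sol_mem(5) sol'(3)] by simp
  qed
  have u_ineq: "0 \<le> l2_inner LC (\<nu> *\<^sub>R u - B_adj \<Gamma>C \<gamma>0 \<tau> p) (v - u)" if "v \<in> L2 LC" "AE x in LC. 0 \<le> v x" for v
  proof -
    have "l2_inner L (q - p - \<epsilon> *\<^sub>R lam) (\<xi> - \<xi>) = 0"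
      using q_L2 p V_L2 lam by (simp add: R.ip_zero)
    then show ?thesis using main[OF sol_mem(4) sol'(2) that] by simp
  qed
  show ?thesis
    using p lam adjoint lam0 lamw0 R.sym[OF lam w] q_ineq u_ineq by (intro bexI[of _ p] bexI[of _ lam]) auto
qed

end

theorem proposition5:
  fixes \<Omega> \<Gamma>N \<Gamma>D \<Gamma>C :: "'a::euclidean_space set"
    and \<gamma>0 :: "('a \<Rightarrow> real) \<Rightarrow> ('a \<Rightarrow> real)"
    and \<tau> tn \<kappa>low \<nu> \<gamma> :: real
    and eps :: "real \<Rightarrow> real"
    and vel :: "'a \<Rightarrow> real \<Rightarrow> 'a"
    and X :: "'a \<Rightarrow> 'a"
    and \<kappa> yprev \<xi>prev yd \<xi>d y \<xi> u :: "'a \<Rightarrow> real"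
  assumes dim: "DIM('a) = 1 \<or> DIM('a) = 2"
    and domain: "open \<Omega>" "bounded \<Omega>" "smooth_boundary \<Omega>"
    and parts: "\<Gamma>N \<subseteq> frontier \<Omega>" "\<Gamma>N \<in> sets borel"
      "\<Gamma>D \<subseteq> frontier \<Omega>" "\<Gamma>D \<in> sets borel"
      "\<Gamma>C \<subseteq> frontier \<Omega>" "\<Gamma>C \<in> sets borel"
    and trace: "trace_operator \<Omega> \<gamma>0"
    and step: "\<tau> > 0"
    and diffusion: "\<kappa> \<in> L_infinity (lebesgue_on \<Omega>)"
    and coercive: "\<kappa>low > 0"
      "\<forall>\<psi>\<in>H1_D \<Omega> \<Gamma>D \<gamma>0. A_op \<Omega> \<tau> \<kappa> \<psi> \<psi> \<ge> \<kappa>low * (h1_norm \<Omega> \<psi>)\<^sup>2"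
    and convection: "\<And>x. X x = x - \<tau> *\<^sub>R vel x tn" "X ` \<Omega> \<subseteq> \<Omega>"
    and previous: "yprev \<in> H1_D \<Omega> \<Gamma>D \<gamma>0" "\<xi>prev \<in> L2 (lebesgue_on \<Omega>)"
      "yprev \<circ> X \<in> L2 (lebesgue_on \<Omega>)" "\<xi>prev \<circ> X \<in> L2 (lebesgue_on \<Omega>)"
    and desired: "yd \<in> H1 \<Omega>" "\<xi>d \<in> L2 (lebesgue_on \<Omega>)"
    and parameters: "\<nu> > 0" "\<gamma> > 0" "\<forall>g>0. eps g > 0"
      "(eps \<longlongrightarrow> 0) at_top" "((\<lambda>g. eps g * g) \<longlongrightarrow> 0) at_top"
    and sol: "solution \<Omega> \<Gamma>D \<Gamma>C \<gamma>0 \<tau> \<kappa> (yprev \<circ> X) (\<xi>prev \<circ> X) yd \<xi>d \<nu> \<gamma> (eps \<gamma>) y \<xi> u"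
  shows "\<exists>p \<in> H1_D \<Omega> \<Gamma>D \<gamma>0. \<exists>lam \<in> L2 (lebesgue_on \<Omega>).
    (\<forall>\<phi>\<in>H1_D \<Omega> \<Gamma>D \<gamma>0.
       A_op \<Omega> \<tau> \<kappa> y \<phi> - B_op \<Gamma>C \<gamma>0 \<tau> u \<phi> - l2_inner (lebesgue_on \<Omega>) \<xi> \<phi>
       - l2_inner (lebesgue_on \<Omega>) (yprev \<circ> X) \<phi> + l2_inner (lebesgue_on \<Omega>) (\<xi>prev \<circ> X) \<phi> = 0) \<and>
    (\<forall>\<phi>\<in>H1_D \<Omega> \<Gamma>D \<gamma>0.
       A_op \<Omega> \<tau> \<kappa> p \<phi> + h1_inner \<Omega> (\<lambda>x. y x - yd x) \<phi>
       + \<gamma> * l2_inner (lebesgue_on \<Omega>) \<xi> \<phi> - l2_inner (lebesgue_on \<Omega>) lam \<phi> = 0) \<and>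
    (AE x in lebesgue_on \<Omega>. 0 \<le> y x + eps \<gamma> * \<xi> x) \<and>
    (AE x in lebesgue_on \<Omega>. 0 \<le> lam x) \<and>
    l2_inner (lebesgue_on \<Omega>) (\<lambda>x. y x + eps \<gamma> * \<xi> x) lam = 0 \<and>
    (AE x in lebesgue_on \<Omega>. 0 \<le> \<xi> x) \<and>
    (\<forall>\<eta> \<in> L2 (lebesgue_on \<Omega>). (AE x in lebesgue_on \<Omega>. 0 \<le> \<eta> x) \<longrightarrow>
       0 \<le> l2_inner (lebesgue_on \<Omega>)
         (\<lambda>x. \<xi> x - \<xi>d x + 2 * \<gamma> * eps \<gamma> * \<xi> x + \<gamma> * y x - p x - eps \<gamma> * lam x)
         (\<lambda>x. \<eta> x - \<xi> x)) \<and>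
    (AE x in surface \<Gamma>C. 0 \<le> u x) \<and>
    (\<forall>v \<in> L2 (surface \<Gamma>C). (AE x in surface \<Gamma>C. 0 \<le> v x) \<longrightarrow>
       0 \<le> l2_inner (surface \<Gamma>C)
         (\<lambda>x. \<nu> * u x - B_adj \<Gamma>C \<gamma>0 \<tau> p x) (\<lambda>x. v x - u x))"
proof -
  interpret optimal_control \<Omega> \<gamma>0 \<Gamma>D \<Gamma>C \<tau> \<kappa>low \<kappa> "yprev \<circ> X" "\<xi>prev \<circ> X" yd \<xi>d y \<xi> u \<nu> \<gamma> "eps \<gamma>"
  proof
    show tr: "trace_operator \<Omega> \<gamma>0" by (rule trace)
    show "trace_space.bpart \<Omega> \<Gamma>D" "trace_space.bpart \<Omega> \<Gamma>C"
      using parts domain tr by (simp_all add: trace_space.bpart_def trace_space_def trace_space_axioms_def bounded_open_def)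
  qed (use domain step diffusion coercive desired parameters sol in auto)
  obtain p lam where p: "p \<in> V" and lam: "lam \<in> L2 L"
    and adj: "\<And>\<phi>. \<phi> \<in> V \<Longrightarrow> a p \<phi> + h1_inner \<Omega> (y - yd) \<phi> + \<gamma> * l2_inner L \<xi> \<phi> - l2_inner L lam \<phi> = 0"
    and lam0: "AE x in L. 0 \<le> lam x" and compl: "l2_inner L (y + eps \<gamma> *\<^sub>R \<xi>) lam = 0"
    and q_ineq: "\<And>\<eta>. \<lbrakk>\<eta> \<in> L2 L; AE x in L. 0 \<le> \<eta> x\<rbrakk> \<Longrightarrow> 0 \<le> l2_inner L (q - p - eps \<gamma> *\<^sub>R lam) (\<eta> - \<xi>)"
    and u_ineq: "\<And>v. \<lbrakk>v \<in> L2 LC; AE x in LC. 0 \<le> v x\<rbrakk> \<Longrightarrow> 0 \<le> l2_inner LC (\<nu> *\<^sub>R u - B_adj \<Gamma>C \<gamma>0 \<tau> p) (v - u)"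
    using optimality_system[OF previous(3,4)] by blast
  \<comment> \<open>Converts the pointwise expressions of the statement into vector operations on
    functions.\<close>
  have e: "(\<lambda>x. y x - yd x) = y - yd" "(\<lambda>x. y x + eps \<gamma> * \<xi> x) = y + eps \<gamma> *\<^sub>R \<xi>"
    "(\<lambda>x. \<xi> x - \<xi>d x + 2 * \<gamma> * eps \<gamma> * \<xi> x + \<gamma> * y x - p x - eps \<gamma> * lam x) = q - p - eps \<gamma> *\<^sub>R lam"
    "(\<lambda>x. \<nu> * u x - B_adj \<Gamma>C \<gamma>0 \<tau> p x) = \<nu> *\<^sub>R u - B_adj \<Gamma>C \<gamma>0 \<tau> p"
    "\<And>\<eta>. (\<lambda>x. \<eta> x - \<xi> x) = \<eta> - \<xi>" "\<And>v. (\<lambda>x. v x - u x) = v - u"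
    by (simp_all add: fun_eq_iff q_def)
  have st: "\<forall>\<phi>\<in>V. a y \<phi> - b u \<phi> - l2_inner L \<xi> \<phi> - l2_inner L (yprev \<circ> X) \<phi> + l2_inner L (\<xi>prev \<circ> X) \<phi> = 0"
    using feas_sol by (simp add: feasible_def state_equation_iff)
  have signs: "AE x in L. 0 \<le> y x + eps \<gamma> * \<xi> x" "AE x in L. 0 \<le> \<xi> x" "AE x in LC. 0 \<le> u x"
    using feas_sol by (simp_all add: feasible_def)
  show ?thesis
    using p lam st adj lam0 compl q_ineq u_ineq signs
    by (intro bexI[of _ p] bexI[of _ lam] conjI; simp only: e) blast+
qed

end
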